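(* Let $H$ be a fixed finite simple graph with $d^*>1$ and let $\alpha\in[0,1)$ be fixed. Let the edges of $K_n$ carry i.i.d. $\mathrm{Exp}(1)$ weights, with $n$ ranging over multiples of $v_H$. Then there are constants $0<a<b$ such that $$a n^{1-1/d^*}\le F_H(\alpha n,n)\le b n^{1-1/d^*}$$ with probability $1-n^{-\omega(1)}$. Furthermore, $F_H(\alpha n,n)$ is sharply concentrated around its median value $M=M(n)$: $$|F_H(\alpha n,n)-M|=O_{\mathbb{P}}(M^{3/4})\quad\text{as } n\to\infty.$$
   Context: For a graph $G$, $v_G$ and $e_G$ denote its numbers of vertices and edges. For $v_G\ge 2$, $d_G:=e_G/(v_G-1)$, and $d^*:=\max\{d_G: G\subseteq H,\ v_G\ge 2\}$. An $(\alpha,H)$-factor on $K_n$ is a collection $Q$ of pairwise vertex-disjoint (not necessarily induced) subgraphs of $K_n$, each isomorphic to $H$, such that at most $\alpha n$ vertices of $K_n$ are not covered by $Q$. Given edge weights $(X_e)$, its weight is $W_Q:=\sum_{H'\in Q}\sum_{e\in\mathcal{E}(H')}X_e$, where $\mathcal{E}(H')$ is the edge set of $H'$. Define $F_H(k,n):=\min\{W_Q: Q \text{ is a } (k/n,H)\text{-factor on } K_n\}$, i.e. the minimum weight of a partial factor leaving at most $k$ vertices uncovered. "With probability $1-n^{-\omega(1)}$" means that the failure probability is, for every fixed $K>0$, at most $n^{-K}$ for all sufficiently large $n$. For random variables $X_n,Y_n$ (possibly deterministic), $X_n=O_{\mathbb{P}}(Y_n)$ means: for every $\varepsilon>0$ there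 is $C=C(\varepsilon)$ such that $\mathbb{P}(|X_n|>C|Y_n|)<\varepsilon$ for all sufficiently large $n$. *)

theory Defs
  imports "HOL-Probability.Probability" "HOL-Library.Ramsey"
begin

type_synonym 'a graph = "'a set \<times> 'a set set"

abbreviation verts :: "'a graph \<Rightarrow> 'a set" where
  "verts G \<equiv> fst G"

abbreviation edges :: "'a graph \<Rightarrow> 'a set set" where
  "edges G \<equiv> snd G"

definition finite_simple_graph :: "'a graph \<Rightarrow> bool" where
  "finite_simple_graph G \<longleftrightarrow> finite (verts G) \<and> edges G \<subseteq> nsets (verts G) 2"

definition subgraph_of :: "'a graph \<Rightarrow> 'a graph \<Rightarrow> bool" where
  "subgraph_of G H \<longleftrightarrow>
     finite_simple_graph G \<and> verts G \<subseteq> verts H \<and> edges G \<subseteq> edges H"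

definition graph_iso :: "'a graph \<Rightarrow> 'b graph \<Rightarrow> bool" where
  "graph_iso G H \<longleftrightarrow>
     (\<exists>f. bij_betw f (verts G) (verts H) \<and> edges H = (\<lambda>e. f ` e) ` edges G)"

definition complete_graph :: "nat \<Rightarrow> nat graph" where
  "complete_graph n = ({..<n}, nsets {..<n} 2)"

definition density1 :: "'a graph \<Rightarrow> real" where
  "density1 G = real (card (edges G)) / (real (card (verts G)) - 1)"

(* The maximum is over a finite set, which is nonempty iff H has at least two vertices;
   for smaller H the value is unspecified. *)
definition dstar :: "'a graph \<Rightarrow> real" where
  "dstar H = Max {density1 G |G. subgraph_of G H \<and> 2 \<le> card (verts G)}"

definition partial_factor :: "real \<Rightarrow> 'a graph \<Rightarrow> nat \<Rightarrow> nat graph set \<Rightarrow> bool" where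
  "partial_factor \<alpha> H n Q \<longleftrightarrow>
     (\<forall>G\<in>Q. subgraph_of G (complete_graph n) \<and> graph_iso G H) \<and>
     pairwise (\<lambda>G G'. disjnt (verts G) (verts G')) Q \<and>
     real (card (verts (complete_graph n) - (\<Union>G\<in>Q. verts G))) \<le> \<alpha> * real n"

definition factor_weight :: "(nat set \<Rightarrow> real) \<Rightarrow> nat graph set \<Rightarrow> real" where
  "factor_weight x Q = (\<Sum>G\<in>Q. \<Sum>e\<in>edges G. x e)"

(* F_H(k,n) for the edge weights x. There are finitely many factors on K_n, and at least one
   whenever k is nonnegative and the number of vertices of H divides n. *)
definition min_factor_weight ::
  "'a graph \<Rightarrow> (nat set \<Rightarrow> real) \<Rightarrow> real \<Rightarrow> nat \<Rightarrow> real" where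
  "min_factor_weight H x k n =
     Min {factor_weight x Q |Q. partial_factor (k / real n) H n Q}"

definition iid_exp1_weights :: "nat \<Rightarrow> 'w measure \<Rightarrow> (nat set \<Rightarrow> 'w \<Rightarrow> real) \<Rightarrow> bool" where
  "iid_exp1_weights n P X \<longleftrightarrow>
     prob_space P \<and>
     prob_space.indep_vars P (\<lambda>_. borel) X (edges (complete_graph n)) \<and>
     (\<forall>e\<in>edges (complete_graph n). distributed P lborel (X e) (exponential_density 1))"

definition is_median :: "'w measure \<Rightarrow> ('w \<Rightarrow> real) \<Rightarrow> real \<Rightarrow> bool" where
  "is_median P Y m \<longleftrightarrow>
     measure P {\<omega> \<in> space P. Y \<omega> \<le> m} \<ge> 1/2 \<and> measure P {\<omega> \<in> space P. Y \<omega> \<ge> m} \<ge> 1/2"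

(* n tends to infinity through the multiples of v *)
definition multiples_at_top :: "nat \<Rightarrow> nat filter" where
  "multiples_at_top v = inf sequentially (principal {n. v dvd n})"

(* The event A n has probability 1 - n^(-omega(1)) as n tends to infinity along Fl. *)
definition with_overwhelming_prob ::
  "nat filter \<Rightarrow> (nat \<Rightarrow> 'w measure) \<Rightarrow> (nat \<Rightarrow> 'w \<Rightarrow> bool) \<Rightarrow> bool" where
  "with_overwhelming_prob Fl P A \<longleftrightarrow>
     (\<forall>K>0. \<forall>\<^sub>F n in Fl.
        measure (P n) {\<omega> \<in> space (P n). \<not> A n \<omega>} \<le> real n powr (- K))"

definition bigO_in_prob ::
  "nat filter \<Rightarrow> (nat \<Rightarrow> 'w measure) \<Rightarrow> (nat \<Rightarrow> 'w \<Rightarrow> real) \<Rightarrow> (nat \<Rightarrow> 'w \<Rightarrow> real) \<Rightarrow> bool" where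
  "bigO_in_prob Fl P X Y \<longleftrightarrow>
     (\<forall>\<epsilon>>0. \<exists>C. \<forall>\<^sub>F n in Fl.
        measure (P n) {\<omega> \<in> space (P n). \<bar>X n \<omega>\<bar> > C * \<bar>Y n \<omega>\<bar>} < \<epsilon>)"

end

theory Submission
  imports Defs "HOL-Real_Asymp.Real_Asymp"
begin

text \<open>Write \<open>d = dstar H\<close>, which is the maximum of \<open>e(G) / (v(G) - 1)\<close> over the subgraphs \<open>G\<close>
of \<open>H\<close>.

The upper bound is greedy. Let \<open>S\<close> be a set of \<open>m\<close> vertices and call an edge light if its weight is
at most \<open>t = A (n/m)^\<delta> m^(-1/d)\<close>. For every subgraph \<open>G\<close> of \<open>H\<close> with an edge, the expected number
of light copies of \<open>G\<close> in \<open>S\<close> is at least a constant times \<open>A (n/m)^\<delta> m\<close>, so Janson's inequality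
(\<open>janson\<close>, \<open>no_copy_probability\<close>) shows that \<open>S\<close> contains no light copy of \<open>H\<close> with probability
exponentially small in \<open>A (n/m)^\<delta> m\<close>. For \<open>A\<close> large this beats the number of sets of size \<open>m\<close>
(\<open>all_large_sets_contain_copies\<close>). Therefore copies of \<open>H\<close> can be removed one after the other, each
at cost \<open>e(H) t\<close>, until \<open>n^c\<close> vertices are left; these are covered arbitrarily with edges of weight
at most \<open>n^c\<close>. As \<open>d > 1\<close>, the costs sum to \<open>O(n^(1-1/d))\<close>. Every vertex gets covered, so the
bound holds for all \<open>\<alpha> \<ge> 0\<close>.

The lower bound is a first moment computation. Let \<open>G\<close> be a subgraph of \<open>H\<close> that attains the
density \<open>d\<close>. A factor of weight below \<open>a n^(1-1/d)\<close> has linearly many members, at least half of which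
have weight \<open>O(a n^(-1/d))\<close>; they contain linearly many edge-disjoint copies of \<open>G\<close> all of whose
edges are that light, and for small \<open>a\<close> the expected number of such families of copies is
exponentially small (\<open>disjoint_light_copies_probability\<close>).

The concentration holds for the minimum \<open>f\<close> of \<open>\<Sum>e\<in>B. x e\<close> over any finite family of sets \<open>B\<close>. As
a function of one weight \<open>z\<close>, \<open>f\<close> equals a constant plus \<open>min z c\<close>, and for exponential \<open>z\<close> the
second moment of \<open>min z c\<close> is twice the expectation of \<open>z\<close> restricted to \<open>z < c\<close>. But \<open>z < c\<close> means
that the element with weight \<open>z\<close> belongs to every lightest set, hence these restricted weights sum
to at most \<open>f\<close>, and the Efron-Stein inequality yields \<open>Var f \<le> 2 E f\<close>
(\<open>capped_weight_variance\<close>). Chebyshev's inequality then gives fluctuations of order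
\<open>sqrt M\<close> around a median \<open>M \<ge> 1\<close>, which is stronger than \<open>M powr (3/4)\<close>.\<close>

section \<open>Random subsets: the inequalities of Harris and Janson\<close>

text \<open>The expectation of \<open>f R\<close> when \<open>R\<close> contains each element of \<open>U\<close> independently with probability
\<open>p\<close>. A finite sum makes inductions over \<open>U\<close> and derivatives of generating functions elementary.\<close>

definition bexp :: "real \<Rightarrow> 'e set \<Rightarrow> ('e set \<Rightarrow> real) \<Rightarrow> real" where
  "bexp p U f = (\<Sum>R\<in>Pow U. p ^ card R * (1 - p) ^ card (U - R) * f R)"

lemma bexp_empty [simp]: "bexp p {} f = f {}"
  by (simp add: bexp_def)

text \<open>Conditioning on whether \<open>a\<close> belongs to the random set.\<close>

lemma bexp_insert:
  assumes "finite U" "a \<notin> U"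
  shows "bexp p (insert a U) f = (1 - p) * bexp p U f + p * bexp p U (\<lambda>R. f (insert a R))"
proof -
  let ?g = "\<lambda>R. p ^ card R * (1 - p) ^ card (insert a U - R) * f R"
  have inj: "inj_on (insert a) (Pow U)"
    using assms by (auto simp: inj_on_def)
  have "bexp p (insert a U) f = sum ?g (Pow U \<union> insert a ` Pow U)"
    by (simp add: bexp_def Pow_insert)
  also have "\<dots> = sum ?g (Pow U) + sum ?g (insert a ` Pow U)"
    using assms by (intro sum.union_disjoint) auto
  also have "sum ?g (insert a ` Pow U) = (\<Sum>R\<in>Pow U. ?g (insert a R))"
    by (simp add: sum.reindex[OF inj])
  also have "\<dots> = p * bexp p U (\<lambda>R. f (insert a R))"
    unfolding bexp_def sum_distrib_left
  proof (intro sum.cong refl)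
    fix R assume R: "R \<in> Pow U"
    then have "finite R" "a \<notin> R" using assms finite_subset by auto
    moreover have "insert a U - insert a R = U - R" using assms R by auto
    ultimately show "?g (insert a R) = p * (p ^ card R * (1 - p) ^ card (U - R) * f (insert a R))"
      by simp
  qed
  also have "sum ?g (Pow U) = (1 - p) * bexp p U f"
    unfolding bexp_def sum_distrib_left
  proof (intro sum.cong refl)
    fix R assume R: "R \<in> Pow U"
    then have "insert a U - R = insert a (U - R)" using assms by auto
    then show "?g R = (1 - p) * (p ^ card R * (1 - p) ^ card (U - R) * f R)"
      using assms by simp
  qed
  finally show ?thesis .
qed

lemma bexp_add: "bexp p U (\<lambda>R. f R + g R) = bexp p U f + bexp p U g"
  by (simp add: bexp_def sum.distrib algebra_simps)

lemma bexp_cmult: "bexp p U (\<lambda>R. c * f R) = c * bexp p U f"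
  by (simp add: bexp_def sum_distrib_left algebra_simps)

lemma bexp_sum: "bexp p U (\<lambda>R. \<Sum>i\<in>J. f i R) = (\<Sum>i\<in>J. bexp p U (f i))"
  unfolding bexp_def sum_distrib_left by (rule sum.swap)

lemma bexp_cong: "(\<And>R. R \<subseteq> U \<Longrightarrow> f R = g R) \<Longrightarrow> bexp p U f = bexp p U g"
  unfolding bexp_def by (intro sum.cong) auto

lemma bexp_mono:
  assumes "0 \<le> p" "p \<le> 1" "\<And>R. R \<subseteq> U \<Longrightarrow> f R \<le> g R"
  shows "bexp p U f \<le> bexp p U g"
  unfolding bexp_def using assms by (intro sum_mono mult_left_mono) auto

lemma bexp_const: "finite U \<Longrightarrow> bexp p U (\<lambda>_. c) = c"
  by (induction U rule: finite_induct) (auto simp: bexp_insert algebra_simps)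

text \<open>Conditioned on containing \<open>A\<close>, the random set has the law of \<open>R \<union> A\<close>.\<close>

lemma bexp_subset_indicator:
  assumes "finite U" "A \<subseteq> U"
  shows "bexp p U (\<lambda>R. of_bool (A \<subseteq> R) * f R) = p ^ card A * bexp p U (\<lambda>R. f (R \<union> A))"
  using assms
proof (induction U arbitrary: A f rule: finite_induct)
  case empty
  then show ?case by auto
next
  case (insert a U)
  show ?case
  proof (cases "a \<in> A")
    case True
    define B where "B = A - {a}"
    have B: "B \<subseteq> U" "A = insert a B" "a \<notin> B" "finite B"
      using True insert.prems insert.hyps finite_subset[of B U] by (auto simp: B_def)
    have "bexp p U (\<lambda>R. of_bool (A \<subseteq> R) * f R) = bexp p U (\<lambda>_. 0)"
      using insert.hyps B by (intro bexp_cong) auto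
    then have z: "bexp p U (\<lambda>R. of_bool (A \<subseteq> R) * f R) = 0"
      using insert.hyps by (simp add: bexp_const)
    have "bexp p U (\<lambda>R. of_bool (A \<subseteq> insert a R) * f (insert a R))
        = bexp p U (\<lambda>R. of_bool (B \<subseteq> R) * f (insert a R))"
      using insert.hyps B by (intro bexp_cong) auto
    also have "\<dots> = p ^ card B * bexp p U (\<lambda>R. f (insert a (R \<union> B)))"
      using insert.IH[OF B(1), of "\<lambda>R. f (insert a R)"] by simp
    finally show ?thesis
      using z B insert.hyps by (simp add: bexp_insert algebra_simps)
  next
    case False
    then have A: "A \<subseteq> U" using insert.prems by auto
    have "bexp p U (\<lambda>R. of_bool (A \<subseteq> insert a R) * f (insert a R))
        = bexp p U (\<lambda>R. of_bool (A \<subseteq> R) * f (insert a R))"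
      using False by (intro bexp_cong) auto
    then show ?thesis
      using insert.IH[OF A, of f] insert.IH[OF A, of "\<lambda>R. f (insert a R)"] insert.hyps
      by (simp add: bexp_insert algebra_simps)
  qed
qed

text \<open>Conditioning on a single element \<open>a\<close>, both conditional expectations are smaller if \<open>a\<close> is present.
Two numbers that are ordered in the same way are positively correlated, and within each of the two
cases the induction hypothesis applies.\<close>

lemma harris_antimono:
  assumes "finite U" "0 \<le> p" "p \<le> 1"
    and "\<And>R S. R \<subseteq> S \<Longrightarrow> S \<subseteq> U \<Longrightarrow> f S \<le> f R"
    and "\<And>R S. R \<subseteq> S \<Longrightarrow> S \<subseteq> U \<Longrightarrow> g S \<le> g R"
  shows "bexp p U f * bexp p U g \<le> bexp p U (\<lambda>R. f R * g R)"
  using assms(1,4,5)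
proof (induction U arbitrary: f g rule: finite_induct)
  case empty
  then show ?case by simp
next
  case (insert a U)
  let ?f0 = "bexp p U f" and ?f1 = "bexp p U (\<lambda>R. f (insert a R))"
  let ?g0 = "bexp p U g" and ?g1 = "bexp p U (\<lambda>R. g (insert a R))"
  have f: "?f1 \<le> ?f0"
    by (intro bexp_mono assms(2,3) insert.prems(1)) auto
  have g: "?g1 \<le> ?g0"
    by (intro bexp_mono assms(2,3) insert.prems(2)) auto
  have a: "?f0 * ?g0 \<le> bexp p U (\<lambda>R. f R * g R)"
    by (rule insert.IH; rule insert.prems; auto)
  have b: "?f1 * ?g1 \<le> bexp p U (\<lambda>R. f (insert a R) * g (insert a R))"
    by (rule insert.IH; rule insert.prems; auto)
  have "0 \<le> p * (1 - p) * ((?f0 - ?f1) * (?g0 - ?g1))"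
    using f g assms by (intro mult_nonneg_nonneg) auto
  then have "((1 - p) * ?f0 + p * ?f1) * ((1 - p) * ?g0 + p * ?g1)
      \<le> (1 - p) * (?f0 * ?g0) + p * (?f1 * ?g1)"
    by (simp add: algebra_simps)
  also have "\<dots> \<le> (1 - p) * bexp p U (\<lambda>R. f R * g R)
      + p * bexp p U (\<lambda>R. f (insert a R) * g (insert a R))"
    using a b assms by (intro add_mono mult_left_mono) auto
  finally show ?case
    using insert.hyps by (simp add: bexp_insert)
qed

text \<open>Let \<open>X\<close> count the sets \<open>A i\<close> contained in the random set and let \<open>\<psi> s\<close> be the expectation of
\<open>exp (- s X)\<close>. Given that \<open>A i\<close> is present, \<open>X\<close> is at most a part \<open>Y i\<close> from the sets that meet
\<open>A i\<close> plus an unconditioned copy of \<open>X\<close>; Harris's inequality separates the two, and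
\<open>exp (- y) \<ge> 1 - y\<close> bounds the first one. This gives the differential inequality
\<open>\<psi>' \<le> - (\<mu> - s \<Delta>) \<psi>\<close>, and \<open>P (X = 0) \<le> \<psi> s\<close> is used at the optimal \<open>s = \<mu> / \<Delta>\<close>. The diagonal
pairs \<open>i = j\<close> are included in \<open>\<Delta>\<close>.\<close>

theorem janson:
  fixes A :: "'i \<Rightarrow> 'e set"
  assumes U: "finite U" and p: "0 \<le> p" "p \<le> 1" and J: "finite J"
    and A: "\<And>i. i \<in> J \<Longrightarrow> A i \<subseteq> U"
    and mu: "\<mu> = (\<Sum>i\<in>J. p ^ card (A i))"
    and Delta: "(\<Sum>i\<in>J. \<Sum>j\<in>{j\<in>J. A i \<inter> A j \<noteq> {}}. p ^ card (A i \<union> A j)) \<le> \<Delta>" "0 < \<Delta>"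
  shows "bexp p U (\<lambda>R. of_bool (\<forall>i\<in>J. \<not> A i \<subseteq> R)) \<le> exp (- (\<mu>\<^sup>2 / (2 * \<Delta>)))"
proof -
  define X where "X = (\<lambda>R. \<Sum>i\<in>J. of_bool (A i \<subseteq> R) :: real)"
  define Y where "Y = (\<lambda>i R. \<Sum>j\<in>{j\<in>J. A i \<inter> A j \<noteq> {}}. of_bool (A j \<subseteq> R) :: real)"
  define Z where "Z = (\<lambda>i R. \<Sum>j\<in>{j\<in>J. A i \<inter> A j = {}}. of_bool (A j \<subseteq> R) :: real)"
  have X_mono: "X R \<le> X S" if "R \<subseteq> S" for R S
    unfolding X_def using that by (intro sum_mono) (auto simp: of_bool_def)
  have Y_mono: "Y i R \<le> Y i S" if "R \<subseteq> S" for i R S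
    unfolding Y_def using that by (intro sum_mono) (auto simp: of_bool_def)
  have X_split: "X (R \<union> A i) \<le> Y i (R \<union> A i) + X R" for i R
  proof -
    have "X (R \<union> A i) = Y i (R \<union> A i) + Z i (R \<union> A i)"
      unfolding X_def Y_def Z_def using J
      by (subst sum.union_disjoint[symmetric]) (auto simp del: sum_of_bool_eq intro!: sum.cong)
    also have "Z i (R \<union> A i) = Z i R"
      unfolding Z_def by (intro sum.cong) auto
    also have "Z i R \<le> X R"
      unfolding Z_def X_def using J by (intro sum_mono2) auto
    finally show ?thesis by simp
  qed
  define \<psi> where "\<psi> = (\<lambda>s. bexp p U (\<lambda>R. exp (- (s * X R))))"
  define \<psi>' where "\<psi>' = (\<lambda>s. - (\<Sum>i\<in>J. bexp p U (\<lambda>R. of_bool (A i \<subseteq> R) * exp (- (s * X R)))))"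
  have deriv: "(\<psi> has_real_derivative \<psi>' s) (at s)" for s
  proof -
    have "(\<psi> has_real_derivative
        (\<Sum>R\<in>Pow U. p ^ card R * (1 - p) ^ card (U - R) * (exp (- (s * X R)) * - X R))) (at s)"
      unfolding \<psi>_def bexp_def by (auto intro!: derivative_eq_intros simp: mult_ac)
    also have "(\<Sum>R\<in>Pow U. p ^ card R * (1 - p) ^ card (U - R) * (exp (- (s * X R)) * - X R))
      = bexp p U (\<lambda>R. (-1) * (\<Sum>i\<in>J. of_bool (A i \<subseteq> R) * exp (- (s * X R))))"
      unfolding bexp_def
    proof (intro sum.cong refl)
      fix R
      have "(\<Sum>i\<in>J. of_bool (A i \<subseteq> R) * exp (- (s * X R))) = X R * exp (- (s * X R))"
        unfolding X_def by (rule sum_distrib_right[symmetric])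
      then show "p ^ card R * (1 - p) ^ card (U - R) * (exp (- (s * X R)) * - X R)
          = p ^ card R * (1 - p) ^ card (U - R)
            * (-1 * (\<Sum>i\<in>J. of_bool (A i \<subseteq> R) * exp (- (s * X R))))"
        by simp
    qed
    also have "\<dots> = \<psi>' s"
      unfolding \<psi>'_def bexp_cmult bexp_sum by simp
    finally show ?thesis .
  qed
  have psi_nonneg: "0 \<le> \<psi> s" for s
    using bexp_mono[OF p, of U "\<lambda>_. 0" "\<lambda>R. exp (- (s * X R))"] U by (simp add: \<psi>_def bexp_const)
  have key: "\<psi>' s \<le> - (\<mu> - s * \<Delta>) * \<psi> s" if s: "0 \<le> s" for s
  proof -
    have single: "p ^ card (A i) * (1 - s * bexp p U (\<lambda>R. Y i (R \<union> A i))) * \<psi> s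
        \<le> bexp p U (\<lambda>R. of_bool (A i \<subseteq> R) * exp (- (s * X R)))" if i: "i \<in> J" for i
    proof -
      have "1 - s * bexp p U (\<lambda>R. Y i (R \<union> A i)) = bexp p U (\<lambda>R. 1 + (- s) * Y i (R \<union> A i))"
        unfolding bexp_add bexp_cmult using U by (simp add: bexp_const)
      also have "\<dots> \<le> bexp p U (\<lambda>R. exp (- (s * Y i (R \<union> A i))))"
        using p by (intro bexp_mono) (auto intro: order.trans[OF _ exp_ge_add_one_self])
      finally have "(1 - s * bexp p U (\<lambda>R. Y i (R \<union> A i))) * \<psi> s
          \<le> bexp p U (\<lambda>R. exp (- (s * Y i (R \<union> A i)))) * \<psi> s"
        by (intro mult_right_mono psi_nonneg)
      also have "\<dots> \<le> bexp p U (\<lambda>R. exp (- (s * Y i (R \<union> A i))) * exp (- (s * X R)))"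
        unfolding \<psi>_def using s by (intro harris_antimono U p) (auto intro!: mult_left_mono X_mono Y_mono)
      also have "\<dots> \<le> bexp p U (\<lambda>R. exp (- (s * X (R \<union> A i))))"
      proof (intro bexp_mono p)
        fix R
        have "s * X (R \<union> A i) \<le> s * (Y i (R \<union> A i) + X R)"
          by (intro mult_left_mono X_split s)
        then show "exp (- (s * Y i (R \<union> A i))) * exp (- (s * X R)) \<le> exp (- (s * X (R \<union> A i)))"
          unfolding exp_add[symmetric] by (simp add: algebra_simps)
      qed
      finally have "p ^ card (A i) * ((1 - s * bexp p U (\<lambda>R. Y i (R \<union> A i))) * \<psi> s)
          \<le> p ^ card (A i) * bexp p U (\<lambda>R. exp (- (s * X (R \<union> A i))))"
        using p by (intro mult_left_mono) auto
      also have "\<dots> = bexp p U (\<lambda>R. of_bool (A i \<subseteq> R) * exp (- (s * X R)))"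
        using bexp_subset_indicator[OF U A[OF i], of p "\<lambda>R. exp (- (s * X R))"] by simp
      finally show ?thesis by (simp add: mult.assoc)
    qed
    have Yexp: "p ^ card (A i) * bexp p U (\<lambda>R. Y i (R \<union> A i))
        = (\<Sum>j\<in>{j\<in>J. A i \<inter> A j \<noteq> {}}. p ^ card (A i \<union> A j))" if i: "i \<in> J" for i
    proof -
      have "p ^ card (A i) * bexp p U (\<lambda>R. Y i (R \<union> A i)) = bexp p U (\<lambda>R. of_bool (A i \<subseteq> R) * Y i R)"
        using bexp_subset_indicator[OF U A[OF i], of p "Y i"] by simp
      also have "\<dots> = bexp p U (\<lambda>R. \<Sum>j\<in>{j\<in>J. A i \<inter> A j \<noteq> {}}. of_bool (A i \<union> A j \<subseteq> R) * 1)"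
        unfolding Y_def sum_distrib_left by (intro bexp_cong sum.cong) auto
      also have "\<dots> = (\<Sum>j\<in>{j\<in>J. A i \<inter> A j \<noteq> {}}. p ^ card (A i \<union> A j))"
        unfolding bexp_sum using A i
        by (intro sum.cong refl, subst bexp_subset_indicator[OF U]) (auto simp: bexp_const U)
      finally show ?thesis .
    qed
    have "\<mu> - s * \<Delta> \<le> \<mu> - s * (\<Sum>i\<in>J. p ^ card (A i) * bexp p U (\<lambda>R. Y i (R \<union> A i)))"
      using Delta s by (simp add: Yexp mult_left_mono)
    also have "\<dots> = (\<Sum>i\<in>J. p ^ card (A i) * (1 - s * bexp p U (\<lambda>R. Y i (R \<union> A i))))"
      unfolding mu sum_distrib_left sum_subtractf[symmetric] by (intro sum.cong) (auto simp: algebra_simps)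
    finally have "(\<mu> - s * \<Delta>) * \<psi> s
        \<le> (\<Sum>i\<in>J. p ^ card (A i) * (1 - s * bexp p U (\<lambda>R. Y i (R \<union> A i)))) * \<psi> s"
      by (intro mult_right_mono psi_nonneg)
    also have "\<dots> \<le> (\<Sum>i\<in>J. bexp p U (\<lambda>R. of_bool (A i \<subseteq> R) * exp (- (s * X R))))"
      unfolding sum_distrib_right by (intro sum_mono single)
    finally show ?thesis
      unfolding \<psi>'_def minus_mult_left[symmetric] by (rule le_imp_neg_le)
  qed
  define s0 where "s0 = \<mu> / \<Delta>"
  have mu0: "0 \<le> \<mu>" using p by (auto simp: mu intro!: sum_nonneg)
  then have s0: "0 \<le> s0" using Delta by (simp add: s0_def)
  \<comment> \<open>The differential inequality says that \<open>h\<close> is nonincreasing.\<close>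
  define h where "h = (\<lambda>s. \<psi> s * exp (s * \<mu> - s\<^sup>2 * \<Delta> / 2))"
  have "h s0 \<le> h 0"
  proof (rule DERIV_nonpos_imp_nonincreasing[OF s0])
    fix s assume s: "0 \<le> s" "s \<le> s0"
    have "(h has_real_derivative (\<psi>' s + (\<mu> - s * \<Delta>) * \<psi> s) * exp (s * \<mu> - s\<^sup>2 * \<Delta> / 2)) (at s)"
      unfolding h_def by (auto intro!: derivative_eq_intros deriv simp: algebra_simps)
    moreover have "(\<psi>' s + (\<mu> - s * \<Delta>) * \<psi> s) * exp (s * \<mu> - s\<^sup>2 * \<Delta> / 2) \<le> 0"
      using key[OF s(1)] by (intro mult_nonpos_nonneg) (auto simp: algebra_simps)
    ultimately show "\<exists>y. (h has_real_derivative y) (at s) \<and> y \<le> 0" by blast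
  qed
  also have "h 0 = 1" using U by (simp add: h_def \<psi>_def bexp_const)
  also have "s0 * \<mu> - s0\<^sup>2 * \<Delta> / 2 = \<mu>\<^sup>2 / (2 * \<Delta>)"
    using Delta by (simp add: s0_def power2_eq_square field_simps)
  then have "h s0 = \<psi> s0 * exp (\<mu>\<^sup>2 / (2 * \<Delta>))"
    by (simp add: h_def)
  finally have "\<psi> s0 \<le> exp (- (\<mu>\<^sup>2 / (2 * \<Delta>)))"
    by (simp add: exp_minus field_simps)
  moreover have "bexp p U (\<lambda>R. of_bool (\<forall>i\<in>J. \<not> A i \<subseteq> R)) \<le> \<psi> s0"
    unfolding \<psi>_def
  proof (intro bexp_mono p)
    fix R
    have "X R = 0" if "\<forall>i\<in>J. \<not> A i \<subseteq> R" using that by (auto simp: X_def)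
    then show "of_bool (\<forall>i\<in>J. \<not> A i \<subseteq> R) \<le> exp (- (s0 * X R))" by auto
  qed
  ultimately show ?thesis by linarith
qed

section \<open>The Efron-Stein inequality\<close>

lemma (in prob_space) bounded_integrable:
  fixes f :: "'a \<Rightarrow> real"
  assumes "f \<in> borel_measurable M" "\<And>x. \<bar>f x\<bar> \<le> B"
  shows "integrable M f"
  using assms by (intro integrable_const_bound[of _ B]) auto

lemma (in prob_space) second_moment_minus_square:
  fixes f :: "'a \<Rightarrow> real"
  assumes "f \<in> borel_measurable M" "\<And>x. \<bar>f x\<bar> \<le> B"
  shows "(\<integral>x. (f x)\<^sup>2 \<partial>M) - (\<integral>x. f x \<partial>M)\<^sup>2 \<le> (\<integral>x. (f x - c)\<^sup>2 \<partial>M)"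
proof -
  have i: "integrable M f" using assms by (rule bounded_integrable)
  have i2: "integrable M (\<lambda>x. (f x)\<^sup>2)"
  proof (rule bounded_integrable[of _ "B\<^sup>2"])
    show "\<bar>(f x)\<^sup>2\<bar> \<le> B\<^sup>2" for x
      using power_mono[OF assms(2)[of x], of 2] by simp
  qed (use assms(1) in measurable)
  have "(\<integral>x. (f x - c)\<^sup>2 \<partial>M) = (\<integral>x. (f x)\<^sup>2 - 2 * c * f x + c\<^sup>2 \<partial>M)"
    by (simp add: power2_eq_square algebra_simps)
  also have "\<dots> = (\<integral>x. (f x)\<^sup>2 \<partial>M) - 2 * c * (\<integral>x. f x \<partial>M) + c\<^sup>2"
    using i i2 by (simp add: prob_space)
  also have "\<dots> = (\<integral>x. (f x)\<^sup>2 \<partial>M) - (\<integral>x. f x \<partial>M)\<^sup>2 + ((\<integral>x. f x \<partial>M) - c)\<^sup>2"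
    by (simp add: power2_eq_square algebra_simps)
  finally show ?thesis by simp
qed

lemma fun_upd_measurable_PiM:
  assumes "i \<in> I" "a \<in> space M"
  shows "(\<lambda>x. x(i := a)) \<in> measurable (PiM I (\<lambda>_. M)) (PiM I (\<lambda>_. M))"
  using assms by (intro measurable_fun_upd[of I I i]) auto

text \<open>The variance along one coordinate is at most the second moment around any centre, here the value
of \<open>f\<close> with that coordinate reset to \<open>a\<close>. In the induction, averaging \<open>f\<close> over the new coordinate
\<open>j\<close> costs the variance along \<open>j\<close>; the coordinate terms of the averaged function are at most those
of \<open>f\<close> by Jensen's inequality for the square.\<close>

theorem efron_stein:
  fixes f :: "('i \<Rightarrow> 'a) \<Rightarrow> real"
  assumes M: "prob_space M" and a: "a \<in> space M" and "finite I"
    and "f \<in> borel_measurable (PiM I (\<lambda>_. M))" "\<And>x. \<bar>f x\<bar> \<le> B"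
  shows "(\<integral>x. (f x)\<^sup>2 \<partial>PiM I (\<lambda>_. M)) - (\<integral>x. f x \<partial>PiM I (\<lambda>_. M))\<^sup>2
      \<le> (\<Sum>i\<in>I. \<integral>x. (f x - f (x(i := a)))\<^sup>2 \<partial>PiM I (\<lambda>_. M))"
  using assms(3-)
proof (induction I arbitrary: f rule: finite_induct)
  case empty
  interpret M: prob_space M by fact
  interpret product_prob_space "\<lambda>_. M" "{}" ..
  have "integral\<^sup>L (PiM {} (\<lambda>_. M)) g = g (\<lambda>_. undefined)" for g :: "('i \<Rightarrow> 'a) \<Rightarrow> real"
    by (simp add: PiM_empty lebesgue_integral_count_space_finite)
  then show ?case by simp
next
  case (insert j I)
  interpret M: prob_space M by fact
  interpret product_prob_space "\<lambda>_. M" I ..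
  interpret P: prob_space "PiM I (\<lambda>_. M)" by (rule prob_space_PiM) (rule M)
  interpret P': prob_space "PiM (insert j I) (\<lambda>_. M)" by (rule prob_space_PiM) (rule M)
  let ?P = "PiM I (\<lambda>_. M)" and ?P' = "PiM (insert j I) (\<lambda>_. M)"
  note f [measurable] = insert.prems(1)
  note B = insert.prems(2)
  have B0: "0 \<le> B" using B[of undefined] by linarith
  have sqB: "\<bar>(u::real)\<^sup>2\<bar> \<le> C\<^sup>2" if "\<bar>u\<bar> \<le> C" for u C
    using power_mono[OF that, of 2] by simp
  have dB: "\<bar>f x - f y\<bar> \<le> 2 * B" for x y
    using B[of x] B[of y] by linarith
  have upd [measurable]: "(\<lambda>(x, y). x(j := y)) \<in> measurable (?P \<Otimes>\<^sub>M M) ?P'"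
    using measurable_add_dim[of j I "\<lambda>_. M"] by simp
  have updi [measurable]: "(\<lambda>x. x(i := a)) \<in> measurable (PiM I' (\<lambda>_. M)) (PiM I' (\<lambda>_. M))" if "i \<in> I'" for i I'
    using fun_upd_measurable_PiM[OF that a] .
  have f2 [measurable]: "(\<lambda>(x, y). f (x(j := y))) \<in> borel_measurable (?P \<Otimes>\<^sub>M M)"
    by measurable
  have fx: "(\<lambda>y. f (x(j := y))) \<in> borel_measurable M" if "x \<in> space ?P" for x
    using measurable_compose[OF measurable_Pair1'[OF that] f2] by simp
  define g where "g = (\<lambda>x. \<integral>y. f (x(j := y)) \<partial>M)"
  have g_meas [measurable]: "g \<in> borel_measurable ?P"
    unfolding g_def by measurable
  have gB: "\<bar>g x\<bar> \<le> B" for x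
  proof (cases "integrable M (\<lambda>y. f (x(j := y)))")
    case True
    have "\<bar>g x\<bar> \<le> (\<integral>y. \<bar>f (x(j := y))\<bar> \<partial>M)"
      unfolding g_def by (rule integral_abs_bound)
    also have "\<dots> \<le> (\<integral>y. B \<partial>M)"
      using True B by (intro integral_mono) auto
    finally show ?thesis by (simp add: M.prob_space)
  next
    case False
    then show ?thesis using B0 by (simp add: g_def not_integrable_integral_eq)
  qed
  have split: "integral\<^sup>L ?P' h = (\<integral>x. (\<integral>y. h (x(j := y)) \<partial>M) \<partial>?P)"
    if "h \<in> borel_measurable ?P'" "\<And>x. \<bar>h x\<bar> \<le> C" for h :: "('i \<Rightarrow> 'a) \<Rightarrow> real" and C
    using that insert.hyps P'.bounded_integrable[OF that] by (intro product_integral_insert) auto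
  have inner_int: "integrable ?P (\<lambda>x. \<integral>y. h (x(j := y)) \<partial>M)"
    if h [measurable]: "h \<in> borel_measurable ?P'" and C: "\<And>x. \<bar>h x\<bar> \<le> C" for h :: "('i \<Rightarrow> 'a) \<Rightarrow> real" and C
  proof (rule P.integrable_const_bound[of _ C])
    have "(\<lambda>(x, y). h (x(j := y))) \<in> borel_measurable (?P \<Otimes>\<^sub>M M)" by measurable
    then show "(\<lambda>x. \<integral>y. h (x(j := y)) \<partial>M) \<in> borel_measurable ?P"
      by measurable
    show "AE x in ?P. norm (\<integral>y. h (x(j := y)) \<partial>M) \<le> C"
    proof (intro AE_I2)
      fix x assume x: "x \<in> space ?P"
      have "(\<lambda>y. h (x(j := y))) \<in> borel_measurable M"
        using measurable_compose[OF measurable_Pair1'[OF x] measurable_compose[OF upd h]] by simp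
      then have "integrable M (\<lambda>y. h (x(j := y)))"
        using C by (rule M.bounded_integrable)
      then have "(\<integral>y. \<bar>h (x(j := y))\<bar> \<partial>M) \<le> (\<integral>y. C \<partial>M)"
        using C by (intro integral_mono) auto
      then show "norm (\<integral>y. h (x(j := y)) \<partial>M) \<le> C"
        using order.trans[OF integral_abs_bound[of M "\<lambda>y. h (x(j := y))"]] by (simp add: M.prob_space)
    qed
  qed
  have sq_meas: "(\<lambda>x. (f x)\<^sup>2) \<in> borel_measurable ?P'" by measurable
  have gi2: "integrable ?P (\<lambda>x. (g x)\<^sup>2)"
    by (rule P.bounded_integrable[OF _ sqB[OF gB]]) measurable
  have d_meas: "(\<lambda>x. (f x - f (x(i := a)))\<^sup>2) \<in> borel_measurable ?P'" if "i \<in> insert j I" for i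
    using updi[OF that] by measurable
  have E1: "(\<integral>x. (f x)\<^sup>2 \<partial>?P') = (\<integral>x. (\<integral>y. (f (x(j := y)))\<^sup>2 \<partial>M) \<partial>?P)"
    by (rule split[OF sq_meas, of "B\<^sup>2"]) (intro sqB B)
  have E2: "(\<integral>x. f x \<partial>?P') = (\<integral>x. g x \<partial>?P)"
    unfolding g_def by (rule split[OF f B])
  have j_part: "(\<integral>x. (\<integral>y. (f (x(j := y)))\<^sup>2 \<partial>M) \<partial>?P) - (\<integral>x. (g x)\<^sup>2 \<partial>?P)
      \<le> (\<integral>x. (f x - f (x(j := a)))\<^sup>2 \<partial>?P')"
  proof -
    have i1: "integrable ?P (\<lambda>x. \<integral>y. (f (x(j := y)))\<^sup>2 \<partial>M)"
      by (rule inner_int[OF sq_meas, of "B\<^sup>2"]) (intro sqB B)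
    have "(\<integral>x. (\<integral>y. (f (x(j := y)))\<^sup>2 \<partial>M) \<partial>?P) - (\<integral>x. (g x)\<^sup>2 \<partial>?P)
        = (\<integral>x. (\<integral>y. (f (x(j := y)))\<^sup>2 \<partial>M) - (g x)\<^sup>2 \<partial>?P)"
      using i1 gi2 by simp
    also have "\<dots> \<le> (\<integral>x. (\<integral>y. (f (x(j := y)) - f (x(j := y, j := a)))\<^sup>2 \<partial>M) \<partial>?P)"
    proof (rule integral_mono)
      show "integrable ?P (\<lambda>x. (\<integral>y. (f (x(j := y)))\<^sup>2 \<partial>M) - (g x)\<^sup>2)"
        using i1 gi2 by simp
      show "integrable ?P (\<lambda>x. \<integral>y. (f (x(j := y)) - f (x(j := y, j := a)))\<^sup>2 \<partial>M)"
        by (rule inner_int[OF d_meas sqB[OF dB]]) (simp)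
      show "(\<integral>y. (f (x(j := y)))\<^sup>2 \<partial>M) - (g x)\<^sup>2
          \<le> (\<integral>y. (f (x(j := y)) - f (x(j := y, j := a)))\<^sup>2 \<partial>M)" if "x \<in> space ?P" for x
        unfolding g_def fun_upd_upd by (rule M.second_moment_minus_square[OF fx[OF that] B])
    qed
    also have "\<dots> = (\<integral>x. (f x - f (x(j := a)))\<^sup>2 \<partial>?P')"
      by (rule split[OF d_meas sqB[OF dB], symmetric]) (simp)
    finally show ?thesis .
  qed
  have i_part: "(\<integral>x. (g x - g (x(i := a)))\<^sup>2 \<partial>?P) \<le> (\<integral>x. (f x - f (x(i := a)))\<^sup>2 \<partial>?P')"
    if i: "i \<in> I" for i
  proof -
    have ij: "i \<noteq> j" using i insert.hyps by auto
    note updi[OF i, measurable]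
    have "(\<integral>x. (g x - g (x(i := a)))\<^sup>2 \<partial>?P)
        \<le> (\<integral>x. (\<integral>y. (f (x(j := y)) - f (x(j := y, i := a)))\<^sup>2 \<partial>M) \<partial>?P)"
    proof (rule integral_mono)
      show "integrable ?P (\<lambda>x. (g x - g (x(i := a)))\<^sup>2)"
      proof (rule P.bounded_integrable[of _ "(2 * B)\<^sup>2"])
        show "(\<lambda>x. (g x - g (x(i := a)))\<^sup>2) \<in> borel_measurable ?P" by measurable
        show "\<bar>(g x - g (x(i := a)))\<^sup>2\<bar> \<le> (2 * B)\<^sup>2" for x
          using gB[of x] gB[of "x(i := a)"] by (intro sqB) linarith
      qed
      show "integrable ?P (\<lambda>x. \<integral>y. (f (x(j := y)) - f (x(j := y, i := a)))\<^sup>2 \<partial>M)"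
        by (rule inner_int[OF d_meas sqB[OF dB]]) (simp add: i)
      fix x assume x: "x \<in> space ?P"
      then have x': "x(i := a) \<in> space ?P"
        using measurable_space[OF updi[OF i]] by auto
      let ?d = "\<lambda>y. f (x(j := y)) - f (x(i := a, j := y))"
      have d: "?d \<in> borel_measurable M" by (rule borel_measurable_diff[OF fx[OF x] fx[OF x']])
      have "g x - g (x(i := a)) = (\<integral>y. ?d y \<partial>M)"
        unfolding g_def
        by (rule Bochner_Integration.integral_diff[OF M.bounded_integrable[OF fx[OF x] B]
              M.bounded_integrable[OF fx[OF x'] B], symmetric])
      moreover have "0 \<le> (\<integral>y. (?d y)\<^sup>2 \<partial>M) - (\<integral>y. ?d y \<partial>M)\<^sup>2"
      proof -
        have i1: "integrable M ?d" by (rule M.bounded_integrable[OF d dB])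
        have i2: "integrable M (\<lambda>y. (?d y)\<^sup>2)"
          by (rule M.bounded_integrable[OF borel_measurable_power[OF d] sqB[OF dB]])
        show ?thesis
          using M.variance_eq[OF i1 i2] Bochner_Integration.integral_nonneg[of M "\<lambda>y. (?d y - (\<integral>y. ?d y \<partial>M))\<^sup>2"] by simp
      qed
      ultimately show "(g x - g (x(i := a)))\<^sup>2 \<le> (\<integral>y. (f (x(j := y)) - f (x(j := y, i := a)))\<^sup>2 \<partial>M)"
        unfolding fun_upd_twist[OF ij[symmetric]] by (simp only: diff_ge_0_iff_ge)
    qed
    also have "\<dots> = (\<integral>x. (f x - f (x(i := a)))\<^sup>2 \<partial>?P')"
      by (rule split[OF d_meas sqB[OF dB], symmetric]) (simp add: i)
    finally show ?thesis .
  qed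
  have "(\<integral>x. (g x)\<^sup>2 \<partial>?P) - (\<integral>x. g x \<partial>?P)\<^sup>2 \<le> (\<Sum>i\<in>I. \<integral>x. (g x - g (x(i := a)))\<^sup>2 \<partial>?P)"
    by (rule insert.IH[OF g_meas gB])
  also have "\<dots> \<le> (\<Sum>i\<in>I. \<integral>x. (f x - f (x(i := a)))\<^sup>2 \<partial>?P')"
    by (intro sum_mono i_part)
  finally show ?case
    unfolding E1 E2 sum.insert[OF insert.hyps] using j_part by linarith
qed

section \<open>The variance of a minimum weight\<close>

definition exp1 :: "real measure" where
  "exp1 = density lborel (exponential_density 1)"

lemma space_exp1 [simp]: "space exp1 = UNIV"
  and sets_exp1 [measurable_cong, simp]: "sets exp1 = sets borel"
  by (auto simp: exp1_def)

lemma prob_space_exp1: "prob_space exp1"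
  unfolding exp1_def by (rule prob_space_exponential_density) simp

interpretation exp1: prob_space exp1
  by (rule prob_space_exp1)

lemma integral_exp1:
  fixes f :: "real \<Rightarrow> real"
  assumes [measurable]: "f \<in> borel_measurable borel"
  shows "(\<integral>x. f x \<partial>exp1) = (\<integral>x. exponential_density 1 x * f x \<partial>lborel)"
  unfolding exp1_def by (subst integral_density) (auto simp: exponential_density_def)

lemma distributed_exp1: "distributed exp1 lborel (\<lambda>x. x) (exponential_density 1)"
  unfolding distributed_def exp1_def by (auto intro!: measure_eqI simp: emeasure_distr)

lemma measure_exp1_atMost: "0 \<le> t \<Longrightarrow> measure exp1 {..t} = 1 - exp (- t)"
  using exp1.exponential_distributedD_le[OF distributed_exp1, of t] by (simp add: atMost_def)

lemma measure_exp1_greaterThan: "0 \<le> t \<Longrightarrow> measure exp1 {t<..} = exp (- t)"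
  using exp1.exponential_distributedD_gt[OF distributed_exp1, of t] by (simp add: greaterThan_def)

lemma measure_exp1_lessThan_0: "measure exp1 {..<0} = 0"
proof -
  have "measure exp1 {..<0} \<le> measure exp1 {..0}"
    by (intro exp1.finite_measure_mono) auto
  then show ?thesis by (simp add: measure_exp1_atMost measure_le_0_iff)
qed

text \<open>Integration by parts: \<open>- z\<^sup>2 exp (- z)\<close> is an antiderivative of \<open>(z\<^sup>2 - 2 z) exp (- z)\<close>, and its
boundary term at \<open>c\<close> cancels the contribution \<open>c\<^sup>2 P (Z > c)\<close> of the truncated part. The factor \<open>max 0 z\<close>
only matters on a null set.\<close>

lemma exp1_truncated_second_moment:
  assumes c: "0 \<le> c"
  shows "(\<integral>z. (min c (max 0 z))\<^sup>2 \<partial>exp1) = 2 * (\<integral>z. (if 0 \<le> z \<and> z < c then z else 0) \<partial>exp1)"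
proof -
  define q where "q = (\<lambda>z::real. if 0 \<le> z \<and> z < c then z else 0)"
  define r where "r = (\<lambda>z::real. indicator {c<..} z :: real)"
  have q [measurable]: "q \<in> borel_measurable borel" unfolding q_def by measurable
  have r [measurable]: "r \<in> borel_measurable borel" unfolding r_def by measurable
  let ?F = "\<lambda>z::real. - (z\<^sup>2 * exp (- z))"
  let ?f = "\<lambda>z::real. (z\<^sup>2 - 2 * z) * exp (- z)"
  have ftc: "has_bochner_integral lborel (\<lambda>z. indicator {0..c} z *\<^sub>R ?f z) (?F c - ?F 0)"
    by (rule has_bochner_integral_FTC_Icc)
      (auto intro!: derivative_eq_intros continuous_intros c
        simp: has_real_derivative_iff_has_vector_derivative[symmetric] power2_eq_square algebra_simps)
  have 1: "(\<integral>z. exponential_density 1 z * (indicator {0..c} z * (z\<^sup>2 - 2 * z)) \<partial>lborel) = - (c\<^sup>2 * exp (- c))"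
  proof -
    have eq: "(\<lambda>z. exponential_density 1 z * (indicator {0..c} z * (z\<^sup>2 - 2 * z)))
        = (\<lambda>z. indicator {0..c} z *\<^sub>R ?f z)"
      by (auto simp: exponential_density_def indicator_def)
    show ?thesis
      unfolding eq has_bochner_integral_integral_eq[OF ftc] by simp
  qed
  have 2: "(\<integral>z. indicator {0..c} z * (z\<^sup>2 - 2 * z) \<partial>exp1) = - (c\<^sup>2 * exp (- c))"
    by (subst integral_exp1) (auto simp: 1)
  have ir: "(\<integral>z. r z \<partial>exp1) = exp (- c)"
    unfolding r_def using measure_exp1_greaterThan[OF c] by simp
  have AE_nonneg: "AE z in exp1. 0 \<le> z"
    by (rule AE_I[of _ _ "{..<0}"]) (auto simp: exp1.emeasure_eq_measure measure_exp1_lessThan_0)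
  have AE_c: "AE z in exp1. z \<noteq> c"
    unfolding exp1_def by (subst AE_density) (auto intro: AE_mp[OF AE_lborel_singleton[of c]])
  have iq: "integrable exp1 q"
    by (rule exp1.bounded_integrable[of _ c]) (use c in \<open>auto simp: q_def\<close>)
  have irr: "integrable exp1 r"
    by (rule exp1.bounded_integrable[of _ 1]) (auto simp: r_def indicator_def)
  have ii: "integrable exp1 (\<lambda>z. indicator {0..c} z * (z\<^sup>2 - 2 * z))"
  proof (rule exp1.bounded_integrable[of _ "c\<^sup>2 + 2 * c"])
    show "\<bar>indicator {0..c} z * (z\<^sup>2 - 2 * z)\<bar> \<le> c\<^sup>2 + 2 * c" for z
    proof (cases "z \<in> {0..c}")
      case True
      then have "z\<^sup>2 \<le> c\<^sup>2" by (intro power_mono) auto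
      moreover have "0 \<le> z" "z \<le> c" "0 \<le> z\<^sup>2" "0 \<le> c\<^sup>2" using True by auto
      ultimately have "\<bar>z\<^sup>2 - 2 * z\<bar> \<le> c\<^sup>2 + 2 * c" by linarith
      then show ?thesis using True by simp
    qed (use c in auto)
  qed measurable
  have "(\<integral>z. (min c (max 0 z))\<^sup>2 \<partial>exp1)
      = (\<integral>z. 2 * q z + (indicator {0..c} z * (z\<^sup>2 - 2 * z) + c\<^sup>2 * r z) \<partial>exp1)"
  proof (rule integral_cong_AE)
    show "AE z in exp1. (min c (max 0 z))\<^sup>2 = 2 * q z + (indicator {0..c} z * (z\<^sup>2 - 2 * z) + c\<^sup>2 * r z)"
      using AE_nonneg AE_c
      by eventually_elim (auto simp: q_def r_def indicator_def min_def max_def)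
  qed measurable
  also have "\<dots> = 2 * (\<integral>z. q z \<partial>exp1) + (- (c\<^sup>2 * exp (- c)) + c\<^sup>2 * exp (- c))"
    using iq irr ii by (simp add: 2 ir)
  finally show ?thesis by (simp add: q_def)
qed

definition min_weight :: "'e set set \<Rightarrow> ('e \<Rightarrow> real) \<Rightarrow> real" where
  "min_weight \<F> x = Min ((\<lambda>B. \<Sum>e\<in>B. x e) ` \<F>)"

lemma min_weight_le: "finite \<F> \<Longrightarrow> B \<in> \<F> \<Longrightarrow> min_weight \<F> x \<le> (\<Sum>e\<in>B. x e)"
  unfolding min_weight_def by (intro Min_le) auto

lemma min_weight_attained:
  assumes "finite \<F>" "\<F> \<noteq> {}"
  obtains B where "B \<in> \<F>" "min_weight \<F> x = (\<Sum>e\<in>B. x e)"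
proof -
  have "min_weight \<F> x \<in> (\<lambda>B. \<Sum>e\<in>B. x e) ` \<F>"
    unfolding min_weight_def using assms by (intro Min_in) auto
  then show ?thesis using that by auto
qed

lemma min_weight_mono:
  assumes "finite \<F>" "\<F> \<noteq> {}" "\<And>e. e \<in> \<Union>\<F> \<Longrightarrow> x e \<le> y e"
  shows "min_weight \<F> x \<le> min_weight \<F> y"
proof -
  obtain B where B: "B \<in> \<F>" "min_weight \<F> y = (\<Sum>e\<in>B. y e)"
    using min_weight_attained assms by blast
  have "min_weight \<F> x \<le> (\<Sum>e\<in>B. x e)" using B assms by (intro min_weight_le)
  also have "\<dots> \<le> (\<Sum>e\<in>B. y e)" using B assms by (intro sum_mono) auto
  finally show ?thesis using B by simp
qed

lemma min_weight_cong: "(\<And>e. e \<in> \<Union>\<F> \<Longrightarrow> x e = y e) \<Longrightarrow> min_weight \<F> x = min_weight \<F> y"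
  unfolding min_weight_def by (intro arg_cong[of _ _ Min] image_cong sum.cong) auto

lemma min_weight_measurable:
  assumes "finite \<F>" "\<F> \<noteq> {}" "\<Union>\<F> \<subseteq> I" "\<And>e. e \<in> I \<Longrightarrow> (\<lambda>x. g x e) \<in> borel_measurable N"
  shows "(\<lambda>x. min_weight \<F> (g x)) \<in> borel_measurable N"
proof -
  have "(\<lambda>x. Min ((\<lambda>B. \<Sum>e\<in>B. g x e) ` \<F>)) \<in> borel_measurable N"
    using assms by (intro borel_measurable_Min borel_measurable_sum) auto
  then show ?thesis by (simp add: min_weight_def)
qed

text \<open>Weights are truncated to \<open>[0, T]\<close> so that the minimum weight is bounded, which makes all
integrals finite. Since \<open>T\<close> does not enter the final variance bound, it can be taken so large that
truncation has no effect outside an event of arbitrarily small probability.\<close>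

definition truncate :: "real \<Rightarrow> real \<Rightarrow> real" where
  "truncate T z = min T (max 0 z)"

lemma truncate_bounds: "0 \<le> T \<Longrightarrow> 0 \<le> truncate T z" "0 \<le> T \<Longrightarrow> truncate T z \<le> T"
  by (auto simp: truncate_def)

context
  fixes \<F> :: "'e set set" and I :: "'e set" and T :: real
  assumes \<F>: "finite \<F>" "\<F> \<noteq> {}" "\<Union>\<F> \<subseteq> I" and I: "finite I" and T: "0 \<le> T"
begin

definition capped_weight :: "('e \<Rightarrow> real) \<Rightarrow> real" where
  "capped_weight x = min_weight \<F> (\<lambda>e. truncate T (x e))"

lemma capped_weight_attained:
  obtains B where "B \<in> \<F>" "capped_weight x = (\<Sum>e\<in>B. truncate T (x e))"
  unfolding capped_weight_def by (rule min_weight_attained[OF \<F>(1,2)])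

lemma capped_weight_nonneg: "0 \<le> capped_weight x"
proof -
  obtain B where "B \<in> \<F>" "capped_weight x = (\<Sum>e\<in>B. truncate T (x e))"
    by (rule capped_weight_attained)
  then show ?thesis using T by (auto intro!: sum_nonneg truncate_bounds)
qed

lemma capped_weight_le: "capped_weight x \<le> card I * T"
proof -
  obtain B where B: "B \<in> \<F>" using \<F> by auto
  then have BI: "B \<subseteq> I" using \<F> by auto
  have "capped_weight x \<le> (\<Sum>e\<in>B. truncate T (x e))"
    unfolding capped_weight_def using B \<F> by (intro min_weight_le) auto
  also have "\<dots> \<le> (\<Sum>e\<in>B. T)" using T by (intro sum_mono truncate_bounds)
  also have "\<dots> \<le> card I * T" using BI I T by (auto intro!: mult_right_mono card_mono)
  finally show ?thesis .
qed

lemma capped_weight_abs: "\<bar>capped_weight x\<bar> \<le> card I * T"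
  using capped_weight_nonneg[of x] capped_weight_le[of x] by simp

lemma capped_weight_measurable [measurable]: "capped_weight \<in> borel_measurable (PiM I (\<lambda>_. exp1))"
  unfolding capped_weight_def truncate_def using \<F> by (intro min_weight_measurable[of _ I]) auto

lemma capped_weight_mono: "(\<And>e. x e \<le> y e) \<Longrightarrow> capped_weight x \<le> capped_weight y"
  unfolding capped_weight_def truncate_def by (intro min_weight_mono \<F> min.mono max.mono) simp_all

text \<open>The value of the minimum with \<open>x i\<close> replaced by \<open>z\<close> is a constant plus \<open>min z (gap i x)\<close> for
\<open>z \<ge> 0\<close>: it grows with slope 1 until a set that avoids \<open>i\<close> is lightest or \<open>z\<close> reaches
\<open>T\<close>, and it is constant afterwards.\<close>

definition gap :: "'e \<Rightarrow> ('e \<Rightarrow> real) \<Rightarrow> real" where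
  "gap i x = capped_weight (x(i := T)) - capped_weight (x(i := 0))"

lemma gap_nonneg: "0 \<le> gap i x"
  unfolding gap_def using T by (simp add: capped_weight_mono)

lemma sum_truncate_upd:
  assumes "B \<in> \<F>"
  shows "(\<Sum>e\<in>B. truncate T ((x(i := z)) e)) = (\<Sum>e\<in>B - {i}. truncate T (x e)) + (if i \<in> B then truncate T z else 0)"
proof -
  have "B \<subseteq> I" using assms \<F>(3) by auto
  then have B: "finite B" using I by (rule finite_subset)
  show ?thesis
  proof (cases "i \<in> B")
    case True
    have "(\<Sum>e\<in>B - {i}. truncate T ((x(i := z)) e)) = (\<Sum>e\<in>B - {i}. truncate T (x e))"
      by (intro sum.cong) auto
    then show ?thesis
      unfolding sum.remove[OF B True] using True by (simp only: fun_upd_same if_True add.commute)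
  next
    case False
    then have "B - {i} = B" by simp
    moreover have "(\<Sum>e\<in>B. truncate T ((x(i := z)) e)) = (\<Sum>e\<in>B. truncate T (x e))"
      using False by (intro sum.cong) auto
    ultimately show ?thesis using False by simp
  qed
qed

lemma capped_weight_upd_le: "capped_weight (x(i := z)) - capped_weight (x(i := 0)) \<le> min (gap i x) (max 0 z)"
proof -
  have "capped_weight (x(i := z)) \<le> capped_weight (x(i := 0)) + max 0 z"
  proof -
    obtain B where B: "B \<in> \<F>" "capped_weight (x(i := 0)) = (\<Sum>e\<in>B. truncate T ((x(i := 0)) e))"
      by (rule capped_weight_attained)
    have "capped_weight (x(i := z)) \<le> (\<Sum>e\<in>B. truncate T ((x(i := z)) e))"
      unfolding capped_weight_def by (rule min_weight_le[OF \<F>(1) B(1)])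
    also have "\<dots> = (\<Sum>e\<in>B - {i}. truncate T (x e)) + (if i \<in> B then truncate T z else 0)"
      by (rule sum_truncate_upd[OF B(1)])
    also have "\<dots> \<le> ((\<Sum>e\<in>B - {i}. truncate T (x e)) + (if i \<in> B then truncate T 0 else 0)) + max 0 z"
      using T by (auto simp: truncate_def)
    also have "(\<Sum>e\<in>B - {i}. truncate T (x e)) + (if i \<in> B then truncate T 0 else 0) = capped_weight (x(i := 0))"
      unfolding B(2) by (rule sum_truncate_upd[OF B(1), symmetric])
    finally show ?thesis .
  qed
  moreover have "capped_weight (x(i := z)) \<le> capped_weight (x(i := T))"
    unfolding capped_weight_def
  proof (intro min_weight_mono \<F>)
    show "truncate T ((x(i := z)) e) \<le> truncate T ((x(i := T)) e)" for e
      using T by (cases "e = i") (simp_all add: truncate_def)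
  qed
  ultimately show ?thesis
    unfolding gap_def by linarith
qed

lemma capped_weight_upd_ge: "0 \<le> capped_weight (x(i := z)) - capped_weight (x(i := 0))"
proof -
  have "capped_weight (x(i := 0)) \<le> capped_weight (x(i := z))"
    unfolding capped_weight_def
  proof (intro min_weight_mono \<F>)
    show "truncate T ((x(i := 0)) e) \<le> truncate T ((x(i := z)) e)" for e
      using T by (cases "e = i") (simp_all add: truncate_def)
  qed
  then show ?thesis by simp
qed

text \<open>If \<open>x i\<close> is below its gap, then \<open>i\<close> belongs to every lightest set, because a lightest set avoiding
\<open>i\<close> would keep its weight when \<open>x i\<close> is raised to \<open>T\<close>. So all these weights are part of the
weight of a single lightest set.\<close>

lemma sum_below_gap_le: "(\<Sum>i\<in>I. if 0 \<le> x i \<and> x i < gap i x then x i else 0) \<le> capped_weight x"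
proof -
  obtain B where B: "B \<in> \<F>" "capped_weight x = (\<Sum>e\<in>B. truncate T (x e))"
    by (rule capped_weight_attained)
  have BI: "B \<subseteq> I" using B \<F> by auto
  have key: "i \<in> B" if i: "0 \<le> x i" "x i < gap i x" for i
  proof (rule ccontr)
    assume nB: "i \<notin> B"
    have "capped_weight (x(i := T)) \<le> (\<Sum>e\<in>B. truncate T ((x(i := T)) e))"
      unfolding capped_weight_def by (rule min_weight_le[OF \<F>(1) B(1)])
    also have "\<dots> = (\<Sum>e\<in>B. truncate T (x e))"
      unfolding sum_truncate_upd[OF B(1)] using nB by simp
    also have "\<dots> = capped_weight (x(i := x i))" using B by simp
    finally have "gap i x \<le> capped_weight (x(i := x i)) - capped_weight (x(i := 0))" by (simp add: gap_def)
    also have "\<dots> \<le> x i" using capped_weight_upd_le[of x i "x i"] i by simp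
    finally show False using i by simp
  qed
  have gapT: "gap i x \<le> T" for i
    using capped_weight_upd_le[of x i T] T by (simp add: gap_def)
  have "(\<Sum>i\<in>I. if 0 \<le> x i \<and> x i < gap i x then x i else 0) \<le> (\<Sum>i\<in>I. if i \<in> B then truncate T (x i) else 0)"
  proof (intro sum_mono)
    fix i assume "i \<in> I"
    show "(if 0 \<le> x i \<and> x i < gap i x then x i else 0) \<le> (if i \<in> B then truncate T (x i) else 0)"
      using key[of i] gapT[of i] T by (auto simp: truncate_def)
  qed
  also have "\<dots> = (\<Sum>i\<in>B. truncate T (x i))"
    using BI I by (simp add: sum.If_cases Int_absorb1)
  finally show ?thesis using B by simp
qed

definition below_gap :: "'e \<Rightarrow> ('e \<Rightarrow> real) \<Rightarrow> real" where
  "below_gap i x = (if 0 \<le> x i \<and> x i < gap i x then x i else 0)"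

lemma capped_weight_upd_measurable:
  "i \<in> I \<Longrightarrow> (\<lambda>x. capped_weight (x(i := z))) \<in> borel_measurable (PiM I (\<lambda>_. exp1))"
  by (rule measurable_compose[OF fun_upd_measurable_PiM capped_weight_measurable]) auto

lemma gap_le: "gap i x \<le> T"
  using capped_weight_upd_le[of x i T] T by (simp add: gap_def)

lemma below_gap_measurable:
  assumes i: "i \<in> I"
  shows "below_gap i \<in> borel_measurable (PiM I (\<lambda>_. exp1))"
proof -
  have [measurable]: "gap i \<in> borel_measurable (PiM I (\<lambda>_. exp1))"
    unfolding gap_def[abs_def] using capped_weight_upd_measurable[OF i] by measurable
  note i [measurable]
  show ?thesis unfolding below_gap_def[abs_def] by measurable
qed

lemma below_gap_abs: "\<bar>below_gap i x\<bar> \<le> T"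
  using gap_le[of i x] T by (auto simp: below_gap_def)

lemma below_gap_integrable: "i \<in> I \<Longrightarrow> integrable (PiM I (\<lambda>_. exp1)) (below_gap i)"
  by (rule prob_space.bounded_integrable[OF prob_space_PiM[OF prob_space_exp1] below_gap_measurable below_gap_abs])

text \<open>Integrate over the \<open>i\<close>-th coordinate first. The gap does not depend on that coordinate, so the
integrand is at most \<open>(min (gap i x) (max 0 y))\<^sup>2\<close> with a constant gap, whose integral is known.\<close>

lemma capped_weight_coordinate_second_moment:
  assumes i: "i \<in> I"
  shows "(\<integral>x. (capped_weight x - capped_weight (x(i := 0)))\<^sup>2 \<partial>PiM I (\<lambda>_. exp1)) \<le> 2 * (\<integral>x. below_gap i x \<partial>PiM I (\<lambda>_. exp1))"
proof -
  let ?W = "PiM I (\<lambda>_. exp1)"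
  interpret W: prob_space ?W by (rule prob_space_PiM) (rule prob_space_exp1)
  define J where "J = I - {i}"
  have J: "finite J" "i \<notin> J" "insert i J = I" using i I by (auto simp: J_def)
  let ?V = "PiM J (\<lambda>_. exp1)"
  interpret V: prob_space ?V by (rule prob_space_PiM) (rule prob_space_exp1)
  interpret product_prob_space "\<lambda>_. exp1" J ..
  have dm: "(\<lambda>x. (capped_weight x - capped_weight (x(i := 0)))\<^sup>2) \<in> borel_measurable ?W"
    using capped_weight_upd_measurable[OF i] by measurable
  have split: "integral\<^sup>L ?W h = (\<integral>x. (\<integral>y. h (x(i := y)) \<partial>exp1) \<partial>?V)"
    if "integrable ?W h" for h :: "('e \<Rightarrow> real) \<Rightarrow> real"
    using that product_integral_insert[OF J(1,2), of h] by (simp add: J(3))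
  have b1: "\<bar>(capped_weight x - capped_weight (x(i := 0)))\<^sup>2\<bar> \<le> T\<^sup>2" for x
  proof -
    have "capped_weight x - capped_weight (x(i := 0)) \<le> T"
      using capped_weight_upd_le[of x i "x i"] gap_le[of i x] by simp
    moreover have "0 \<le> capped_weight x - capped_weight (x(i := 0))" using capped_weight_upd_ge[of x i "x i"] by simp
    ultimately show ?thesis unfolding abs_power2 by (intro power_mono)
  qed
  have gap_upd: "gap i (x(i := y)) = gap i x" for x y by (simp add: gap_def)
  have pair: "(\<lambda>(x, y). x(i := y)) \<in> measurable (?V \<Otimes>\<^sub>M exp1) ?W"
    using measurable_add_dim[of i J "\<lambda>_. exp1"] by (simp add: J(3))
  have pair1: "(\<lambda>y. x(i := y)) \<in> measurable exp1 ?W" if "x \<in> space ?V" for x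
    using measurable_compose[OF measurable_Pair1'[OF that] pair] by simp
  have inner_int: "integrable ?V (\<lambda>x. \<integral>y. h (x(i := y)) \<partial>exp1)"
    if h: "h \<in> borel_measurable ?W" and C: "\<And>x. \<bar>h x\<bar> \<le> C" for h :: "('e \<Rightarrow> real) \<Rightarrow> real" and C
  proof (rule V.integrable_const_bound[of _ C])
    have [measurable]: "(\<lambda>(x, y). h (x(i := y))) \<in> borel_measurable (?V \<Otimes>\<^sub>M exp1)"
      using measurable_compose[OF pair h] by (simp add: case_prod_unfold)
    show "(\<lambda>x. \<integral>y. h (x(i := y)) \<partial>exp1) \<in> borel_measurable ?V"
      by measurable
    show "AE x in ?V. norm (\<integral>y. h (x(i := y)) \<partial>exp1) \<le> C"
    proof (intro AE_I2)
      fix x assume x: "x \<in> space ?V"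
      have "integrable exp1 (\<lambda>y. h (x(i := y)))"
        using measurable_compose[OF pair1[OF x] h] C by (rule exp1.bounded_integrable)
      then have "(\<integral>y. \<bar>h (x(i := y))\<bar> \<partial>exp1) \<le> (\<integral>y. C \<partial>exp1)"
        using C by (intro integral_mono) auto
      then show "norm (\<integral>y. h (x(i := y)) \<partial>exp1) \<le> C"
        using order.trans[OF integral_abs_bound[of exp1 "\<lambda>y. h (x(i := y))"]]
        using exp1.prob_space by simp
    qed
  qed
  have c1: "(\<integral>x. (capped_weight x - capped_weight (x(i := 0)))\<^sup>2 \<partial>?W)
      = (\<integral>x. (\<integral>y. (capped_weight (x(i := y)) - capped_weight (x(i := y, i := 0)))\<^sup>2 \<partial>exp1) \<partial>?V)"
    by (rule split, rule W.bounded_integrable[OF dm b1])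
  have c2: "(\<integral>x. (\<integral>y. (capped_weight (x(i := y)) - capped_weight (x(i := y, i := 0)))\<^sup>2 \<partial>exp1) \<partial>?V)
      \<le> (\<integral>x. 2 * (\<integral>y. below_gap i (x(i := y)) \<partial>exp1) \<partial>?V)"
  proof (rule integral_mono)
    show "integrable ?V (\<lambda>x. \<integral>y. (capped_weight (x(i := y)) - capped_weight (x(i := y, i := 0)))\<^sup>2 \<partial>exp1)"
      by (rule inner_int[OF dm b1])
    show "integrable ?V (\<lambda>x. 2 * (\<integral>y. below_gap i (x(i := y)) \<partial>exp1))"
      using inner_int[OF below_gap_measurable[OF i] below_gap_abs] by simp
    fix x assume x: "x \<in> space ?V"
    have "(\<integral>y. (capped_weight (x(i := y)) - capped_weight (x(i := y, i := 0)))\<^sup>2 \<partial>exp1)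
        \<le> (\<integral>y. (min (gap i x) (max 0 y))\<^sup>2 \<partial>exp1)"
    proof (rule integral_mono)
      show "integrable exp1 (\<lambda>y. (capped_weight (x(i := y)) - capped_weight (x(i := y, i := 0)))\<^sup>2)"
        using measurable_compose[OF pair1[OF x] dm] b1 by (rule exp1.bounded_integrable)
      show "integrable exp1 (\<lambda>y. (min (gap i x) (max 0 y))\<^sup>2)"
      proof (rule exp1.bounded_integrable[of _ "T\<^sup>2"])
        show "\<bar>(min (gap i x) (max 0 y))\<^sup>2\<bar> \<le> T\<^sup>2" for y
          unfolding abs_power2 using gap_nonneg[of i x] gap_le[of i x] by (intro power_mono) linarith+
      qed measurable
      show "(capped_weight (x(i := y)) - capped_weight (x(i := y, i := 0)))\<^sup>2 \<le> (min (gap i x) (max 0 y))\<^sup>2" for y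
        unfolding fun_upd_upd by (intro power_mono capped_weight_upd_le capped_weight_upd_ge)
    qed
    also have "\<dots> = 2 * (\<integral>y. below_gap i (x(i := y)) \<partial>exp1)"
      unfolding exp1_truncated_second_moment[OF gap_nonneg] below_gap_def gap_upd by (simp only: fun_upd_same)
    finally show "(\<integral>y. (capped_weight (x(i := y)) - capped_weight (x(i := y, i := 0)))\<^sup>2 \<partial>exp1)
        \<le> 2 * (\<integral>y. below_gap i (x(i := y)) \<partial>exp1)" .
  qed
  have c3: "(\<integral>x. 2 * (\<integral>y. below_gap i (x(i := y)) \<partial>exp1) \<partial>?V) = 2 * (\<integral>x. below_gap i x \<partial>?W)"
    by (subst split[OF below_gap_integrable[OF i]]) simp
  from c1 c2 c3 show ?thesis by linarith
qed

theorem capped_weight_variance: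
  "(\<integral>x. (capped_weight x)\<^sup>2 \<partial>PiM I (\<lambda>_. exp1)) - (\<integral>x. capped_weight x \<partial>PiM I (\<lambda>_. exp1))\<^sup>2
     \<le> 2 * (\<integral>x. capped_weight x \<partial>PiM I (\<lambda>_. exp1))"
proof -
  let ?W = "PiM I (\<lambda>_. exp1)"
  interpret W: prob_space ?W by (rule prob_space_PiM) (rule prob_space_exp1)
  have 1: "(\<integral>x. (capped_weight x)\<^sup>2 \<partial>?W) - (\<integral>x. capped_weight x \<partial>?W)\<^sup>2 \<le> (\<Sum>i\<in>I. \<integral>x. (capped_weight x - capped_weight (x(i := 0)))\<^sup>2 \<partial>?W)"
    by (rule efron_stein[where f = capped_weight and a = 0, OF prob_space_exp1 _ I capped_weight_measurable capped_weight_abs]) simp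
  have 2: "(\<Sum>i\<in>I. \<integral>x. (capped_weight x - capped_weight (x(i := 0)))\<^sup>2 \<partial>?W) \<le> (\<Sum>i\<in>I. 2 * (\<integral>x. below_gap i x \<partial>?W))"
    by (rule sum_mono) (rule capped_weight_coordinate_second_moment)
  have 3: "(\<Sum>i\<in>I. 2 * (\<integral>x. below_gap i x \<partial>?W)) = 2 * (\<integral>x. (\<Sum>i\<in>I. below_gap i x) \<partial>?W)"
    unfolding sum_distrib_left[symmetric]
    by (subst Bochner_Integration.integral_sum) (auto intro: below_gap_integrable)
  have 4: "(\<integral>x. (\<Sum>i\<in>I. below_gap i x) \<partial>?W) \<le> (\<integral>x. capped_weight x \<partial>?W)"
  proof (rule integral_mono)
    show "integrable ?W (\<lambda>x. \<Sum>i\<in>I. below_gap i x)"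
      by (intro Bochner_Integration.integrable_sum below_gap_integrable)
    show "integrable ?W capped_weight"
      by (rule W.bounded_integrable[OF capped_weight_measurable capped_weight_abs])
    show "(\<Sum>i\<in>I. below_gap i x) \<le> capped_weight x" for x
      unfolding below_gap_def by (rule sum_below_gap_le)
  qed
  from 1 2 3 4 show ?thesis by linarith
qed

end

section \<open>Concentration of the minimum weight around its median\<close>

abbreviation exp_weights :: "'e set \<Rightarrow> ('e \<Rightarrow> real) measure" where
  "exp_weights I \<equiv> PiM I (\<lambda>_. exp1)"

lemma prob_space_exp_weights: "prob_space (exp_weights I)"
  by (rule prob_space_PiM) (rule prob_space_exp1)

lemma measure_exp_weights_box:
  assumes "finite I" "\<And>e. e \<in> I \<Longrightarrow> X e \<in> sets borel"
  shows "measure (exp_weights I) (PiE I X) = (\<Prod>e\<in>I. measure exp1 (X e))"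
proof -
  interpret finite_product_prob_space "\<lambda>_. exp1" I
    by standard (rule assms)
  show ?thesis using assms by (intro prob_times) auto
qed

lemma measure_exp_weights_le_threshold:
  assumes I: "finite I" and B: "B \<subseteq> I" and t: "0 \<le> t"
  shows "measure (exp_weights I) {x \<in> space (exp_weights I). \<forall>e\<in>B. x e \<le> t} = (1 - exp (- t)) ^ card B"
proof -
  have "{x \<in> space (exp_weights I). \<forall>e\<in>B. x e \<le> t} = PiE I (\<lambda>e. if e \<in> B then {..t} else UNIV)"
    using B by (auto simp: space_PiM PiE_iff extensional_def split: if_splits)
  then have "measure (exp_weights I) {x \<in> space (exp_weights I). \<forall>e\<in>B. x e \<le> t}
      = (\<Prod>e\<in>I. measure exp1 (if e \<in> B then {..t} else UNIV))"
    using I by (simp add: measure_exp_weights_box)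
  also have "\<dots> = (\<Prod>e\<in>I. if e \<in> B then 1 - exp (- t) else 1)"
    using exp1.prob_space t by (intro prod.cong) (auto simp: measure_exp1_atMost)
  also have "\<dots> = (1 - exp (- t)) ^ card B"
    using I B by (simp add: prod.If_cases Int_absorb1)
  finally show ?thesis .
qed

text \<open>The set of elements of weight at most \<open>t\<close> is a random subset with \<open>p = 1 - exp (- t)\<close>. This
transports the discrete inequalities to the weights.\<close>

lemma
  assumes I: "finite I" and t: "0 \<le> t"
  shows light_set_measurable: "{x \<in> space (exp_weights I). A {e \<in> I. x e \<le> t}} \<in> sets (exp_weights I)"
    and measure_exp_weights_light_set: "measure (exp_weights I) {x \<in> space (exp_weights I). A {e \<in> I. x e \<le> t}}
      = bexp (1 - exp (- t)) I (\<lambda>R. of_bool (A R))"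
proof -
  interpret prob_space "exp_weights I" by (rule prob_space_exp_weights)
  let ?box = "\<lambda>R. PiE I (\<lambda>e. if e \<in> R then {..t} else {t<..})"
  have mem: "x \<in> ?box R \<longleftrightarrow> x \<in> space (exp_weights I) \<and> {e \<in> I. x e \<le> t} = R" if "R \<subseteq> I" for x R
  proof
    assume x: "x \<in> ?box R"
    then have "x e \<le> t \<longleftrightarrow> e \<in> R" if "e \<in> I" for e
      using that by (auto simp: PiE_iff not_le dest!: bspec[of I _ e] split: if_splits)
    then have "{e \<in> I. x e \<le> t} = R" using that by auto
    moreover have "x \<in> space (exp_weights I)" using x by (auto simp: space_PiM PiE_iff)
    ultimately show "x \<in> space (exp_weights I) \<and> {e \<in> I. x e \<le> t} = R" by simp
  next
    assume x: "x \<in> space (exp_weights I) \<and> {e \<in> I. x e \<le> t} = R"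
    then show "x \<in> ?box R" by (auto simp: space_PiM PiE_iff not_le)
  qed
  have set_eq: "{x \<in> space (exp_weights I). A {e \<in> I. x e \<le> t}} = (\<Union>R\<in>{R \<in> Pow I. A R}. ?box R)" (is "?L = ?R")
  proof (intro equalityI subsetI)
    fix x assume "x \<in> ?L"
    then have x: "x \<in> space (exp_weights I)" "A {e \<in> I. x e \<le> t}" by auto
    then have "x \<in> ?box {e \<in> I. x e \<le> t}" by (subst mem) auto
    with x(2) show "x \<in> ?R" by (intro UN_I[of "{e \<in> I. x e \<le> t}"]) simp_all
  next
    fix x assume "x \<in> ?R"
    then obtain R where "R \<subseteq> I" "A R" "x \<in> ?box R" by auto
    then show "x \<in> ?L" using mem[of R x] by simp
  qed
  have fin: "finite {R \<in> Pow I. A R}" using I by simp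
  have sets: "?box R \<in> sets (exp_weights I)" for R
    using I by (intro sets_PiM_I_finite) auto
  show "{x \<in> space (exp_weights I). A {e \<in> I. x e \<le> t}} \<in> sets (exp_weights I)"
    unfolding set_eq using fin sets by auto
  have disj: "disjoint_family_on ?box {R \<in> Pow I. A R}"
    unfolding disjoint_family_on_def
  proof (intro ballI impI equals0I)
    fix R R' x assume "R \<in> {R \<in> Pow I. A R}" "R' \<in> {R \<in> Pow I. A R}" "R \<noteq> R'" "x \<in> ?box R \<inter> ?box R'"
    then have R: "R \<subseteq> I" "R' \<subseteq> I" "R \<noteq> R'" and x: "x \<in> ?box R" "x \<in> ?box R'" by auto
    show False
      using mem[THEN iffD1, OF R(1) x(1)] mem[THEN iffD1, OF R(2) x(2)] R(3) by simp
  qed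
  have box: "measure (exp_weights I) (?box R) = (1 - exp (- t)) ^ card R * (1 - (1 - exp (- t))) ^ card (I - R)"
    if R: "R \<subseteq> I" for R
  proof -
    have "measure (exp_weights I) (?box R) = (\<Prod>e\<in>I. measure exp1 (if e \<in> R then {..t} else {t<..}))"
      using I by (intro measure_exp_weights_box) auto
    also have "\<dots> = (\<Prod>e\<in>I. if e \<in> R then 1 - exp (- t) else exp (- t))"
      using t by (intro prod.cong) (auto simp: measure_exp1_atMost measure_exp1_greaterThan)
    also have "\<dots> = (1 - exp (- t)) ^ card R * exp (- t) ^ card (I - R)"
      using I R by (simp add: prod.If_cases Int_absorb1 Diff_eq)
    finally show ?thesis by simp
  qed
  have "measure (exp_weights I) {x \<in> space (exp_weights I). A {e \<in> I. x e \<le> t}} = (\<Sum>R\<in>{R \<in> Pow I. A R}. measure (exp_weights I) (?box R))"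
    unfolding set_eq using fin sets disj by (intro finite_measure_finite_Union) auto
  also have "\<dots> = (\<Sum>R\<in>{R \<in> Pow I. A R}. (1 - exp (- t)) ^ card R * (1 - (1 - exp (- t))) ^ card (I - R))"
    by (intro sum.cong box) auto
  also have "\<dots> = bexp (1 - exp (- t)) I (\<lambda>R. of_bool (A R))"
    unfolding bexp_def using I by (intro sum.mono_neutral_cong_left) auto
  finally show "measure (exp_weights I) {x \<in> space (exp_weights I). A {e \<in> I. x e \<le> t}}
      = bexp (1 - exp (- t)) I (\<lambda>R. of_bool (A R))" .
qed

lemma measure_exp_weights_out_of_range:
  assumes I: "finite I" and T: "0 \<le> T"
  shows "{x \<in> space (exp_weights I). \<exists>e\<in>I. x e < 0 \<or> T < x e} \<in> sets (exp_weights I)" (is ?meas)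
    and "measure (exp_weights I) {x \<in> space (exp_weights I). \<exists>e\<in>I. x e < 0 \<or> T < x e} \<le> card I * exp (- T)" (is ?bound)
proof -
  interpret prob_space "exp_weights I" by (rule prob_space_exp_weights)
  have eq: "{x \<in> space (exp_weights I). \<exists>e\<in>I. x e < 0 \<or> T < x e}
      = (\<Union>e\<in>I. {x \<in> space (exp_weights I). x e < 0 \<or> T < x e})" by auto
  have sets: "{x \<in> space (exp_weights I). x e < 0 \<or> T < x e} \<in> sets (exp_weights I)" if e [measurable]: "e \<in> I" for e
    by measurable
  then show ?meas unfolding eq using I by auto
  have single: "measure (exp_weights I) {x \<in> space (exp_weights I). x e < 0 \<or> T < x e} \<le> exp (- T)" if e: "e \<in> I" for e
  proof -
    have "measure exp1 ({..<0} \<union> {T<..}) = measure (distr (exp_weights I) exp1 (\<lambda>x. x e)) ({..<0} \<union> {T<..})"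
      using e by (subst distr_PiM_component) (auto intro: prob_space_exp1)
    also have "\<dots> = measure (exp_weights I) ((\<lambda>x. x e) -` ({..<0} \<union> {T<..}) \<inter> space (exp_weights I))"
      using e by (intro measure_distr) auto
    also have "(\<lambda>x. x e) -` ({..<0} \<union> {T<..}) \<inter> space (exp_weights I) = {x \<in> space (exp_weights I). x e < 0 \<or> T < x e}"
      by auto
    finally have "measure (exp_weights I) {x \<in> space (exp_weights I). x e < 0 \<or> T < x e} = measure exp1 ({..<0} \<union> {T<..})" by simp
    also have "\<dots> \<le> measure exp1 {..<0} + measure exp1 {T<..}"
      by (intro measure_Un_le) auto
    finally show ?thesis using T by (simp add: measure_exp1_lessThan_0 measure_exp1_greaterThan)
  qed
  have "measure (exp_weights I) (\<Union>e\<in>I. {x \<in> space (exp_weights I). x e < 0 \<or> T < x e})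
      \<le> (\<Sum>e\<in>I. measure (exp_weights I) {x \<in> space (exp_weights I). x e < 0 \<or> T < x e})"
    using I sets by (intro finite_measure_subadditive_finite) auto
  also have "\<dots> \<le> (\<Sum>e\<in>I. exp (- T))" by (intro sum_mono single)
  finally show ?bound unfolding eq by simp
qed

text \<open>By Chebyshev's inequality and \<open>Var f \<le> 2 E f\<close>, the truncated minimum \<open>f\<close> is within
\<open>O (sqrt (E f))\<close> of its mean \<open>E\<close>. Both defining events of a median have probability at least
\<open>1/2\<close>, so each contains a point where \<open>f\<close> is untruncated and close to \<open>E\<close>; this puts \<open>m\<close> close to
\<open>E\<close>. The same argument with deviation \<open>E / 2\<close> shows \<open>E = O m\<close> and thereby expresses the
fluctuations by \<open>m\<close>, which is where \<open>m \<ge> 1\<close> enters. The constant depends on nothing but \<open>\<epsilon>\<close>.\<close>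

theorem min_weight_concentration:
  assumes "0 < \<epsilon>"
  obtains C where "\<And>(I :: 'e set) \<F> m.
      \<lbrakk>finite I; finite \<F>; \<F> \<noteq> {}; \<Union>\<F> \<subseteq> I; 1 \<le> m;
       1/2 \<le> measure (exp_weights I) {x \<in> space (exp_weights I). min_weight \<F> x \<le> m};
       1/2 \<le> measure (exp_weights I) {x \<in> space (exp_weights I). m \<le> min_weight \<F> x}\<rbrakk>
      \<Longrightarrow> measure (exp_weights I) {x \<in> space (exp_weights I). \<bar>min_weight \<F> x - m\<bar> > C * sqrt m} < \<epsilon>"
proof
  define \<delta> where "\<delta> = min (\<epsilon> / 4) (1/8)"
  have \<delta>: "0 < \<delta>" "\<delta> \<le> 1/8" "2 * \<delta> < \<epsilon>" using assms by (auto simp: \<delta>_def)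
  fix I :: "'e set" and \<F> m
  assume I: "finite I" and \<F>: "finite \<F>" "\<F> \<noteq> {}" "\<Union>\<F> \<subseteq> I" and m: "1 \<le> m"
    and med_le: "1/2 \<le> measure (exp_weights I) {x \<in> space (exp_weights I). min_weight \<F> x \<le> m}"
    and med_ge: "1/2 \<le> measure (exp_weights I) {x \<in> space (exp_weights I). m \<le> min_weight \<F> x}"
  interpret prob_space "exp_weights I" by (rule prob_space_exp_weights)
  obtain T where T: "0 \<le> T" "card I * exp (- T) \<le> \<delta>"
  proof -
    define T where "T = max 0 (ln (card I / \<delta>))"
    have "card I * exp (- T) \<le> \<delta>"
    proof (cases "card I = 0")
      case False
      then have "card I / \<delta> = exp (ln (card I / \<delta>))" using \<delta> by simp
      also have "\<dots> \<le> exp T" by (simp add: T_def)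
      finally have "card I / \<delta> \<le> exp T" .
      then show ?thesis using \<delta> by (simp add: exp_minus field_simps)
    qed (use \<delta> in simp)
    then show ?thesis using that[of T] by (simp add: T_def)
  qed
  let ?f = "capped_weight \<F> T" and ?F = "min_weight \<F>"
  define N where "N = {x \<in> space (exp_weights I). \<exists>e\<in>I. x e < 0 \<or> T < x e}"
  have N: "N \<in> sets (exp_weights I)" "prob N \<le> \<delta>"
    using measure_exp_weights_out_of_range[OF I T(1)] T(2) by (auto simp: N_def)
  have F_eq: "?F x = ?f x" if "x \<in> space (exp_weights I)" "x \<notin> N" for x
    unfolding capped_weight_def[OF \<F> I T(1)]
  proof (rule min_weight_cong)
    fix e assume "e \<in> \<Union>\<F>"
    then have "e \<in> I" using \<F>(3) by (rule subsetD[rotated])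
    then have "0 \<le> x e" "x e \<le> T" using that by (auto simp: N_def not_less)
    then show "x e = truncate T (x e)" by (simp add: truncate_def)
  qed
  have F_meas [measurable]: "?F \<in> borel_measurable (exp_weights I)"
    using \<F> by (intro min_weight_measurable[of _ I]) auto
  have f_meas [measurable]: "?f \<in> borel_measurable (exp_weights I)"
    by (rule capped_weight_measurable[OF \<F> I T(1)])
  have f_abs: "\<bar>?f x\<bar> \<le> card I * T" for x
    by (rule capped_weight_abs[OF \<F> I T(1)])
  have int1: "integrable (exp_weights I) ?f" by (rule bounded_integrable[OF f_meas f_abs])
  have int2: "integrable (exp_weights I) (\<lambda>x. (?f x)\<^sup>2)"
  proof (rule bounded_integrable)
    show "\<bar>(?f x)\<^sup>2\<bar> \<le> (card I * T)\<^sup>2" for x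
      using power_mono[OF f_abs[of x], of 2] by simp
  qed measurable
  define E where "E = expectation ?f"
  have E0: "0 \<le> E" unfolding E_def by (intro Bochner_Integration.integral_nonneg capped_weight_nonneg[OF \<F> I T(1)])
  have var: "variance ?f \<le> 2 * E"
    using variance_eq[OF int1 int2] capped_weight_variance[OF \<F> I T(1)] by (simp add: E_def)
  define D where "D = (\<lambda>s. {x \<in> space (exp_weights I). s \<le> \<bar>?f x - E\<bar>})"
  have D_sets: "D s \<in> sets (exp_weights I)" for s unfolding D_def by measurable
  have cheb: "prob (D s) \<le> 2 * E / s\<^sup>2" if "0 < s" for s
  proof -
    have "prob (D s) \<le> variance ?f / s\<^sup>2"
      unfolding D_def E_def using that int2 by (intro Chebyshev_inequality) auto
    also have "\<dots> \<le> 2 * E / s\<^sup>2" using var by (intro divide_right_mono) auto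
    finally show ?thesis .
  qed
  have witness: "\<exists>x\<in>A. ?F x = ?f x \<and> \<bar>?f x - E\<bar> < s"
    if "A \<in> sets (exp_weights I)" "1/2 \<le> prob A" "prob (D s) \<le> 1/8" for A s
  proof (rule ccontr)
    assume H: "\<not> ?thesis"
    have "A \<subseteq> N \<union> D s"
    proof
      fix x assume x: "x \<in> A"
      then have "x \<in> space (exp_weights I)" using sets.sets_into_space[OF that(1)] by (rule subsetD[rotated])
      then show "x \<in> N \<union> D s" using H x F_eq[of x] by (auto simp: D_def not_less)
    qed
    then have "prob A \<le> prob (N \<union> D s)" using N D_sets by (intro finite_measure_mono) auto
    also have "\<dots> \<le> prob N + prob (D s)" using N D_sets by (intro measure_Un_le) auto
    finally show False using N that \<delta> by linarith
  qed
  have A1: "{x \<in> space (exp_weights I). ?F x \<le> m} \<in> sets (exp_weights I)" by measurable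
  have A2: "{x \<in> space (exp_weights I). m \<le> ?F x} \<in> sets (exp_weights I)" by measurable
  have E_le: "E \<le> 64 * m"
  proof (cases "E \<le> 64")
    case False
    have "prob (D (E / 2)) \<le> 2 * E / (E / 2)\<^sup>2" using False by (intro cheb) auto
    also have "\<dots> = 8 / E" using False by (simp add: power2_eq_square field_simps)
    also have "\<dots> \<le> 1/8" using False by (simp add: field_simps)
    finally obtain x where "?F x \<le> m" "?F x = ?f x" "\<bar>?f x - E\<bar> < E / 2"
      using witness[OF A1 med_le, of "E / 2"] by auto
    then show ?thesis using m by linarith
  qed (use m in simp)
  \<comment> \<open>As \<open>2 E \<le> 128 m\<close>, Chebyshev's inequality bounds the probability of a deviation by \<open>s\<close> by \<open>\<delta>\<close>.\<close>
  define s where "s = sqrt (128 * m / \<delta>)"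
  have s: "0 < s" "s\<^sup>2 = 128 * m / \<delta>" using m \<delta> by (auto simp: s_def)
  have Ds: "prob (D s) \<le> \<delta>"
  proof -
    have "prob (D s) \<le> 2 * E / s\<^sup>2" by (rule cheb[OF s(1)])
    also have "\<dots> \<le> 128 * m / s\<^sup>2" using E_le by (intro divide_right_mono) auto
    also have "\<dots> = \<delta>" unfolding s(2) using m \<delta> by simp
    finally show ?thesis .
  qed
  then have Ds8: "prob (D s) \<le> 1/8" using \<delta> by linarith
  obtain x where "?F x \<le> m" "?F x = ?f x" "\<bar>?f x - E\<bar> < s"
    using witness[OF A1 med_le Ds8] by auto
  moreover obtain y where "m \<le> ?F y" "?F y = ?f y" "\<bar>?f y - E\<bar> < s"
    using witness[OF A2 med_ge Ds8] by auto
  ultimately have mE: "\<bar>m - E\<bar> < s" by linarith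
  have two_s: "2 * sqrt (128 / \<delta>) * sqrt m = 2 * s"
    by (simp add: s_def real_sqrt_mult real_sqrt_divide)
  have "{x \<in> space (exp_weights I). \<bar>?F x - m\<bar> > 2 * sqrt (128 / \<delta>) * sqrt m} \<subseteq> N \<union> D s"
  proof
    fix x assume x: "x \<in> {x \<in> space (exp_weights I). \<bar>?F x - m\<bar> > 2 * sqrt (128 / \<delta>) * sqrt m}"
    show "x \<in> N \<union> D s"
    proof (cases "x \<in> N")
      case False
      then have "?F x = ?f x" using x F_eq by auto
      then have "s \<le> \<bar>?f x - E\<bar>" using x mE two_s by auto
      then show ?thesis using x by (simp add: D_def)
    qed simp
  qed
  then have "prob {x \<in> space (exp_weights I). \<bar>?F x - m\<bar> > 2 * sqrt (128 / \<delta>) * sqrt m} \<le> prob (N \<union> D s)"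
    using N D_sets by (intro finite_measure_mono) auto
  also have "\<dots> \<le> prob N + prob (D s)" using N D_sets by (intro measure_Un_le) auto
  also have "\<dots> < \<epsilon>" using N Ds \<delta> by linarith
  finally show "prob {x \<in> space (exp_weights I). \<bar>?F x - m\<bar> > 2 * sqrt (128 / \<delta>) * sqrt m} < \<epsilon>" .
qed

section \<open>Light copies of a graph in a vertex set\<close>

text \<open>Labelled copies: a copy of \<open>H\<close> occurs once for each automorphism, which only changes constants.
Extensionality makes the set of embeddings finite.\<close>

definition embeddings :: "'a graph \<Rightarrow> 'b set \<Rightarrow> ('a \<Rightarrow> 'b) set" where
  "embeddings H S = {\<phi> \<in> verts H \<rightarrow>\<^sub>E S. inj_on \<phi> (verts H)}"

definition edge_image :: "('a \<Rightarrow> 'b) \<Rightarrow> 'a graph \<Rightarrow> 'b set set" where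
  "edge_image \<phi> H = (\<lambda>e. \<phi> ` e) ` edges H"

lemma finite_edges: "finite_simple_graph H \<Longrightarrow> finite (edges H)"
  unfolding finite_simple_graph_def by (meson finite_imp_finite_nsets finite_subset)

lemma edge_subset_verts: "finite_simple_graph H \<Longrightarrow> e \<in> edges H \<Longrightarrow> e \<subseteq> verts H"
  unfolding finite_simple_graph_def nsets_def by auto

lemma finite_embeddings: "finite_simple_graph H \<Longrightarrow> finite S \<Longrightarrow> finite (embeddings H S)"
  unfolding embeddings_def finite_simple_graph_def
  by (rule finite_subset[of _ "verts H \<rightarrow>\<^sub>E S"]) (auto intro: finite_PiE)

lemma inj_on_edges:
  assumes "finite_simple_graph H" "inj_on \<phi> (verts H)"
  shows "inj_on (\<lambda>e. \<phi> ` e) (edges H)"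
  using assms edge_subset_verts[OF assms(1)] by (intro inj_onI) (metis inj_on_image_eq_iff)

lemma card_edge_image:
  assumes "finite_simple_graph H" "inj_on \<phi> (verts H)"
  shows "card (edge_image \<phi> H) = card (edges H)"
  unfolding edge_image_def by (rule card_image[OF inj_on_edges[OF assms]])

lemma edge_image_nsets:
  assumes "finite_simple_graph H" "\<phi> \<in> embeddings H S"
  shows "edge_image \<phi> H \<subseteq> nsets S 2"
proof
  fix f assume "f \<in> edge_image \<phi> H"
  then obtain e where e: "e \<in> edges H" "f = \<phi> ` e" by (auto simp: edge_image_def)
  then have ev: "e \<subseteq> verts H" "card e = 2" "finite e"
    using assms(1) by (auto simp: finite_simple_graph_def nsets_def)
  then have "card f = 2"
    using assms(2) e(2) by (subst e(2), subst card_image) (auto simp: embeddings_def intro: inj_on_subset)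
  then show "f \<in> nsets S 2"
    using ev e(2) assms(2) by (auto simp: nsets_def embeddings_def)
qed

lemma finite_densities:
  assumes "finite_simple_graph H"
  shows "finite {density1 G |G. subgraph_of G H \<and> 2 \<le> card (verts G)}"
proof -
  have "{density1 G |G. subgraph_of G H \<and> 2 \<le> card (verts G)} \<subseteq> density1 ` (Pow (verts H) \<times> Pow (edges H))"
    by (auto simp: subgraph_of_def image_iff)
  moreover have "finite (Pow (verts H) \<times> Pow (edges H))"
    using assms finite_edges[OF assms] by (simp add: finite_simple_graph_def)
  ultimately show ?thesis by (meson finite_imageI finite_subset)
qed

lemma card_edges_le_dstar:
  assumes "finite_simple_graph H" "subgraph_of G H" "2 \<le> card (verts G)"
  shows "real (card (edges G)) \<le> dstar H * (real (card (verts G)) - 1)"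
proof -
  have "density1 G \<le> dstar H"
    unfolding dstar_def using assms by (intro Max_ge finite_densities CollectI exI[of _ G]) auto
  then show ?thesis using assms(3) by (simp add: density1_def field_simps)
qed

lemma dstar_attained:
  assumes "finite_simple_graph H" "2 \<le> card (verts H)"
  obtains G where "subgraph_of G H" "2 \<le> card (verts G)"
    "real (card (edges G)) = dstar H * (real (card (verts G)) - 1)"
proof -
  have "subgraph_of H H" using assms by (simp add: subgraph_of_def)
  then have "{density1 G |G. subgraph_of G H \<and> 2 \<le> card (verts G)} \<noteq> {}"
    using assms(2) by blast
  then have "dstar H \<in> {density1 G |G. subgraph_of G H \<and> 2 \<le> card (verts G)}"
    unfolding dstar_def using assms(1) by (intro Max_in finite_densities)
  then obtain G where G: "subgraph_of G H" "2 \<le> card (verts G)" "dstar H = density1 G" by auto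
  then show ?thesis by (intro that[of G]) (auto simp: density1_def)
qed

lemma card_embeddings_ge:
  assumes "finite (verts H)" "finite S" "2 * card (verts H) \<le> card S"
  shows "(real (card S) / 2) ^ card (verts H) \<le> real (card (embeddings H S))"
proof -
  have "real (card (embeddings H S)) = (\<Prod>i = 0..<card (verts H). real (card S - i))"
    unfolding embeddings_def using card_inj_on_subset_funcset[OF assms(1,2) order.refl] by simp
  also have "\<dots> \<ge> (\<Prod>i = 0..<card (verts H). real (card S) / 2)"
    using assms(3) by (intro prod_mono) auto
  finally show ?thesis by simp
qed

text \<open>In terms of a subgraph with \<open>f\<close> edges and \<open>w\<close> vertices: at \<open>p \<ge> C m^(-1/d)\<close>, the order
\<open>m^w p^f\<close> of its expected number of copies among \<open>m\<close> vertices is at least \<open>C m\<close>.\<close>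

lemma threshold_power_bound:
  fixes p m C d :: real and f w :: nat
  assumes p: "0 < p" "p \<le> 1" and C: "1 \<le> C" and d: "1 \<le> d" and m: "1 \<le> m"
    and th: "C \<le> p * m powr (1 / d)" and f: "real f \<le> d * (real w - 1)" and w: "2 \<le> w"
  shows "C * m \<le> p ^ f * m ^ w"
proof -
  have dw: "1 \<le> d * (real w - 1)" using d w mult_mono[of 1 d 1 "real w - 1"] by simp
  have "C = C powr 1" using C by simp
  also have "\<dots> \<le> C powr (d * (real w - 1))" using C dw by (intro powr_mono) auto
  also have "\<dots> \<le> (p * m powr (1 / d)) powr (d * (real w - 1))"
    using C th dw by (intro powr_mono2) auto
  also have "\<dots> = p powr (d * (real w - 1)) * m powr (real w - 1)"
    using p m d by (simp add: powr_mult powr_powr)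
  also have "\<dots> \<le> p powr real f * m powr (real w - 1)"
    using p f by (intro mult_right_mono powr_mono') auto
  finally have "C * m \<le> p powr real f * m powr (real w - 1) * m powr 1"
    using m by (intro mult_mono) auto
  also have "\<dots> = p powr real f * m powr (real w)"
    by (simp only: mult.assoc powr_add[symmetric]) simp
  also have "\<dots> = p ^ f * m ^ w" using p m by (simp add: powr_realpow)
  finally show ?thesis .
qed

text \<open>If the copies \<open>\<phi>\<close> and \<open>\<psi>\<close> share an edge, then the vertices that \<open>\<psi>\<close> sends into the image of
\<open>\<phi>\<close>, together with the shared edges, form a subgraph of \<open>H\<close>, so its density is at most
\<open>dstar H\<close>. With \<open>w\<close> such vertices, \<open>threshold_power_bound\<close> bounds the joint probability by
\<open>p^(2 e) m^w / (C m)\<close>. The sum of \<open>m^w\<close> over all maps \<open>\<psi>\<close> factorises over the vertices of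
\<open>H\<close>, where each factor is at most \<open>(v + 1) m\<close>.\<close>

lemma overlapping_copies_bound:
  fixes p C :: real
  assumes H: "finite_simple_graph H" and d: "1 \<le> dstar H"
    and S: "finite S" "1 \<le> card S"
    and p: "0 < p" "p \<le> 1" and C: "1 \<le> C" and th: "C \<le> p * real (card S) powr (1 / dstar H)"
    and \<phi>: "\<phi> \<in> embeddings H S"
  shows "(\<Sum>\<psi>\<in>{\<psi>\<in>embeddings H S. edge_image \<phi> H \<inter> edge_image \<psi> H \<noteq> {}}.
            p ^ card (edge_image \<phi> H \<union> edge_image \<psi> H)) * (C * card S)
    \<le> p ^ (2 * card (edges H)) * ((real (card (verts H)) + 1) * real (card S)) ^ card (verts H)"
proof -
  define V where "V = verts H"
  define m where "m = card S"
  have finV: "finite V" using H by (simp add: V_def finite_simple_graph_def)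
  define W where "W = (\<lambda>\<psi>. {u \<in> V. \<psi> u \<in> \<phi> ` V})"
  let ?J = "{\<psi>\<in>embeddings H S. edge_image \<phi> H \<inter> edge_image \<psi> H \<noteq> {}}"
  have finite_ei: "finite (edge_image \<psi> H)" for \<psi> :: "'a \<Rightarrow> 'b"
    using finite_edges[OF H] by (simp add: edge_image_def)
  have single: "p ^ card (edge_image \<phi> H \<union> edge_image \<psi> H) * (C * m)
      \<le> p ^ (2 * card (edges H)) * (\<Prod>u\<in>V. if \<psi> u \<in> \<phi> ` V then real m else 1)"
    if \<psi>: "\<psi> \<in> ?J" for \<psi>
  proof -
    have inj: "inj_on \<psi> V" "inj_on \<phi> V" using \<psi> \<phi> by (auto simp: embeddings_def V_def)
    define F where "F = {e \<in> edges H. \<psi> ` e \<in> edge_image \<phi> H}"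
    have F_img: "edge_image \<phi> H \<inter> edge_image \<psi> H = (\<lambda>e. \<psi> ` e) ` F"
    proof (intro equalityI subsetI)
      fix f assume f: "f \<in> edge_image \<phi> H \<inter> edge_image \<psi> H"
      then obtain e where "e \<in> edges H" "f = \<psi> ` e" by (auto simp: edge_image_def)
      then show "f \<in> (\<lambda>e. \<psi> ` e) ` F" using f by (intro image_eqI[of _ _ e]) (auto simp: F_def)
    qed (auto simp: F_def edge_image_def)
    then have cardF: "card (edge_image \<phi> H \<inter> edge_image \<psi> H) = card F"
      using inj_on_subset[OF inj_on_edges[OF H], of \<psi> F] inj by (simp add: card_image F_def V_def)
    have FW: "F \<subseteq> nsets (W \<psi>) 2"
    proof
      fix e assume e: "e \<in> F"
      then obtain e' where e': "e' \<in> edges H" "\<psi> ` e = \<phi> ` e'" by (auto simp: F_def edge_image_def)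
      have "e \<subseteq> V" "e' \<subseteq> V" using e e' edge_subset_verts[OF H] by (auto simp: F_def V_def)
      moreover from this have "\<psi> ` e \<subseteq> \<phi> ` V" unfolding e'(2) by (intro image_mono)
      ultimately have "e \<subseteq> W \<psi>" by (auto simp: W_def)
      moreover have "e \<in> nsets V 2" using e H by (auto simp: F_def finite_simple_graph_def V_def)
      ultimately show "e \<in> nsets (W \<psi>) 2" by (auto simp: nsets_def)
    qed
    have finW: "finite (W \<psi>)" using finV by (simp add: W_def)
    have "F \<noteq> {}" using \<psi> F_img by auto
    then obtain e where "e \<in> F" by auto
    then have e: "e \<subseteq> W \<psi>" "card e = 2" using FW by (auto simp: nsets_def)
    then have w2: "2 \<le> card (W \<psi>)" using card_mono[OF finW e(1)] by simp
    have "subgraph_of (W \<psi>, F) H"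
      using FW finW by (auto simp: subgraph_of_def finite_simple_graph_def W_def F_def V_def)
    then have "real (card F) \<le> dstar H * (real (card (W \<psi>)) - 1)"
      using card_edges_le_dstar[OF H, of "(W \<psi>, F)"] w2 by simp
    then have "C * m \<le> p ^ card F * real m ^ card (W \<psi>)"
      using p C d S th w2 by (intro threshold_power_bound[of p C "dstar H"]) (auto simp: m_def)
    then have "p ^ card (edge_image \<phi> H \<union> edge_image \<psi> H) * (C * m)
        \<le> p ^ card (edge_image \<phi> H \<union> edge_image \<psi> H) * (p ^ card F * real m ^ card (W \<psi>))"
      using p by (intro mult_left_mono) auto
    also have "\<dots> = p ^ (card (edge_image \<phi> H \<union> edge_image \<psi> H) + card F) * real m ^ card (W \<psi>)"
      by (simp add: power_add)
    also have "card (edge_image \<phi> H \<union> edge_image \<psi> H) + card F = 2 * card (edges H)"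
      using card_Un_Int[OF finite_ei finite_ei, of \<phi> \<psi>] inj cardF
      by (simp add: card_edge_image[OF H] V_def)
    also have "real m ^ card (W \<psi>) = (\<Prod>u\<in>V. if \<psi> u \<in> \<phi> ` V then real m else 1)"
      using finV by (simp add: prod.If_cases W_def Collect_conj_eq)
    finally show ?thesis .
  qed
  have "(\<Sum>\<psi>\<in>?J. p ^ card (edge_image \<phi> H \<union> edge_image \<psi> H)) * (C * m)
      \<le> (\<Sum>\<psi>\<in>?J. p ^ (2 * card (edges H)) * (\<Prod>u\<in>V. if \<psi> u \<in> \<phi> ` V then real m else 1))"
    unfolding sum_distrib_right by (intro sum_mono single)
  also have "\<dots> \<le> (\<Sum>\<psi>\<in>V \<rightarrow>\<^sub>E S. p ^ (2 * card (edges H)) * (\<Prod>u\<in>V. if \<psi> u \<in> \<phi> ` V then real m else 1))"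
    using p finV S by (intro sum_mono2 finite_PiE mult_nonneg_nonneg prod_nonneg)
      (auto simp: embeddings_def V_def)
  also have "\<dots> = p ^ (2 * card (edges H)) * (\<Sum>\<psi>\<in>V \<rightarrow>\<^sub>E S. \<Prod>u\<in>V. if \<psi> u \<in> \<phi> ` V then real m else 1)"
    by (simp add: sum_distrib_left)
  also have "(\<Sum>\<psi>\<in>V \<rightarrow>\<^sub>E S. \<Prod>u\<in>V. if \<psi> u \<in> \<phi> ` V then real m else 1)
      = (\<Prod>u\<in>V. \<Sum>y\<in>S. if y \<in> \<phi> ` V then real m else 1)"
    using finV S by (subst prod_sum_PiE) auto
  also have "p ^ (2 * card (edges H)) * (\<Prod>u\<in>V. \<Sum>y\<in>S. if y \<in> \<phi> ` V then real m else 1)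
      \<le> p ^ (2 * card (edges H)) * (\<Prod>u\<in>V. (card V + 1) * real m)"
  proof (intro mult_left_mono prod_mono conjI)
    have "(\<Sum>y\<in>S. if y \<in> \<phi> ` V then real m else 1) \<le> (\<Sum>y\<in>S. (if y \<in> \<phi> ` V then real m else 0) + 1)"
      by (intro sum_mono) auto
    also have "\<dots> = real (card (S \<inter> \<phi> ` V)) * m + m"
      using S by (simp add: sum.distrib sum.If_cases m_def)
    also have "card (S \<inter> \<phi> ` V) \<le> card V"
      using card_mono[of "\<phi> ` V" "S \<inter> \<phi> ` V"] card_image_le[OF finV, of \<phi>] finV by simp
    finally show "(\<Sum>y\<in>S. if y \<in> \<phi> ` V then real m else 1) \<le> (card V + 1) * real m"
      by (simp add: algebra_simps mult_right_mono)
    show "0 \<le> (\<Sum>y\<in>S. if y \<in> \<phi> ` V then real m else 1)" by (intro sum_nonneg) auto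
  qed (use p in auto)
  finally show ?thesis by (simp add: V_def m_def add.commute)
qed

text \<open>Janson's inequality for the embeddings of \<open>H\<close> in \<open>S\<close>. There are at least \<open>(m / 2)^v\<close> of them by
\<open>card_embeddings_ge\<close>, so \<open>\<mu>\<^sup>2 / \<Delta>\<close> is at least a constant times \<open>C m\<close>.\<close>

theorem no_copy_probability:
  fixes p C :: real
  assumes H: "finite_simple_graph H" and d: "1 \<le> dstar H"
    and S: "finite S" "2 * card (verts H) \<le> card S" "1 \<le> card S"
    and U: "finite U" "nsets S 2 \<subseteq> U"
    and p: "0 \<le> p" "p \<le> 1" and C: "1 \<le> C" and th: "C \<le> p * real (card S) powr (1 / dstar H)"
  shows "bexp p U (\<lambda>R. of_bool (\<forall>\<phi>\<in>embeddings H S. \<not> edge_image \<phi> H \<subseteq> R))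
    \<le> exp (- (C * card S / (2 * (2 * (real (card (verts H)) + 1)) ^ card (verts H))))"
proof -
  define v where "v = card (verts H)"
  define m where "m = real (card S)"
  define N where "N = real (card (embeddings H S))"
  define q where "q = p ^ (2 * card (edges H))"
  have p0: "0 < p" using p C th by (cases "p = 0") auto
  have m: "1 \<le> m" using S by (simp add: m_def)
  have q: "0 < q" using p0 by (simp add: q_def)
  have N: "(m / 2) ^ v \<le> N"
    using card_embeddings_ge[of H S] H S by (simp add: N_def m_def v_def finite_simple_graph_def)
  then have N0: "0 < N" using m by (auto intro: less_le_trans[rotated])
  define \<Delta> where "\<Delta> = N * (q * ((real v + 1) * m) ^ v / (C * m))"
  have \<Delta>0: "0 < \<Delta>" using N0 q m C by (simp add: \<Delta>_def)
  have "bexp p U (\<lambda>R. of_bool (\<forall>\<phi>\<in>embeddings H S. \<not> edge_image \<phi> H \<subseteq> R))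
      \<le> exp (- ((N * p ^ card (edges H))\<^sup>2 / (2 * \<Delta>)))"
  proof (rule janson[OF U(1) p, where A = "\<lambda>\<phi>. edge_image \<phi> H"])
    show "finite (embeddings H S)" by (rule finite_embeddings[OF H S(1)])
    show "edge_image \<phi> H \<subseteq> U" if "\<phi> \<in> embeddings H S" for \<phi>
      using edge_image_nsets[OF H that] U(2) by blast
    show "N * p ^ card (edges H) = (\<Sum>\<phi>\<in>embeddings H S. p ^ card (edge_image \<phi> H))"
      by (simp add: N_def card_edge_image[OF H] embeddings_def)
    show "(\<Sum>\<phi>\<in>embeddings H S. \<Sum>\<psi>\<in>{\<psi>\<in>embeddings H S. edge_image \<phi> H \<inter> edge_image \<psi> H \<noteq> {}}.
        p ^ card (edge_image \<phi> H \<union> edge_image \<psi> H)) \<le> \<Delta>"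
    proof -
      have "(\<Sum>\<phi>\<in>embeddings H S. \<Sum>\<psi>\<in>{\<psi>\<in>embeddings H S. edge_image \<phi> H \<inter> edge_image \<psi> H \<noteq> {}}.
        p ^ card (edge_image \<phi> H \<union> edge_image \<psi> H))
        \<le> (\<Sum>\<phi>\<in>embeddings H S. q * ((real v + 1) * m) ^ v / (C * m))"
      proof (rule sum_mono)
        fix \<phi> assume \<phi>: "\<phi> \<in> embeddings H S"
        have "0 < C * m" using C m by simp
        then show "(\<Sum>\<psi>\<in>{\<psi>\<in>embeddings H S. edge_image \<phi> H \<inter> edge_image \<psi> H \<noteq> {}}.
            p ^ card (edge_image \<phi> H \<union> edge_image \<psi> H)) \<le> q * ((real v + 1) * m) ^ v / (C * m)"
          using overlapping_copies_bound[OF H d S(1,3) p0 p(2) C th \<phi>]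
          by (subst pos_le_divide_eq) (auto simp: q_def v_def m_def)
      qed
      then show ?thesis by (simp add: \<Delta>_def N_def)
    qed
  qed (rule \<Delta>0)
  also have "(N * p ^ card (edges H))\<^sup>2 / (2 * \<Delta>) = N * (C * m) / (2 * ((real v + 1) * m) ^ v)"
  proof -
    have "(N * p ^ card (edges H))\<^sup>2 = N * N * q"
      by (simp add: q_def power2_eq_square power_mult[symmetric] mult_2 power_add)
    then show ?thesis using N0 q m C by (simp add: \<Delta>_def field_simps)
  qed
  also have "C * m / (2 * (2 * (real v + 1)) ^ v) \<le> N * (C * m) / (2 * ((real v + 1) * m) ^ v)"
  proof -
    have "C * m / (2 * (2 * (real v + 1)) ^ v) = (m / 2) ^ v * (C * m) / (2 * ((real v + 1) * m) ^ v)"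
    proof -
      have "((real v + 1) * m) ^ v = (2 * (real v + 1)) ^ v * (m / 2) ^ v"
        unfolding power_mult_distrib[symmetric] by (rule arg_cong[of _ _ "\<lambda>y. y ^ v"]) simp
      then show ?thesis using m by simp
    qed
    also have "\<dots> \<le> N * (C * m) / (2 * ((real v + 1) * m) ^ v)"
      using N m C by (intro divide_right_mono mult_right_mono) auto
    finally show ?thesis .
  qed
  then have "exp (- (N * (C * m) / (2 * ((real v + 1) * m) ^ v))) \<le> exp (- (C * m / (2 * (2 * (real v + 1)) ^ v)))"
    by simp
  finally show ?thesis by (simp add: m_def v_def)
qed

section \<open>Factors and the greedy construction\<close>

abbreviation copy :: "('a \<Rightarrow> 'b) \<Rightarrow> 'a graph \<Rightarrow> 'b graph" where
  "copy \<phi> H \<equiv> (\<phi> ` verts H, edge_image \<phi> H)"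

lemma copy_iso:
  assumes H: "finite_simple_graph H" and inj: "inj_on \<phi> (verts H)"
  shows "graph_iso (copy \<phi> H) H"
  unfolding graph_iso_def
proof (intro exI[of _ "inv_into (verts H) \<phi>"] conjI)
  show "bij_betw (inv_into (verts H) \<phi>) (verts (copy \<phi> H)) (verts H)"
    using inj by (auto intro: bij_betw_inv_into inj_on_imp_bij_betw)
  have "inv_into (verts H) \<phi> ` \<phi> ` e = e" if "e \<in> edges H" for e
    using inj edge_subset_verts[OF H that] by (rule inv_into_image_cancel)
  then show "edges H = (\<lambda>e. inv_into (verts H) \<phi> ` e) ` edges (copy \<phi> H)"
    by (auto simp: edge_image_def image_image)
qed

lemma copy_subgraph:
  assumes H: "finite_simple_graph H" and \<phi>: "\<phi> \<in> embeddings H S" and S: "S \<subseteq> {..<n}"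
  shows "subgraph_of (copy \<phi> H) (complete_graph n)"
proof -
  have img: "\<phi> ` verts H \<subseteq> S" using \<phi> by (auto simp: embeddings_def)
  have "\<phi> \<in> embeddings H (\<phi> ` verts H)" using \<phi> by (auto simp: embeddings_def)
  then have 1: "edge_image \<phi> H \<subseteq> nsets (\<phi> ` verts H) 2" by (rule edge_image_nsets[OF H])
  have 2: "nsets (\<phi> ` verts H) 2 \<subseteq> nsets {..<n} 2"
    using img S by (intro nsets_mono) auto
  have "finite (\<phi> ` verts H)" using H by (simp add: finite_simple_graph_def)
  then show ?thesis
    using 1 2 img S by (auto simp: subgraph_of_def finite_simple_graph_def complete_graph_def)
qed

lemma embeddings_nonempty:
  assumes "finite (verts H)" "finite S" "card (verts H) \<le> card S"
  shows "embeddings H S \<noteq> {}"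
proof -
  obtain f where f: "f ` verts H \<subseteq> S" "inj_on f (verts H)"
    using card_le_inj[OF assms] by auto
  then have "restrict f (verts H) \<in> embeddings H S"
    by (auto simp: embeddings_def inj_on_restrict_eq)
  then show ?thesis by auto
qed

text \<open>A copy is removed from the vertices that are still uncovered until none are left; \<open>\<tau> m\<close> bounds the
edge weights of the copy chosen when \<open>m\<close> vertices are uncovered.\<close>

lemma greedy_factor:
  fixes H :: "'a graph" and x :: "nat set \<Rightarrow> real" and \<tau> :: "nat \<Rightarrow> real"
  assumes H: "finite_simple_graph H" and v: "1 \<le> card (verts H)"
    and step: "\<And>S. S \<subseteq> {..<n} \<Longrightarrow> card (verts H) \<le> card S \<Longrightarrow>
      \<exists>\<phi>\<in>embeddings H S. \<forall>e\<in>edge_image \<phi> H. x e \<le> \<tau> (card S)"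
    and S: "S \<subseteq> {..<n}" "card S = card (verts H) * k"
  shows "\<exists>Q. finite Q \<and> (\<forall>G\<in>Q. subgraph_of G (complete_graph n) \<and> graph_iso G H) \<and>
    pairwise (\<lambda>G G'. disjnt (verts G) (verts G')) Q \<and> (\<Union>G\<in>Q. verts G) = S \<and>
    factor_weight x Q \<le> card (edges H) * (\<Sum>j = 1..k. \<tau> (card (verts H) * j))"
  using S
proof (induction k arbitrary: S)
  case 0
  then have "S = {}" using finite_subset[of S "{..<n}"] by simp
  then show ?case by (intro exI[of _ "{}"]) (auto simp: factor_weight_def pairwise_def)
next
  case (Suc k)
  have finS: "finite S" using Suc.prems finite_subset[of S "{..<n}"] by simp
  obtain \<phi> where \<phi>: "\<phi> \<in> embeddings H S" "\<And>e. e \<in> edge_image \<phi> H \<Longrightarrow> x e \<le> \<tau> (card S)"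
    using step[of S] Suc.prems by auto
  have inj: "inj_on \<phi> (verts H)" and img: "\<phi> ` verts H \<subseteq> S"
    using \<phi>(1) by (auto simp: embeddings_def)
  have "card (S - \<phi> ` verts H) = card (verts H) * k"
    using Suc.prems img finS inj by (simp add: card_Diff_subset finite_subset card_image)
  moreover have "S - \<phi> ` verts H \<subseteq> {..<n}" using Suc.prems by auto
  ultimately obtain Q where Q: "finite Q" "\<And>G. G \<in> Q \<Longrightarrow> subgraph_of G (complete_graph n) \<and> graph_iso G H"
      "pairwise (\<lambda>G G'. disjnt (verts G) (verts G')) Q" "(\<Union>G\<in>Q. verts G) = S - \<phi> ` verts H"
      "factor_weight x Q \<le> card (edges H) * (\<Sum>j = 1..k. \<tau> (card (verts H) * j))"
    using Suc.IH[of "S - \<phi> ` verts H"] by auto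
  have disj: "disjnt (\<phi> ` verts H) (verts G)" if "G \<in> Q" for G
    using Q(4) that by (auto simp: disjnt_def)
  have "\<phi> ` verts H \<noteq> {}" using v by auto
  then have notin: "copy \<phi> H \<notin> Q" using disj[of "copy \<phi> H"] by (auto simp: disjnt_def)
  have w: "(\<Sum>e\<in>edge_image \<phi> H. x e) \<le> card (edges H) * \<tau> (card (verts H) * Suc k)"
  proof -
    have "(\<Sum>e\<in>edge_image \<phi> H. x e) \<le> (\<Sum>e\<in>edge_image \<phi> H. \<tau> (card S))" by (intro sum_mono \<phi>(2))
    then show ?thesis using card_edge_image[OF H inj] Suc.prems by simp
  qed
  show ?case
  proof (intro exI[of _ "insert (copy \<phi> H) Q"] conjI ballI)
    show "finite (insert (copy \<phi> H) Q)" using Q(1) by simp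
    show "subgraph_of G (complete_graph n)" "graph_iso G H" if "G \<in> insert (copy \<phi> H) Q" for G
      using that Q(2)[of G] copy_subgraph[OF H \<phi>(1) Suc.prems(1)] copy_iso[OF H inj]
      by (elim insertE; simp)+
    show "pairwise (\<lambda>G G'. disjnt (verts G) (verts G')) (insert (copy \<phi> H) Q)"
      using Q(3) disj by (auto simp: pairwise_insert disjnt_sym)
    show "(\<Union>G\<in>insert (copy \<phi> H) Q. verts G) = S" using Q(4) img by auto
    have "factor_weight x (insert (copy \<phi> H) Q) = (\<Sum>e\<in>edge_image \<phi> H. x e) + factor_weight x Q"
      using Q(1) notin by (simp add: factor_weight_def)
    also have "\<dots> \<le> card (edges H) * \<tau> (card (verts H) * Suc k)
        + card (edges H) * (\<Sum>j = 1..k. \<tau> (card (verts H) * j))"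
      using w Q(5) by linarith
    also have "\<dots> = card (edges H) * (\<Sum>j = 1..Suc k. \<tau> (card (verts H) * j))"
      by (simp add: distrib_left)
    finally show "factor_weight x (insert (copy \<phi> H) Q)
        \<le> card (edges H) * (\<Sum>j = 1..Suc k. \<tau> (card (verts H) * j))" .
  qed
qed

text \<open>Members of a factor are vertex-disjoint, hence edge-disjoint, so the weight of a factor is the weight
of its edge set and the minimum factor weight is a \<open>min_weight\<close>.\<close>

definition factor_family :: "real \<Rightarrow> 'a graph \<Rightarrow> nat \<Rightarrow> nat set set set" where
  "factor_family \<alpha> H n = (\<lambda>Q. \<Union>G\<in>Q. edges G) ` {Q. partial_factor \<alpha> H n Q}"

lemma partial_factor_finite:
  assumes "partial_factor \<alpha> H n Q"
  shows "finite Q"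
proof (rule finite_subset)
  show "Q \<subseteq> Pow {..<n} \<times> Pow (nsets {..<n} 2)"
    using assms by (force simp: partial_factor_def subgraph_of_def complete_graph_def)
  show "finite (Pow {..<n} \<times> Pow (nsets {..<n} (2::nat)))"
    by (simp add: finite_imp_finite_nsets)
qed

lemma finite_partial_factors: "finite {Q. partial_factor \<alpha> H n Q}"
proof (rule finite_subset)
  show "{Q. partial_factor \<alpha> H n Q} \<subseteq> Pow (Pow {..<n} \<times> Pow (nsets {..<n} 2))"
    by (force simp: partial_factor_def subgraph_of_def complete_graph_def)
  show "finite (Pow (Pow {..<n} \<times> Pow (nsets {..<n} (2::nat))))"
    by (simp add: finite_imp_finite_nsets)
qed

lemma disjnt_edges:
  assumes "finite_simple_graph G" "finite_simple_graph G'" "disjnt (verts G) (verts G')"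
  shows "edges G \<inter> edges G' = {}"
proof (rule equals0I)
  fix e assume "e \<in> edges G \<inter> edges G'"
  then have "e \<subseteq> verts G" "e \<subseteq> verts G'" "card e = 2"
    using assms by (auto simp: finite_simple_graph_def nsets_def)
  then show False using assms(3) by (auto simp: disjnt_def card_2_iff)
qed

lemma factor_weight_eq_sum:
  assumes "partial_factor \<alpha> H n Q"
  shows "factor_weight x Q = (\<Sum>e\<in>(\<Union>G\<in>Q. edges G). x e)"
proof -
  have fsg: "finite_simple_graph G" if "G \<in> Q" for G
    using assms that by (auto simp: partial_factor_def subgraph_of_def)
  show ?thesis
    unfolding factor_weight_def
  proof (rule sum.UNION_disjoint[symmetric])
    show "\<forall>G\<in>Q. \<forall>G'\<in>Q. G \<noteq> G' \<longrightarrow> edges G \<inter> edges G' = {}"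
    proof (intro ballI impI)
      fix G G' assume G: "G \<in> Q" "G' \<in> Q" "G \<noteq> G'"
      then have "disjnt (verts G) (verts G')"
        using assms by (simp add: partial_factor_def pairwise_def)
      then show "edges G \<inter> edges G' = {}" by (intro disjnt_edges fsg G)
    qed
  qed (use partial_factor_finite[OF assms] fsg finite_edges in auto)
qed

lemma min_factor_weight_eq:
  assumes "0 < n"
  shows "min_factor_weight H x (\<alpha> * real n) n = min_weight (factor_family \<alpha> H n) x"
proof -
  have "{factor_weight x Q |Q. partial_factor \<alpha> H n Q}
      = (\<lambda>B. \<Sum>e\<in>B. x e) ` factor_family \<alpha> H n"
    unfolding factor_family_def image_image using factor_weight_eq_sum[of \<alpha> H n _ x] by force
  then show ?thesis using assms by (simp add: min_factor_weight_def min_weight_def)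
qed

lemma finite_factor_family: "finite (factor_family \<alpha> H n)"
  unfolding factor_family_def by (intro finite_imageI finite_partial_factors)

lemma Union_factor_family: "\<Union>(factor_family \<alpha> H n) \<subseteq> edges (complete_graph n)"
  by (force simp: factor_family_def partial_factor_def subgraph_of_def)

lemma factor_family_greedy:
  fixes H :: "'a graph" and x :: "nat set \<Rightarrow> real" and \<tau> :: "nat \<Rightarrow> real"
  assumes H: "finite_simple_graph H" and v: "1 \<le> card (verts H)" and \<alpha>: "0 \<le> \<alpha>" and n: "n = card (verts H) * k"
    and step: "\<And>S. S \<subseteq> {..<n} \<Longrightarrow> card (verts H) \<le> card S \<Longrightarrow>
      \<exists>\<phi>\<in>embeddings H S. \<forall>e\<in>edge_image \<phi> H. x e \<le> \<tau> (card S)"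
  shows "\<exists>B\<in>factor_family \<alpha> H n. (\<Sum>e\<in>B. x e) \<le> card (edges H) * (\<Sum>j = 1..k. \<tau> (card (verts H) * j))"
proof -
  have card_n: "card {..<n} = card (verts H) * k" using n by simp
  obtain Q where Q: "\<And>G. G \<in> Q \<Longrightarrow> subgraph_of G (complete_graph n) \<and> graph_iso G H"
      "pairwise (\<lambda>G G'. disjnt (verts G) (verts G')) Q" "(\<Union>G\<in>Q. verts G) = {..<n}"
      "factor_weight x Q \<le> card (edges H) * (\<Sum>j = 1..k. \<tau> (card (verts H) * j))"
    using greedy_factor[where n = n and x = x and \<tau> = \<tau>, OF H v step subset_refl card_n] by auto
  have pf: "partial_factor \<alpha> H n Q"
    unfolding partial_factor_def using Q(1,2) \<alpha> by (simp add: Q(3)) (simp add: complete_graph_def)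
  then have "(\<Union>G\<in>Q. edges G) \<in> factor_family \<alpha> H n" by (auto simp: factor_family_def)
  then show ?thesis using Q(4) factor_weight_eq_sum[OF pf, of x] by auto
qed

lemma factor_family_nonempty:
  assumes H: "finite_simple_graph H" and v: "1 \<le> card (verts H)" and \<alpha>: "0 \<le> \<alpha>" and n: "card (verts H) dvd n"
  shows "factor_family \<alpha> H n \<noteq> {}"
proof -
  obtain k where k: "n = card (verts H) * k" using n by auto
  have "\<exists>\<phi>\<in>embeddings H S. \<forall>e\<in>edge_image \<phi> H. (0::real) \<le> 0"
    if "S \<subseteq> {..<n}" "card (verts H) \<le> card S" for S
    using embeddings_nonempty[of H S] that H finite_subset[of S "{..<n}"]
    by (auto simp: finite_simple_graph_def)
  then show ?thesis
    using factor_family_greedy[OF H v \<alpha> k, of "\<lambda>_. 0" "\<lambda>_. 0"] by auto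
qed

text \<open>The left-hand side is one term of the exponential series.\<close>

lemma power_div_fact_le_exp: "0 \<le> x \<Longrightarrow> x ^ k / fact k \<le> exp (x::real)"
proof -
  assume x: "0 \<le> x"
  have s: "(\<lambda>n. x ^ n /\<^sub>R fact n) sums exp x" by (rule exp_converges)
  have "sum (\<lambda>n. x ^ n /\<^sub>R fact n) {k} \<le> suminf (\<lambda>n. x ^ n /\<^sub>R fact n)"
    using s x by (intro sum_le_suminf) (auto simp: sums_iff)
  then show ?thesis using s by (simp add: sums_iff divide_inverse mult.commute)
qed

lemma binomial_le_exp:
  assumes "1 \<le> k"
  shows "real (M choose k) \<le> (exp 1 * real M / real k) ^ k"
proof -
  have "real (M choose k) * fact k \<le> real M ^ k"
    using binomial_fact_pow[of M k] by (metis of_nat_fact of_nat_le_iff of_nat_mult of_nat_power)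
  then have "real (M choose k) \<le> real M ^ k / fact k" by (simp add: field_simps)
  also have "\<dots> = (real M / real k) ^ k * (real k ^ k / fact k)"
    using assms by (simp add: power_divide)
  also have "\<dots> \<le> (real M / real k) ^ k * exp (real k)"
    by (intro mult_left_mono power_div_fact_le_exp) auto
  also have "\<dots> = (exp 1 * real M / real k) ^ k"
    by (simp add: exp_of_nat_mult[symmetric] power_mult_distrib power_divide)
  finally show ?thesis .
qed

text \<open>Comparison with the integral of \<open>y powr (- s)\<close>, done term by term with the mean value theorem.\<close>

lemma sum_powr_le:
  assumes s: "0 \<le> s" "s < 1"
  shows "(\<Sum>m = 1..n. real m powr (- s)) \<le> real n powr (1 - s) / (1 - s)"
proof (induction n)
  case 0
  then show ?case by simp
next
  case (Suc n)
  have "(1 - s) * real (Suc n) powr (- s) \<le> real (Suc n) powr (1 - s) - real n powr (1 - s)"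
  proof (cases "n = 0")
    case True
    then show ?thesis using s by simp
  next
    case False
    have "\<exists>z. real n < z \<and> z < real (Suc n) \<and>
        real (Suc n) powr (1 - s) - real n powr (1 - s) = (real (Suc n) - real n) * ((1 - s) * z powr (1 - s - 1))"
      using False by (intro MVT2) (auto intro!: derivative_eq_intros)
    then obtain z where z: "real n < z" "z < real (Suc n)"
      "real (Suc n) powr (1 - s) - real n powr (1 - s) = (1 - s) * z powr (- s)" by auto
    have "real (Suc n) powr (- s) \<le> z powr (- s)" using z s by (intro powr_mono2') auto
    then show ?thesis unfolding z(3) using s by (intro mult_left_mono) auto
  qed
  then have "real (Suc n) powr (- s) \<le> (real (Suc n) powr (1 - s) - real n powr (1 - s)) / (1 - s)"
    using s by (simp add: field_simps)
  then show ?case using Suc.IH s by (simp add: diff_divide_distrib)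
qed

lemma finite_edges_complete_graph [simp]: "finite (edges (complete_graph n))"
  by (simp add: complete_graph_def finite_imp_finite_nsets)

lemma card_edges_complete_graph_le: "card (edges (complete_graph n)) \<le> n\<^sup>2"
proof -
  have "card (edges (complete_graph n)) = n choose 2"
    by (simp add: complete_graph_def)
  also have "\<dots> \<le> n\<^sup>2" using binomial_fact_pow[of n 2] by (simp add: fact_2)
  finally show ?thesis .
qed

abbreviation edge_weights :: "nat \<Rightarrow> (nat set \<Rightarrow> real) measure" where
  "edge_weights n \<equiv> exp_weights (edges (complete_graph n))"


section \<open>Every large vertex set contains a light copy\<close>

lemma one_minus_exp_ge: "0 \<le> t \<Longrightarrow> t \<le> 1 \<Longrightarrow> t / 2 \<le> 1 - exp (- (t::real))"
proof -
  assume t: "0 \<le> t" "t \<le> 1"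
  have "1 + t \<le> exp t" by (rule exp_ge_add_one_self)
  then have "exp (- t) \<le> 1 / (1 + t)" using t by (simp add: exp_minus field_simps)
  also have "1 / (1 + t) = 1 - t / (1 + t)" using t by (simp add: field_simps)
  also have "t / 2 \<le> t / (1 + t)" using t by (intro divide_left_mono) auto
  then have "1 - t / (1 + t) \<le> 1 - t / 2" by simp
  finally show ?thesis by simp
qed

definition large_set_without_light_copy ::
  "'a graph \<Rightarrow> nat \<Rightarrow> real \<Rightarrow> real \<Rightarrow> real \<Rightarrow> (nat set \<Rightarrow> real) \<Rightarrow> bool" where
  "large_set_without_light_copy H n c \<delta> A x \<longleftrightarrow>
     (\<exists>S\<subseteq>{..<n}. real n powr c \<le> real (card S) \<and>
       (\<forall>\<phi>\<in>embeddings H S. \<not> (\<forall>e\<in>edge_image \<phi> H.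
          x e \<le> A * (real n / real (card S)) powr \<delta> * real (card S) powr (- (1 / dstar H)))))"

text \<open>With thresholds \<open>2 A (n/m)^\<delta> m^(-1/d)\<close>, a fixed set of \<open>m\<close> vertices fails with probability at most
\<open>exp (- \<kappa> A (n/m)^\<delta> m)\<close>, and there are at most \<open>(e n/m)^m\<close> sets of that size. The logarithm of
\<open>n/m\<close> is at most \<open>(n/m)^\<delta> / \<delta>\<close>, so the union bound succeeds as soon as \<open>\<kappa> A \<ge> 2 + 1/\<delta>\<close>. The
condition relating \<open>\<delta>\<close> and \<open>c\<close> makes the thresholds tend to 0 for all \<open>m \<ge> n^c\<close>, so that the
probability \<open>1 - exp (- t)\<close> of an edge being light is at least \<open>t / 2\<close>.\<close>

lemma all_large_sets_contain_copies:
  fixes H :: "'a graph" and c \<delta> :: real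
  assumes H: "finite_simple_graph H" and d: "1 < dstar H" and c: "0 < c" and \<delta>: "0 < \<delta>"
    and c\<delta>: "\<delta> < c * (\<delta> + 1 / dstar H)"
  obtains A where "0 < A"
    "\<forall>\<^sub>F n in sequentially.
       {x \<in> space (edge_weights n). large_set_without_light_copy H n c \<delta> A x}
         \<in> sets (edge_weights n) \<and>
       measure (edge_weights n)
       {x \<in> space (edge_weights n). large_set_without_light_copy H n c \<delta> A x}
       \<le> real n * exp (- (real n powr c))"
proof -
  define v where "v = card (verts H)"
  define \<beta> where "\<beta> = 1 / dstar H"
  define \<kappa> where "\<kappa> = 1 / (2 * (2 * (real v + 1)) ^ v)"
  have \<kappa>: "0 < \<kappa>" by (simp add: \<kappa>_def)
  \<comment> \<open>Half of the threshold constant \<open>2 * A\<close> is lost to \<open>1 - exp (- t) \<ge> t / 2\<close>.\<close>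
  define A where "A = max 1 ((2 + 1 / \<delta>) / \<kappa>)"
  have A: "1 \<le> A" by (simp add: A_def)
  have "(2 + 1 / \<delta>) / \<kappa> \<le> A" by (simp add: A_def)
  then have \<kappa>A: "2 + 1 / \<delta> \<le> \<kappa> * A" using \<kappa> by (simp add: pos_divide_le_eq mult.commute)
  have \<beta>: "0 < \<beta>" using d by (simp add: \<beta>_def)
  define t where "t = (\<lambda>n m :: nat. 2 * A * (real n / real m) powr \<delta> * real m powr (- \<beta>))"
  have ev1: "\<forall>\<^sub>F n in sequentially. 2 * A * real n powr (\<delta> - c * (\<delta> + \<beta>)) \<le> 1"
  proof -
    have "\<delta> - c * (\<delta> + \<beta>) < 0" using c\<delta> by (simp add: \<beta>_def)
    then have "(\<lambda>n. 2 * A * real n powr (\<delta> - c * (\<delta> + \<beta>))) \<longlonglongrightarrow> 0"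
      by real_asymp
    then have "\<forall>\<^sub>F n in sequentially. 2 * A * real n powr (\<delta> - c * (\<delta> + \<beta>)) < 1"
      by (rule order_tendstoD) simp
    then show ?thesis by (rule eventually_mono) simp
  qed
  have ev2: "\<forall>\<^sub>F n in sequentially. 2 * real v + 1 \<le> real n powr c"
  proof -
    have "filterlim (\<lambda>n. real n powr c) at_top sequentially" using c by real_asymp
    then show ?thesis by (simp add: filterlim_at_top)
  qed
  define bad where "bad = (\<lambda>(n::nat) (S::nat set) (x::nat set \<Rightarrow> real). \<forall>\<phi>\<in>embeddings H S. \<not> (\<forall>e\<in>edge_image \<phi> H. x e \<le> t n (card S)))"
  have main: "\<forall>\<^sub>F n in sequentially.
      {x \<in> space (edge_weights n). \<exists>S\<subseteq>{..<n}. real n powr c \<le> real (card S) \<and> bad n S x}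
         \<in> sets (edge_weights n) \<and>
      measure (edge_weights n)
       {x \<in> space (edge_weights n). \<exists>S\<subseteq>{..<n}. real n powr c \<le> real (card S) \<and> bad n S x}
       \<le> real n * exp (- (real n powr c))"
    using ev1 ev2 eventually_gt_at_top[of 0]
  proof eventually_elim
    fix n :: nat
    assume e1: "2 * A * real n powr (\<delta> - c * (\<delta> + \<beta>)) \<le> 1" and e2: "2 * real v + 1 \<le> real n powr c"
      and n: "0 < n"
    let ?I = "edges (complete_graph n)"
    interpret prob_space "exp_weights ?I" by (rule prob_space_exp_weights)
    define Bad where "Bad = (\<lambda>S. {x \<in> space (exp_weights ?I). bad n S x})"
    have good_size: "2 * v \<le> card S" "1 \<le> card S" "card S \<le> n" "0 \<le> t n (card S)" "t n (card S) \<le> 1"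
      if S: "S \<subseteq> {..<n}" "real n powr c \<le> real (card S)" for S
    proof -
      define m where "m = card S"
      have m: "2 * real v + 1 \<le> real m" using e2 S(2) by (simp add: m_def)
      then show "2 * v \<le> card S" "1 \<le> card S" by (simp_all add: m_def)
      have m0: "0 < real m" using m by simp
      show "card S \<le> n" using card_mono[OF _ S(1)] by simp
      show "0 \<le> t n (card S)" using A by (simp add: t_def)
      have "t n m = 2 * A * real n powr \<delta> * real m powr (- (\<delta> + \<beta>))"
      proof -
        have "(real n / real m) powr \<delta> = real n powr \<delta> * real m powr (- \<delta>)"
          by (simp add: powr_divide powr_minus_divide)
        moreover have "real m powr (- (\<delta> + \<beta>)) = real m powr (- \<delta>) * real m powr (- \<beta>)"
          by (simp add: powr_add[symmetric])
        ultimately show ?thesis by (simp add: t_def)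
      qed
      also have "\<dots> \<le> 2 * A * real n powr \<delta> * (real n powr c) powr (- (\<delta> + \<beta>))"
        using S(2) A \<delta> \<beta> n by (intro mult_left_mono powr_mono2') (auto simp: m_def)
      also have "\<dots> = 2 * A * real n powr (\<delta> - c * (\<delta> + \<beta>))"
      proof -
        have "real n powr (\<delta> - c * (\<delta> + \<beta>)) = real n powr \<delta> * real n powr (- (c * (\<delta> + \<beta>)))"
          by (simp add: powr_add[symmetric])
        then show ?thesis by (simp only: powr_powr mult_minus_right mult.assoc)
      qed
      finally show "t n (card S) \<le> 1" using e1 by (simp add: m_def)
    qed
    have single: "Bad S \<in> sets (exp_weights ?I) \<and>
        measure (exp_weights ?I) (Bad S) \<le> exp (- (\<kappa> * A * (real n / real (card S)) powr \<delta> * real (card S)))"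
      if S: "S \<subseteq> {..<n}" "real n powr c \<le> real (card S)" for S
    proof -
      define m where "m = card S"
      note gs = good_size[OF S]
      have finS: "finite S" using S(1) finite_subset by auto
      define C where "C = A * (real n / real m) powr \<delta>"
      have "1 powr \<delta> \<le> (real n / real m) powr \<delta>"
        using gs \<delta> by (intro powr_mono2) (auto simp: m_def)
      then have C: "1 \<le> C" using mult_mono[of 1 A 1 "(real n / real m) powr \<delta>"] A by (simp add: C_def)
      have nsets: "nsets S 2 \<subseteq> ?I" unfolding complete_graph_def using S(1) by (simp add: nsets_mono)
      have Bad_eq: "Bad S = {x \<in> space (exp_weights ?I). \<forall>\<phi>\<in>embeddings H S. \<not> edge_image \<phi> H \<subseteq> {e \<in> ?I. x e \<le> t n m}}"
      proof -
        have "edge_image \<phi> H \<subseteq> ?I" if "\<phi> \<in> embeddings H S" for \<phi>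
          using edge_image_nsets[OF H that] nsets by (rule order.trans)
        then show ?thesis unfolding Bad_def bad_def m_def by (intro Collect_cong conj_cong refl ball_cong) auto
      qed
      let ?p = "1 - exp (- t n m)"
      have p: "0 \<le> ?p" "?p \<le> 1" using gs by (auto simp: m_def)
      have "C = t n m / 2 * real m powr \<beta>"
        using gs by (simp add: C_def t_def powr_minus field_simps m_def)
      also have "\<dots> \<le> ?p * real m powr \<beta>"
        using gs by (intro mult_right_mono one_minus_exp_ge) (auto simp: m_def)
      finally have th: "C \<le> ?p * real (card S) powr (1 / dstar H)" by (simp add: m_def \<beta>_def)
      have "measure (exp_weights ?I) (Bad S) = bexp ?p ?I (\<lambda>R. of_bool (\<forall>\<phi>\<in>embeddings H S. \<not> edge_image \<phi> H \<subseteq> R))"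
        unfolding Bad_eq using gs by (intro measure_exp_weights_light_set) (auto simp: m_def)
      also have "\<dots> \<le> exp (- (C * card S / (2 * (2 * (real (card (verts H)) + 1)) ^ card (verts H))))"
        using d gs by (intro no_copy_probability[OF H _ finS _ _ _ nsets p C th]) (auto simp: v_def)
      also have "C * card S / (2 * (2 * (real (card (verts H)) + 1)) ^ card (verts H))
          = \<kappa> * A * (real n / real (card S)) powr \<delta> * real (card S)"
        by (simp add: C_def \<kappa>_def v_def m_def)
      finally show ?thesis
        unfolding Bad_eq using gs by (auto simp: m_def intro: light_set_measurable)
    qed
    define Ms where "Ms = {m\<in>{1..n}. real n powr c \<le> real m}"
    define \<S> where "\<S> = (\<lambda>m. {S. S \<subseteq> {..<n} \<and> card S = m})"
    have fin\<S>: "finite (\<S> m)" for m unfolding \<S>_def by (rule finite_subset[of _ "Pow {..<n}"]) auto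
    have per_size: "(\<Sum>S\<in>\<S> m. measure (exp_weights ?I) (Bad S)) \<le> exp (- (real n powr c))" if m: "m \<in> Ms" for m
    proof -
      define y where "y = (real n / real m) powr \<delta>"
      have mm: "1 \<le> m" "m \<le> n" "real n powr c \<le> real m" using m by (auto simp: Ms_def)
      have q1: "1 \<le> real n / real m" using mm by (simp add: field_simps)
      then have "1 powr \<delta> \<le> y" unfolding y_def using \<delta> by (intro powr_mono2) auto
      then have y: "1 \<le> y" by simp
      have ln: "ln (real n / real m) \<le> y / \<delta>"
      proof -
        have "\<delta> * ln (real n / real m) = ln y" unfolding y_def using q1 by (simp add: ln_powr)
        also have "\<dots> \<le> y - 1" using y by (intro ln_le_minus_one) auto
        finally show ?thesis using \<delta> by (simp add: field_simps)
      qed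
      have "(\<Sum>S\<in>\<S> m. measure (exp_weights ?I) (Bad S)) \<le> (\<Sum>S\<in>\<S> m. exp (- (\<kappa> * A * y * real m)))"
        using single mm by (intro sum_mono) (auto simp: \<S>_def y_def)
      also have "\<dots> = real (n choose m) * exp (- (\<kappa> * A * y * real m))"
        using n_subsets[of "{..<n}" m] by (simp add: \<S>_def)
      also have "\<dots> \<le> (exp 1 * real n / real m) ^ m * exp (- (\<kappa> * A * y * real m))"
        using mm by (intro mult_right_mono binomial_le_exp) auto
      also have "exp 1 * real n / real m = exp (1 + ln (real n / real m))"
        using mm n by (simp add: exp_add)
      also have "exp (1 + ln (real n / real m)) ^ m * exp (- (\<kappa> * A * y * real m))
          = exp (real m * (1 + ln (real n / real m) - \<kappa> * A * y))"
        by (simp add: exp_of_nat_mult[symmetric] exp_add[symmetric] algebra_simps)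
      also have "\<dots> \<le> exp (real m * (- 1))"
      proof -
        have "(2 + 1 / \<delta>) * y \<le> \<kappa> * A * y" using \<kappa>A y by (intro mult_right_mono) auto
        then have "1 + ln (real n / real m) - \<kappa> * A * y \<le> - 1" using ln y by (simp add: algebra_simps)
        then show ?thesis by (simp only: exp_le_cancel_iff) (intro mult_left_mono, auto)
      qed
      also have "\<dots> \<le> exp (- (real n powr c))" using mm by simp
      finally show ?thesis .
    qed
    have eq: "{x \<in> space (exp_weights ?I). \<exists>S\<subseteq>{..<n}. real n powr c \<le> real (card S) \<and> bad n S x}
        = (\<Union>m\<in>Ms. \<Union>S\<in>\<S> m. Bad S)" (is "?L = ?R")
    proof (intro equalityI subsetI)
      fix x assume "x \<in> ?L"
      then obtain S where S: "S \<subseteq> {..<n}" "real n powr c \<le> real (card S)" "x \<in> Bad S"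
        by (auto simp: Bad_def)
      then show "x \<in> ?R" using good_size[OF S(1,2)]
        by (intro UN_I[of "card S"] UN_I[of S]) (auto simp: Ms_def \<S>_def)
    qed (auto simp: Bad_def Ms_def \<S>_def)
    have Bad_sets: "Bad S \<in> sets (exp_weights ?I)" if "S \<in> \<S> m" "m \<in> Ms" for m S
      using single[of S] that by (auto simp: \<S>_def Ms_def)
    have finMs: "finite Ms" by (simp add: Ms_def)
    have sets2: "(\<Union>S\<in>\<S> m. Bad S) \<in> sets (exp_weights ?I)" if "m \<in> Ms" for m
      using fin\<S> Bad_sets that by (intro sets.finite_UN) auto
    have sets3: "(\<Union>m\<in>Ms. \<Union>S\<in>\<S> m. Bad S) \<in> sets (exp_weights ?I)"
      by (rule sets.finite_UN[OF finMs sets2])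
    have "measure (exp_weights ?I) (\<Union>m\<in>Ms. \<Union>S\<in>\<S> m. Bad S) \<le> (\<Sum>m\<in>Ms. measure (exp_weights ?I) (\<Union>S\<in>\<S> m. Bad S))"
      using finMs sets2 by (intro finite_measure_subadditive_finite) auto
    also have "\<dots> \<le> (\<Sum>m\<in>Ms. exp (- (real n powr c)))"
    proof (rule sum_mono)
      fix m assume m: "m \<in> Ms"
      have "measure (exp_weights ?I) (\<Union>S\<in>\<S> m. Bad S) \<le> (\<Sum>S\<in>\<S> m. measure (exp_weights ?I) (Bad S))"
        using fin\<S> Bad_sets m by (intro finite_measure_subadditive_finite) auto
      then show "measure (exp_weights ?I) (\<Union>S\<in>\<S> m. Bad S) \<le> exp (- (real n powr c))"
        using per_size[OF m] by linarith
    qed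
    also have "\<dots> \<le> real n * exp (- (real n powr c))"
    proof -
      have "card Ms \<le> card {1..n}" unfolding Ms_def by (intro card_mono) auto
      then show ?thesis by simp
    qed
    finally show "{x \<in> space (exp_weights ?I). \<exists>S\<subseteq>{..<n}. real n powr c \<le> real (card S) \<and> bad n S x} \<in> sets (exp_weights ?I) \<and>
      measure (exp_weights ?I) {x \<in> space (exp_weights ?I). \<exists>S\<subseteq>{..<n}. real n powr c \<le> real (card S) \<and> bad n S x}
       \<le> real n * exp (- (real n powr c))"
      unfolding eq using sets3 by simp
  qed
  show ?thesis
    by (rule that[of "2 * A"]) (use A main in \<open>auto simp: bad_def t_def \<beta>_def large_set_without_light_copy_def\<close>)
qed

section \<open>The upper tail\<close>

text \<open>The greedy construction costs at most \<open>t\<close> per edge while at least \<open>n^c\<close> vertices are uncovered,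
which sums to \<open>O (n^(1 - 1/d))\<close> because \<open>\<delta> + 1/d < 1\<close>. The last \<open>n^c\<close> vertices cost, up to a
constant, at most \<open>n^c\<close> times the largest edge weight \<open>n^c\<close>, where \<open>2 c = 1 - 1/d\<close>.\<close>

lemma min_weight_upper_tail:
  fixes H :: "'a graph"
  assumes H: "finite_simple_graph H" and v2: "2 \<le> card (verts H)" and d: "1 < dstar H" and \<alpha>: "0 \<le> \<alpha>"
  obtains b c where "0 < b" "0 < c"
    "\<forall>\<^sub>F n in sequentially. card (verts H) dvd n \<longrightarrow>
       measure (edge_weights n)
         {x \<in> space (edge_weights n). \<not> min_weight (factor_family \<alpha> H n) x \<le> b * real n powr (1 - 1 / dstar H)}
       \<le> 2 * real n ^ 2 * exp (- (real n powr c))"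
proof -
  define v where "v = card (verts H)"
  define \<beta> where "\<beta> = 1 / dstar H"
  have \<beta>: "0 < \<beta>" "\<beta> < 1" using d by (auto simp: \<beta>_def)
  define c where "c = (1 - \<beta>) / 2"
  \<comment> \<open>\<open>c\<close> is chosen with \<open>n^c * n^c = n^(1 - \<beta>)\<close>, and \<open>\<delta>\<close> with \<open>\<delta> < c (\<delta> + \<beta>)\<close> and \<open>\<delta> + \<beta> < 1\<close>.\<close>
  define \<delta> where "\<delta> = c * \<beta> / 2"
  define s where "s = \<delta> + \<beta>"
  have c: "0 < c" using \<beta> by (simp add: c_def)
  have \<delta>: "0 < \<delta>" using c \<beta> by (simp add: \<delta>_def)
  have c\<delta>: "\<delta> < c * (\<delta> + 1 / dstar H)"
  proof -
    have "0 < c * \<delta>" "c * \<beta> = 2 * \<delta>" using c \<delta> by (auto simp: \<delta>_def)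
    then have "\<delta> < c * \<delta> + c * \<beta>" using \<delta> by linarith
    then show ?thesis by (simp add: \<beta>_def distrib_left)
  qed
  have s: "0 \<le> s" "s < 1"
  proof -
    have "c * \<beta> \<le> c * 1" using c \<beta> by (intro mult_left_mono) auto
    then have "\<delta> \<le> (1 - \<beta>) / 4" by (simp add: \<delta>_def c_def)
    then show "s < 1" using \<beta> by (simp add: s_def)
  qed (use \<beta> \<delta> in \<open>simp add: s_def\<close>)
  obtain A where A: "0 < A" and ev: "\<forall>\<^sub>F n in sequentially.
       {x \<in> space (edge_weights n). large_set_without_light_copy H n c \<delta> A x}
         \<in> sets (edge_weights n) \<and>
       measure (edge_weights n)
       {x \<in> space (edge_weights n). large_set_without_light_copy H n c \<delta> A x}
       \<le> real n * exp (- (real n powr c))"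
    by (rule all_large_sets_contain_copies[OF H d c \<delta> c\<delta>])
  define b where "b = card (edges H) * (1 + A / (1 - s)) + 1"
  have b: "0 < b" using A s by (auto simp: b_def intro!: add_nonneg_pos)
  have "\<forall>\<^sub>F n in sequentially. v dvd n \<longrightarrow>
       measure (edge_weights n)
         {x \<in> space (edge_weights n). \<not> min_weight (factor_family \<alpha> H n) x \<le> b * real n powr (1 - \<beta>)}
       \<le> 2 * real n ^ 2 * exp (- (real n powr c))"
    using ev eventually_gt_at_top[of 0]
  proof eventually_elim
    fix n :: nat
    let ?I = "edges (complete_graph n)"
    let ?\<sigma> = "\<lambda>m. A * (real n / real m) powr \<delta> * real m powr (- \<beta>)"
    let ?F = "min_weight (factor_family \<alpha> H n)"
    define B2 where "B2 = {x \<in> space (exp_weights ?I). \<exists>S\<subseteq>{..<n}. real n powr c \<le> real (card S) \<and>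
          (\<forall>\<phi>\<in>embeddings H S. \<not> (\<forall>e\<in>edge_image \<phi> H. x e \<le> ?\<sigma> (card S)))}"
    assume "{x \<in> space (exp_weights ?I). large_set_without_light_copy H n c \<delta> A x}
         \<in> sets (exp_weights ?I) \<and>
       measure (exp_weights ?I)
       {x \<in> space (exp_weights ?I). large_set_without_light_copy H n c \<delta> A x}
       \<le> real n * exp (- (real n powr c))"
    then have B2: "B2 \<in> sets (exp_weights ?I)" "measure (exp_weights ?I) B2 \<le> real n * exp (- (real n powr c))"
      unfolding B2_def \<beta>_def large_set_without_light_copy_def by simp_all
    assume n: "0 < n"
    interpret prob_space "exp_weights ?I" by (rule prob_space_exp_weights)
    define B1 where "B1 = {x \<in> space (exp_weights ?I). \<exists>e\<in>?I. x e < 0 \<or> real n powr c < x e}"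
    have B1: "B1 \<in> sets (exp_weights ?I)" "measure (exp_weights ?I) B1 \<le> real n ^ 2 * exp (- (real n powr c))"
    proof -
      show "B1 \<in> sets (exp_weights ?I)" unfolding B1_def by (rule measure_exp_weights_out_of_range) auto
      have "measure (exp_weights ?I) B1 \<le> card ?I * exp (- (real n powr c))"
        unfolding B1_def by (rule measure_exp_weights_out_of_range) auto
      also have "\<dots> \<le> real n ^ 2 * exp (- (real n powr c))"
      proof (rule mult_right_mono)
        show "real (card ?I) \<le> real n ^ 2"
          using card_edges_complete_graph_le[of n] by (metis of_nat_le_iff of_nat_power)
      qed simp
      finally show "measure (exp_weights ?I) B1 \<le> real n ^ 2 * exp (- (real n powr c))" .
    qed
    show "v dvd n \<longrightarrow> measure (exp_weights ?I) {x \<in> space (exp_weights ?I). \<not> ?F x \<le> b * real n powr (1 - \<beta>)}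
       \<le> 2 * real n ^ 2 * exp (- (real n powr c))"
    proof
      assume "v dvd n"
      then obtain k where k: "n = card (verts H) * k" by (auto simp: v_def)
      \<comment> \<open>The greedy bound: light copies while enough vertices remain, arbitrary copies afterwards.\<close>
      define \<tau> where "\<tau> = (\<lambda>m. if real n powr c \<le> real m then ?\<sigma> m else real n powr c)"
      have \<tau>0: "0 \<le> \<tau> m" for m using A by (auto simp: \<tau>_def)
      have good: "?F x \<le> b * real n powr (1 - \<beta>)" if x: "x \<in> space (exp_weights ?I)" "x \<notin> B1" "x \<notin> B2" for x
      proof -
        have x_le: "x e \<le> real n powr c" if "e \<in> ?I" for e
          using x that by (auto simp: B1_def not_less)
        have step: "\<exists>\<phi>\<in>embeddings H S. \<forall>e\<in>edge_image \<phi> H. x e \<le> \<tau> (card S)"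
          if S: "S \<subseteq> {..<n}" "card (verts H) \<le> card S" for S
        proof (cases "real n powr c \<le> real (card S)")
          case True
          then show ?thesis using x S(1) by (auto simp: B2_def \<tau>_def)
        next
          case False
          have "embeddings H S \<noteq> {}"
            using S H finite_subset[OF S(1)] by (intro embeddings_nonempty) (auto simp: finite_simple_graph_def)
          then obtain \<phi> where \<phi>: "\<phi> \<in> embeddings H S" by auto
          have "edge_image \<phi> H \<subseteq> ?I"
            using edge_image_nsets[OF H \<phi>] nsets_mono[OF S(1), of 2] by (simp add: complete_graph_def)
          then show ?thesis using \<phi> x_le False by (intro bexI[of _ \<phi>]) (auto simp: \<tau>_def)
        qed
        have "1 \<le> card (verts H)" using v2 by simp
        from factor_family_greedy[OF H this \<alpha> k step]
        obtain B where B: "B \<in> factor_family \<alpha> H n"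
          "(\<Sum>e\<in>B. x e) \<le> card (edges H) * (\<Sum>j = 1..k. \<tau> (card (verts H) * j))" by auto
        have "?F x \<le> card (edges H) * (\<Sum>j = 1..k. \<tau> (card (verts H) * j))"
          using min_weight_le[OF finite_factor_family B(1), of x] B(2) by linarith
        also have "\<dots> \<le> card (edges H) * (real n powr (1 - \<beta>) + A / (1 - s) * real n powr (1 - \<beta>))"
        proof (rule mult_left_mono)
          have "(\<Sum>j = 1..k. \<tau> (card (verts H) * j)) = (\<Sum>m\<in>(\<lambda>j. card (verts H) * j) ` {1..k}. \<tau> m)"
            using v2 by (subst sum.reindex) (auto simp: inj_on_def)
          also have "\<dots> \<le> (\<Sum>m = 1..n. \<tau> m)"
            using v2 k \<tau>0 by (intro sum_mono2) auto
          also have "\<dots> \<le> (\<Sum>m = 1..n. (if real m < real n powr c then real n powr c else 0) + ?\<sigma> m)"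
            using A by (intro sum_mono) (auto simp: \<tau>_def)
          also have "\<dots> = (\<Sum>m = 1..n. if real m < real n powr c then real n powr c else 0) + (\<Sum>m = 1..n. ?\<sigma> m)"
            by (rule sum.distrib)
          also have "(\<Sum>m = 1..n. if real m < real n powr c then real n powr c else 0) \<le> real n powr c * real n powr c"
          proof -
            define Ms where "Ms = {m \<in> {1..n}. real m < real n powr c}"
            have "card Ms \<le> card {1..nat \<lfloor>real n powr c\<rfloor>}"
              unfolding Ms_def by (intro card_mono) (auto simp: le_nat_floor)
            then have "card Ms \<le> nat \<lfloor>real n powr c\<rfloor>" by simp
            then have "real (card Ms) \<le> real (nat \<lfloor>real n powr c\<rfloor>)" by (rule of_nat_mono)
            also have "\<dots> \<le> real n powr c" by (rule of_nat_floor) simp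
            finally have "real (card Ms) * real n powr c \<le> real n powr c * real n powr c"
              by (intro mult_right_mono) auto
            moreover have "(\<Sum>m = 1..n. if real m < real n powr c then real n powr c else 0) = real (card Ms) * real n powr c"
              unfolding Ms_def by (subst sum.inter_filter[symmetric]) simp_all
            ultimately show ?thesis by simp
          qed
          also have "real n powr c * real n powr c = real n powr (1 - \<beta>)"
            by (simp add: powr_add[symmetric] c_def)
          also have "(\<Sum>m = 1..n. ?\<sigma> m) \<le> A / (1 - s) * real n powr (1 - \<beta>)"
          proof -
            have \<sigma>: "?\<sigma> m = A * real n powr \<delta> * real m powr (- s)" for m
            proof -
              have "(real n / real m) powr \<delta> = real n powr \<delta> * real m powr (- \<delta>)"
                by (simp add: powr_divide powr_minus_divide)
              moreover have "real m powr (- s) = real m powr (- \<delta>) * real m powr (- \<beta>)"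
                by (simp add: powr_add[symmetric] s_def)
              ultimately show ?thesis by simp
            qed
            have "(\<Sum>m = 1..n. ?\<sigma> m) = A * real n powr \<delta> * (\<Sum>m = 1..n. real m powr (- s))"
              unfolding sum_distrib_left by (intro sum.cong refl \<sigma>)
            also have "\<dots> \<le> A * real n powr \<delta> * (real n powr (1 - s) / (1 - s))"
              using A s by (intro mult_left_mono sum_powr_le) auto
            also have "\<dots> = A / (1 - s) * (real n powr \<delta> * real n powr (1 - s))" by simp
            also have "real n powr \<delta> * real n powr (1 - s) = real n powr (1 - \<beta>)"
              by (simp add: powr_add[symmetric] s_def)
            finally show ?thesis .
          qed
          finally show "(\<Sum>j = 1..k. \<tau> (card (verts H) * j))
              \<le> real n powr (1 - \<beta>) + A / (1 - s) * real n powr (1 - \<beta>)" by simp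
        qed simp
        also have "\<dots> \<le> b * real n powr (1 - \<beta>)" by (simp add: b_def algebra_simps)
        finally show ?thesis .
      qed
      have "{x \<in> space (exp_weights ?I). \<not> ?F x \<le> b * real n powr (1 - \<beta>)} \<subseteq> B1 \<union> B2"
        using good by auto
      then have "measure (exp_weights ?I) {x \<in> space (exp_weights ?I). \<not> ?F x \<le> b * real n powr (1 - \<beta>)} \<le> measure (exp_weights ?I) (B1 \<union> B2)"
        using B1 B2 by (intro finite_measure_mono) auto
      also have "\<dots> \<le> measure (exp_weights ?I) B1 + measure (exp_weights ?I) B2"
        using B1 B2 by (intro measure_Un_le) auto
      also have "\<dots> \<le> real n ^ 2 * exp (- (real n powr c)) + real n * exp (- (real n powr c))"
        using B1 B2 by linarith
      also have "\<dots> \<le> 2 * real n ^ 2 * exp (- (real n powr c))"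
      proof -
        have "real n * 1 \<le> real n * real n" using n by (intro mult_left_mono) auto
        then have "real n * exp (- (real n powr c)) \<le> real n ^ 2 * exp (- (real n powr c))"
          by (intro mult_right_mono) (auto simp: power2_eq_square)
        then show ?thesis by simp
      qed
      finally show "measure (exp_weights ?I) {x \<in> space (exp_weights ?I). \<not> ?F x \<le> b * real n powr (1 - \<beta>)}
          \<le> 2 * real n ^ 2 * exp (- (real n powr c))" .
    qed
  qed
  then show ?thesis using that[OF b c] by (simp add: v_def \<beta>_def)
qed

section \<open>The lower tail\<close>

lemma card_partial_factor_ge:
  assumes H: "finite (verts H)" and pf: "partial_factor \<alpha> H n Q"
  shows "(1 - \<alpha>) * real n \<le> real (card Q) * real (card (verts H))"
proof -
  let ?V = "\<Union>G\<in>Q. verts G"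
  have "card (verts G) = card (verts H)" if "G \<in> Q" for G
    using pf that by (auto simp: partial_factor_def graph_iso_def intro: bij_betw_same_card)
  then have "card ?V \<le> (\<Sum>G\<in>Q. card (verts H))"
    using card_UN_le[OF partial_factor_finite[OF pf], of verts] by (simp cong: sum.cong)
  then have 1: "card ?V \<le> card Q * card (verts H)" by simp
  have "finite ?V"
  proof (rule finite_subset)
    show "?V \<subseteq> {..<n}" using pf by (force simp: partial_factor_def subgraph_of_def complete_graph_def)
  qed simp
  then have "n \<le> card ({..<n} - ?V) + card ?V"
    using diff_card_le_card_Diff[of ?V "{..<n}"] by simp
  moreover have "real (card ({..<n} - ?V)) \<le> \<alpha> * real n"
    using pf by (simp add: partial_factor_def complete_graph_def)
  ultimately have "real n \<le> \<alpha> * real n + real (card ?V)" by linarith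
  also have "\<dots> \<le> \<alpha> * real n + real (card Q * card (verts H))" using 1 by (intro add_left_mono of_nat_mono)
  finally show ?thesis by (simp add: algebra_simps)
qed

text \<open>Markov's inequality for the counting measure on \<open>Q\<close>.\<close>

lemma card_light_ge_half:
  fixes w :: "'b \<Rightarrow> real"
  assumes Q: "finite Q" and w: "\<And>G. G \<in> Q \<Longrightarrow> 0 \<le> w G" and L: "(\<Sum>G\<in>Q. w G) \<le> L" "0 < \<tau>" "2 * L \<le> \<tau> * real (card Q)"
  shows "real (card Q) \<le> 2 * real (card {G \<in> Q. w G \<le> \<tau>})"
proof -
  have "\<tau> * real (card {G \<in> Q. \<not> w G \<le> \<tau>}) = (\<Sum>G\<in>{G \<in> Q. \<not> w G \<le> \<tau>}. \<tau>)" by simp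
  also have "\<dots> \<le> (\<Sum>G\<in>{G \<in> Q. \<not> w G \<le> \<tau>}. w G)" by (intro sum_mono) auto
  also have "\<dots> \<le> (\<Sum>G\<in>Q. w G)" using Q w by (intro sum_mono2) auto
  finally have "\<tau> * (2 * real (card {G \<in> Q. \<not> w G \<le> \<tau>})) \<le> \<tau> * real (card Q)" using L by linarith
  then have "2 * real (card {G \<in> Q. \<not> w G \<le> \<tau>}) \<le> real (card Q)" using L(2) by simp
  moreover have "card Q = card {G \<in> Q. w G \<le> \<tau>} + card {G \<in> Q. \<not> w G \<le> \<tau>}"
    using Q by (subst card_Un_disjoint[symmetric]) (auto intro!: arg_cong[of _ _ card])
  ultimately show ?thesis by simp
qed

lemma subgraph_copy_in_copy:
  assumes G0: "subgraph_of G0 H" and iso: "graph_iso G H" and G: "subgraph_of G (complete_graph n)"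
  shows "\<exists>\<psi>\<in>embeddings G0 {..<n}. edge_image \<psi> G0 \<subseteq> edges G \<and> \<psi> ` verts G0 \<subseteq> verts G"
proof -
  obtain f where f: "bij_betw f (verts G) (verts H)" "edges H = (\<lambda>e. f ` e) ` edges G"
    using iso by (auto simp: graph_iso_def)
  have injf: "inj_on f (verts G)" and imf: "f ` verts G = verts H"
    using f(1) by (auto simp: bij_betw_def)
  have fG: "finite_simple_graph G" and GV: "verts G \<subseteq> {..<n}"
    using G by (auto simp: subgraph_of_def complete_graph_def)
  define g where "g = inv_into (verts G) f"
  have g: "inj_on g (verts H)" "g ` verts H = verts G"
    using bij_betw_inv_into[OF f(1)] by (auto simp: bij_betw_def g_def)
  have V0: "verts G0 \<subseteq> verts H" and E0: "edges G0 \<subseteq> edges H" and fG0: "finite_simple_graph G0"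
    using G0 by (auto simp: subgraph_of_def)
  define \<psi> where "\<psi> = restrict g (verts G0)"
  have im: "\<psi> ` verts G0 \<subseteq> verts G" using V0 g(2) by (auto simp: \<psi>_def)
  have "inj_on \<psi> (verts G0)" using inj_on_subset[OF g(1) V0] by (simp add: \<psi>_def inj_on_restrict_eq)
  moreover have "\<psi> \<in> verts G0 \<rightarrow>\<^sub>E {..<n}"
  proof (rule PiE_I)
    show "\<psi> u \<in> {..<n}" if "u \<in> verts G0" for u using im GV that by (meson image_subset_iff subsetD)
  qed (simp add: \<psi>_def)
  ultimately have emb: "\<psi> \<in> embeddings G0 {..<n}"
    by (simp add: embeddings_def)
  have "edge_image \<psi> G0 \<subseteq> edges G"
  proof
    fix h assume "h \<in> edge_image \<psi> G0"
    then obtain e where e: "e \<in> edges G0" "h = \<psi> ` e" by (auto simp: edge_image_def)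
    then obtain e' where e': "e' \<in> edges G" "e = f ` e'" using E0 f(2) by auto
    have "e \<subseteq> verts G0" by (rule edge_subset_verts[OF fG0 e(1)])
    then have "h = g ` e" unfolding e(2) \<psi>_def by (intro image_cong) auto
    also have "\<dots> = e'"
      unfolding e'(2) g_def by (rule inv_into_image_cancel[OF injf edge_subset_verts[OF fG e'(1)]])
    finally show "h \<in> edges G" using e'(1) by simp
  qed
  then show ?thesis using emb im by blast
qed

definition many_light_copies :: "'a graph \<Rightarrow> nat \<Rightarrow> nat \<Rightarrow> real \<Rightarrow> (nat set \<Rightarrow> real) \<Rightarrow> bool" where
  "many_light_copies G n k \<tau> x \<longleftrightarrow>
     (\<exists>\<Psi>\<subseteq>embeddings G {..<n}. card \<Psi> = k \<and>
       pairwise (\<lambda>\<phi> \<psi>. disjnt (edge_image \<phi> G) (edge_image \<psi> G)) \<Psi> \<and>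
       (\<forall>\<psi>\<in>\<Psi>. \<forall>e\<in>edge_image \<psi> G. x e \<le> \<tau>))"

text \<open>By averaging, at least half of the members of the factor have weight at most \<open>\<tau>\<close>, and for
nonnegative weights each of their edges does too. Every member contains a copy of \<open>G0\<close>, and copies in different
members are edge-disjoint.\<close>

lemma many_light_disjoint_copies:
  fixes H :: "'a graph" and x :: "nat set \<Rightarrow> real"
  assumes H: "finite (verts H)" and v: "1 \<le> card (verts H)" and G0: "subgraph_of G0 H" and V0: "verts G0 \<noteq> {}"
    and pf: "partial_factor \<alpha> H n Q"
    and x: "\<And>e. e \<in> edges (complete_graph n) \<Longrightarrow> 0 \<le> x e"
    and \<tau>: "0 < \<tau>" "2 * factor_weight x Q * card (verts H) \<le> \<tau> * ((1 - \<alpha>) * real n)"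
    and k: "2 * real k * card (verts H) \<le> (1 - \<alpha>) * real n"
  shows "many_light_copies G0 n k \<tau> x"
proof -
  define v where "v = card (verts H)"
  have v1: "1 \<le> real v" using v by (simp add: v_def)
  have finQ: "finite Q" by (rule partial_factor_finite[OF pf])
  have sub: "subgraph_of G (complete_graph n)" and iso: "graph_iso G H" if "G \<in> Q" for G
    using pf that by (auto simp: partial_factor_def)
  have fsg: "finite_simple_graph G" and edges_sub: "edges G \<subseteq> edges (complete_graph n)" if "G \<in> Q" for G
    using sub[OF that] by (auto simp: subgraph_of_def)
  define w where "w = (\<lambda>G. \<Sum>e\<in>edges G. x e)"
  have w0: "0 \<le> w G" if "G \<in> Q" for G
    unfolding w_def using edges_sub[OF that] x by (intro sum_nonneg) auto
  have cQ: "(1 - \<alpha>) * real n \<le> real (card Q) * real v"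
    using card_partial_factor_ge[OF H pf] by (simp add: v_def)
  define Q' where "Q' = {G \<in> Q. w G \<le> \<tau>}"
  have "real (card Q) \<le> 2 * real (card Q')"
    unfolding Q'_def
  proof (rule card_light_ge_half[OF finQ w0 _ \<tau>(1)])
    have "2 * factor_weight x Q * v \<le> \<tau> * real (card Q) * v"
      using order.trans[OF \<tau>(2) mult_left_mono[OF cQ[unfolded v_def], of \<tau>]] \<tau>(1) by (simp add: v_def mult.assoc)
    then show "2 * factor_weight x Q \<le> \<tau> * real (card Q)" using v1 by (simp add: mult_le_cancel_right)
  qed (auto simp: w_def factor_weight_def)
  then have "real (card Q) * real v \<le> 2 * real (card Q') * real v" by (intro mult_right_mono) auto
  then have "real k * real v \<le> real (card Q') * real v" using cQ k by (simp add: v_def)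
  then have kQ': "k \<le> card Q'" using v1 by (simp add: mult_le_cancel_right)
  then obtain Q'' where Q'': "Q'' \<subseteq> Q'" "card Q'' = k" "finite Q''"
    by (rule obtain_subset_with_card_n)
  have "\<forall>G\<in>Q. \<exists>\<psi>\<in>embeddings G0 {..<n}. edge_image \<psi> G0 \<subseteq> edges G \<and> \<psi> ` verts G0 \<subseteq> verts G"
    using subgraph_copy_in_copy[OF G0 iso sub] by blast
  then obtain \<Phi> where \<Phi>: "\<And>G. G \<in> Q \<Longrightarrow> \<Phi> G \<in> embeddings G0 {..<n}"
    "\<And>G. G \<in> Q \<Longrightarrow> edge_image (\<Phi> G) G0 \<subseteq> edges G" "\<And>G. G \<in> Q \<Longrightarrow> \<Phi> G ` verts G0 \<subseteq> verts G"
    by metis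
  have QQ: "G \<in> Q" if "G \<in> Q''" for G using that Q'' by (auto simp: Q'_def)
  have vdisj: "disjnt (verts G) (verts G')" if "G \<in> Q" "G' \<in> Q" "G \<noteq> G'" for G G'
    using pf that by (simp add: partial_factor_def pairwise_def)
  have inj: "inj_on \<Phi> Q''"
  proof (rule inj_onI, rule ccontr)
    fix G G' assume *: "G \<in> Q''" "G' \<in> Q''" "\<Phi> G = \<Phi> G'" "G \<noteq> G'"
    obtain u where "u \<in> verts G0" using V0 by auto
    then have "\<Phi> G u \<in> verts G" "\<Phi> G u \<in> verts G'"
      using \<Phi>(3)[OF QQ[OF *(1)]] \<Phi>(3)[OF QQ[OF *(2)]] *(3) by auto
    then show False using vdisj[OF QQ[OF *(1)] QQ[OF *(2)] *(4)] by (auto simp: disjnt_def)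
  qed
  show ?thesis
    unfolding many_light_copies_def
  proof (intro exI[of _ "\<Phi> ` Q''"] conjI ballI)
    show "\<Phi> ` Q'' \<subseteq> embeddings G0 {..<n}" using \<Phi>(1) QQ by auto
    show "card (\<Phi> ` Q'') = k" using card_image[OF inj] Q'' by simp
    show "pairwise (\<lambda>\<phi> \<psi>. disjnt (edge_image \<phi> G0) (edge_image \<psi> G0)) (\<Phi> ` Q'')"
    proof (rule pairwiseI)
      fix \<phi> \<psi> assume "\<phi> \<in> \<Phi> ` Q''" "\<psi> \<in> \<Phi> ` Q''" "\<phi> \<noteq> \<psi>"
      then obtain G G' where G: "G \<in> Q''" "G' \<in> Q''" "\<phi> = \<Phi> G" "\<psi> = \<Phi> G'" "G \<noteq> G'" by auto
      have "edges G \<inter> edges G' = {}"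
        using G QQ by (intro disjnt_edges fsg vdisj) auto
      then show "disjnt (edge_image \<phi> G0) (edge_image \<psi> G0)"
        using \<Phi>(2)[OF QQ[OF G(1)]] \<Phi>(2)[OF QQ[OF G(2)]] G(3,4) by (auto simp: disjnt_def)
    qed
    fix \<psi> e assume "\<psi> \<in> \<Phi> ` Q''" and e: "e \<in> edge_image \<psi> G0"
    then obtain G where G: "G \<in> Q''" "\<psi> = \<Phi> G" by auto
    have eG: "e \<in> edges G" using e G \<Phi>(2)[OF QQ[OF G(1)]] by auto
    have "x e \<le> w G"
      unfolding w_def using eG edges_sub[OF QQ[OF G(1)]] x finite_edges[OF fsg[OF QQ[OF G(1)]]]
      by (intro member_le_sum) auto
    also have "\<dots> \<le> \<tau>" using G Q'' by (auto simp: Q'_def)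
    finally show "x e \<le> \<tau>" .
  qed
qed

text \<open>Union bound over the families of \<open>k\<close> edge-disjoint embeddings. There are at most
\<open>n^v choose k \<le> (e n^v / k)^k\<close> of them, and by independence all edges of a given family are light
with probability at most \<open>\<tau>^(e k)\<close>.\<close>

lemma disjoint_light_copies_probability:
  fixes G0 :: "'a graph"
  assumes G0: "finite_simple_graph G0" and \<tau>: "0 \<le> \<tau>" and k: "1 \<le> k"
  shows "{x \<in> space (edge_weights n). many_light_copies G0 n k \<tau> x} \<in> sets (edge_weights n)" (is "?E \<in> _")
    and "measure (edge_weights n) {x \<in> space (edge_weights n).
      many_light_copies G0 n k \<tau> x}
    \<le> (exp 1 * (real n ^ card (verts G0) * \<tau> ^ card (edges G0)) / real k) ^ k"
proof -
  let ?I = "edges (complete_graph n)"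
  interpret prob_space "exp_weights ?I" by (rule prob_space_exp_weights)
  define E where "E = embeddings G0 {..<n}"
  have finE: "finite E" unfolding E_def by (rule finite_embeddings[OF G0]) simp
  have finV: "finite (verts G0)" using G0 by (simp add: finite_simple_graph_def)
  have cardE: "card E \<le> n ^ card (verts G0)"
  proof -
    have "card E \<le> card (verts G0 \<rightarrow>\<^sub>E {..<n})"
      unfolding E_def embeddings_def using finV by (intro card_mono finite_PiE) auto
    then show ?thesis using finV by (simp add: card_funcsetE)
  qed
  define \<P> where "\<P> = {\<Psi>. \<Psi> \<subseteq> E \<and> card \<Psi> = k \<and>
      pairwise (\<lambda>\<phi> \<psi>. disjnt (edge_image \<phi> G0) (edge_image \<psi> G0)) \<Psi>}"
  have fin\<P>: "finite \<P>" using finE by (auto simp: \<P>_def intro: finite_subset[of _ "Pow E"])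
  define B where "B = (\<lambda>\<Psi> :: ('a \<Rightarrow> nat) set. \<Union>\<psi>\<in>\<Psi>. edge_image \<psi> G0)"
  have E_eq: "?E = (\<Union>\<Psi>\<in>\<P>. {x \<in> space (exp_weights ?I). \<forall>e\<in>B \<Psi>. x e \<le> \<tau>})"
    unfolding \<P>_def B_def E_def many_light_copies_def by auto
  have BI: "B \<Psi> \<subseteq> ?I" if "\<Psi> \<in> \<P>" for \<Psi>
    using that edge_image_nsets[OF G0] by (fastforce simp: B_def \<P>_def E_def complete_graph_def)
  have sets: "{x \<in> space (exp_weights ?I). \<forall>e\<in>B \<Psi>. x e \<le> \<tau>} \<in> sets (exp_weights ?I)" if "\<Psi> \<in> \<P>" for \<Psi>
  proof -
    have "{x \<in> space (exp_weights ?I). \<forall>e\<in>B \<Psi>. x e \<le> \<tau>} = {x \<in> space (exp_weights ?I). B \<Psi> \<subseteq> {e \<in> ?I. x e \<le> \<tau>}}"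
      using BI[OF that] by auto
    then show ?thesis using \<tau> by (simp add: light_set_measurable)
  qed
  show "?E \<in> sets (exp_weights ?I)" unfolding E_eq using fin\<P> sets by auto
  have single: "measure (exp_weights ?I) {x \<in> space (exp_weights ?I). \<forall>e\<in>B \<Psi>. x e \<le> \<tau>} \<le> (\<tau> ^ card (edges G0)) ^ k"
    if \<Psi>: "\<Psi> \<in> \<P>" for \<Psi>
  proof -
    have fin\<Psi>: "finite \<Psi>" using \<Psi> finE finite_subset by (auto simp: \<P>_def)
    have "card (B \<Psi>) = (\<Sum>\<psi>\<in>\<Psi>. card (edge_image \<psi> G0))"
      unfolding B_def
    proof (rule card_UN_disjoint[OF fin\<Psi>])
      show "\<forall>\<phi>\<in>\<Psi>. finite (edge_image \<phi> G0)"
        using finite_edges[OF G0] by (simp add: edge_image_def)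
      show "\<forall>\<phi>\<in>\<Psi>. \<forall>\<psi>\<in>\<Psi>. \<phi> \<noteq> \<psi> \<longrightarrow> edge_image \<phi> G0 \<inter> edge_image \<psi> G0 = {}"
        using \<Psi> by (simp add: \<P>_def pairwise_def disjnt_def)
    qed
    also have "\<dots> = (\<Sum>\<psi>\<in>\<Psi>. card (edges G0))"
      using \<Psi> by (intro sum.cong card_edge_image[OF G0] refl) (auto simp: \<P>_def E_def embeddings_def)
    also have "\<dots> = card (edges G0) * k" using \<Psi> by (simp add: \<P>_def)
    finally have cB: "card (B \<Psi>) = card (edges G0) * k" .
    have "measure (exp_weights ?I) {x \<in> space (exp_weights ?I). \<forall>e\<in>B \<Psi>. x e \<le> \<tau>} = (1 - exp (- \<tau>)) ^ card (B \<Psi>)"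
      by (rule measure_exp_weights_le_threshold[OF _ BI[OF \<Psi>] \<tau>]) simp
    also have "\<dots> \<le> \<tau> ^ card (B \<Psi>)"
      using \<tau> exp_ge_add_one_self[of "- \<tau>"] by (intro power_mono) auto
    finally show ?thesis by (simp add: cB power_mult)
  qed
  have "measure (exp_weights ?I) ?E \<le> (\<Sum>\<Psi>\<in>\<P>. measure (exp_weights ?I) {x \<in> space (exp_weights ?I). \<forall>e\<in>B \<Psi>. x e \<le> \<tau>})"
    unfolding E_eq using fin\<P> sets by (intro finite_measure_subadditive_finite) auto
  also have "\<dots> \<le> (\<Sum>\<Psi>\<in>\<P>. (\<tau> ^ card (edges G0)) ^ k)" by (intro sum_mono single)
  also have "\<dots> = real (card \<P>) * (\<tau> ^ card (edges G0)) ^ k" by simp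
  also have "\<dots> \<le> (exp 1 * real n ^ card (verts G0) / real k) ^ k * (\<tau> ^ card (edges G0)) ^ k"
  proof (rule mult_right_mono)
    have "card \<P> \<le> card {\<Psi>. \<Psi> \<subseteq> E \<and> card \<Psi> = k}"
      using finE by (intro card_mono) (auto simp: \<P>_def)
    also have "\<dots> = card E choose k" by (rule n_subsets[OF finE])
    finally have "real (card \<P>) \<le> real (card E choose k)" by simp
    also have "\<dots> \<le> (exp 1 * real (card E) / real k) ^ k" by (rule binomial_le_exp[OF k])
    also have "\<dots> \<le> (exp 1 * real n ^ card (verts G0) / real k) ^ k"
      using cardE by (intro power_mono divide_right_mono mult_left_mono)
        (auto simp: of_nat_power[symmetric] simp del: of_nat_power)
    finally show "real (card \<P>) \<le> (exp 1 * real n ^ card (verts G0) / real k) ^ k" .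
  qed (use \<tau> in simp)
  also have "\<dots> = (exp 1 * (real n ^ card (verts G0) * \<tau> ^ card (edges G0)) / real k) ^ k"
    by (simp add: power_mult_distrib[symmetric] mult_ac)
  finally show "measure (exp_weights ?I) ?E \<le> (exp 1 * (real n ^ card (verts G0) * \<tau> ^ card (edges G0)) / real k) ^ k" .
qed

text \<open>Apply \<open>disjoint_light_copies_probability\<close> to a densest subgraph \<open>G0\<close> and \<open>\<tau> = A n^(-1/d)\<close>. Since
\<open>e(G0) / d = v(G0) - 1\<close>, the expected number \<open>n^v \<tau>^e\<close> of light copies is at most \<open>A n\<close>, which is a
small multiple of \<open>k\<close> for small \<open>A\<close>. The second error term is the probability that a weight lies
outside \<open>[0, n]\<close>; it accounts for negative weights, which occur with probability 0.\<close>

lemma min_weight_lower_tail: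
  fixes H :: "'a graph"
  assumes H: "finite_simple_graph H" and v2: "2 \<le> card (verts H)" and d: "1 < dstar H"
    and \<alpha>: "0 \<le> \<alpha>" "\<alpha> < 1"
  obtains a \<kappa> where "0 < a" "0 < \<kappa>"
    "\<forall>\<^sub>F n in sequentially. card (verts H) dvd n \<longrightarrow>
       measure (edge_weights n)
         {x \<in> space (edge_weights n). \<not> a * real n powr (1 - 1 / dstar H) \<le> min_weight (factor_family \<alpha> H n) x}
       \<le> exp (- (\<kappa> * real n)) + real n ^ 2 * exp (- real n)"
proof -
  define v where "v = card (verts H)"
  define \<beta> where "\<beta> = 1 / dstar H"
  obtain G0 where G0: "subgraph_of G0 H" "2 \<le> card (verts G0)"
    "real (card (edges G0)) = dstar H * (real (card (verts G0)) - 1)"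
    using dstar_attained[OF H v2] by blast
  define v0 where "v0 = card (verts G0)"
  define e0 where "e0 = card (edges G0)"
  have fG0: "finite_simple_graph G0" using G0 by (simp add: subgraph_of_def)
  have v1: "2 \<le> real v" using v2 by (simp add: v_def)
  have e0: "1 \<le> e0"
  proof -
    have "1 * 1 \<le> dstar H * (real v0 - 1)" using d G0(2) by (intro mult_mono) (auto simp: v0_def)
    then show ?thesis using G0(3) by (simp add: e0_def v0_def)
  qed
  have \<beta>e0: "\<beta> * real e0 = real v0 - 1" using d G0(3) by (simp add: \<beta>_def e0_def v0_def)
  \<comment> \<open>\<open>A\<close> is chosen such that \<open>e A n = k / e\<close> for \<open>k = \<kappa> n\<close>, and \<open>a\<close> such that a factor of weight at most
    \<open>a n^(1 - \<beta>)\<close> has at least \<open>k\<close> members of weight at most \<open>\<tau>\<close>.\<close>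
  define A where "A = (1 - \<alpha>) / (4 * real v * exp 2)"
  have A: "0 < A" "A \<le> 1"
  proof -
    show "0 < A" using \<alpha> v1 by (simp add: A_def)
    have "1 * 1 \<le> (4 * real v) * exp (2::real)" using v1 by (intro mult_mono) auto
    then show "A \<le> 1" unfolding A_def using \<alpha> v1 by (subst pos_divide_le_eq) auto
  qed
  define a where "a = A * (1 - \<alpha>) / (2 * real v)"
  define \<kappa> where "\<kappa> = (1 - \<alpha>) / (4 * real v)"
  have a: "0 < a" using A \<alpha> v1 by (simp add: a_def)
  have \<kappa>: "0 < \<kappa>" using \<alpha> v1 by (simp add: \<kappa>_def)
  have "\<forall>\<^sub>F n in sequentially. 1 \<le> \<kappa> * real n" using \<kappa> by real_asymp
  then have "\<forall>\<^sub>F n in sequentially. card (verts H) dvd n \<longrightarrow>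
       measure (edge_weights n)
         {x \<in> space (edge_weights n). \<not> a * real n powr (1 - \<beta>) \<le> min_weight (factor_family \<alpha> H n) x}
       \<le> exp (- (\<kappa> * real n)) + real n ^ 2 * exp (- real n)"
    using eventually_gt_at_top[of 0]
  proof eventually_elim
    fix n :: nat assume \<kappa>n: "1 \<le> \<kappa> * real n" and n: "0 < n"
    let ?I = "edges (complete_graph n)"
    let ?F = "min_weight (factor_family \<alpha> H n)"
    interpret prob_space "exp_weights ?I" by (rule prob_space_exp_weights)
    define \<tau> where "\<tau> = A * real n powr (- \<beta>)"
    have \<tau>: "0 < \<tau>" using A n by (simp add: \<tau>_def)
    define k where "k = nat \<lceil>\<kappa> * real n\<rceil>"
    have k1: "\<kappa> * real n \<le> real k" unfolding k_def by (rule real_nat_ceiling_ge)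
    have k2: "real k \<le> 2 * (\<kappa> * real n)" using \<kappa>n by (simp add: k_def) linarith
    have k0: "1 \<le> k" using k1 \<kappa>n by (cases k) auto
    define E1 where "E1 = {x \<in> space (exp_weights ?I). many_light_copies G0 n k \<tau> x}"
    define E2 where "E2 = {x \<in> space (exp_weights ?I). \<exists>e\<in>?I. x e < 0 \<or> real n < x e}"
    have E1_sets: "E1 \<in> sets (exp_weights ?I)"
      unfolding E1_def by (rule disjoint_light_copies_probability[OF fG0 _ k0]) (use \<tau> in simp)
    have E1: "measure (exp_weights ?I) E1 \<le> exp (- (\<kappa> * real n))"
    proof -
      have "measure (exp_weights ?I) E1 \<le> (exp 1 * (real n ^ v0 * \<tau> ^ e0) / real k) ^ k"
        unfolding E1_def v0_def e0_def by (rule disjoint_light_copies_probability[OF fG0 _ k0]) (use \<tau> in simp)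
      also have "\<dots> \<le> exp (- 1) ^ k"
      proof (rule power_mono)
        have "\<tau> ^ e0 = A ^ e0 * real n powr (- (real v0 - 1))"
          using n \<beta>e0 by (simp add: \<tau>_def power_mult_distrib powr_realpow[symmetric] powr_powr)
        also have "\<dots> \<le> A * real n powr (- (real v0 - 1))"
          using A power_decreasing[of 1 e0 A] e0 by (intro mult_right_mono) auto
        finally have "real n ^ v0 * \<tau> ^ e0 \<le> real n ^ v0 * (A * real n powr (- (real v0 - 1)))"
          by (intro mult_left_mono) auto
        also have "\<dots> = A * (real n powr (real v0) * real n powr (- (real v0 - 1)))"
          using n by (simp add: powr_realpow)
        also have "real n powr (real v0) * real n powr (- (real v0 - 1)) = real n"
          using n by (simp add: powr_add[symmetric])
        finally have "exp 1 * (real n ^ v0 * \<tau> ^ e0) \<le> exp 1 * (A * real n)" by (intro mult_left_mono) auto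
        also have "\<dots> = exp (- 1) * (\<kappa> * real n)"
        proof -
          have "exp 1 / exp 2 = exp (- 1 :: real)" by (simp add: exp_diff[symmetric])
          moreover have "exp 1 * (A * real n) = exp 1 / exp 2 * (\<kappa> * real n)"
            by (simp add: A_def \<kappa>_def)
          ultimately show ?thesis by simp
        qed
        also have "\<dots> \<le> exp (- 1) * real k" using k1 by (intro mult_left_mono) auto
        finally show "exp 1 * (real n ^ v0 * \<tau> ^ e0) / real k \<le> exp (- 1)"
          using k0 by (simp add: pos_divide_le_eq)
        show "0 \<le> exp 1 * (real n ^ v0 * \<tau> ^ e0) / real k" using \<tau> by simp
      qed
      also have "\<dots> = exp (- real k)" by (simp add: exp_of_nat_mult[symmetric])
      also have "\<dots> \<le> exp (- (\<kappa> * real n))" using k1 by simp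
      finally show ?thesis .
    qed
    have E2_sets: "E2 \<in> sets (exp_weights ?I)" unfolding E2_def by (rule measure_exp_weights_out_of_range) auto
    have E2: "measure (exp_weights ?I) E2 \<le> real n ^ 2 * exp (- real n)"
    proof -
      have "measure (exp_weights ?I) E2 \<le> card ?I * exp (- real n)"
        unfolding E2_def by (rule measure_exp_weights_out_of_range) auto
      also have "\<dots> \<le> real n ^ 2 * exp (- real n)"
      proof (rule mult_right_mono)
        show "real (card ?I) \<le> real n ^ 2"
          using card_edges_complete_graph_le[of n] by (metis of_nat_le_iff of_nat_power)
      qed simp
      finally show ?thesis .
    qed
    show "card (verts H) dvd n \<longrightarrow> measure (exp_weights ?I) {x \<in> space (exp_weights ?I). \<not> a * real n powr (1 - \<beta>) \<le> ?F x}
       \<le> exp (- (\<kappa> * real n)) + real n ^ 2 * exp (- real n)"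
    proof
      assume dvd: "card (verts H) dvd n"
      have "{x \<in> space (exp_weights ?I). \<not> a * real n powr (1 - \<beta>) \<le> ?F x} \<subseteq> E1 \<union> E2"
      proof
        fix x assume x: "x \<in> {x \<in> space (exp_weights ?I). \<not> a * real n powr (1 - \<beta>) \<le> ?F x}"
        show "x \<in> E1 \<union> E2"
        proof (cases "x \<in> E2")
          case False
          then have x0: "0 \<le> x e" if "e \<in> ?I" for e
            using x that by (auto simp: E2_def not_less)
          have v1': "1 \<le> card (verts H)" using v2 by simp
          obtain B where B: "B \<in> factor_family \<alpha> H n" "?F x = (\<Sum>e\<in>B. x e)"
            using min_weight_attained[OF finite_factor_family factor_family_nonempty[OF H v1' \<alpha>(1) dvd], of x] by auto
          then obtain Q where Q: "partial_factor \<alpha> H n Q" "B = (\<Union>G\<in>Q. edges G)"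
            by (auto simp: factor_family_def)
          have fw: "factor_weight x Q = ?F x" using factor_weight_eq_sum[OF Q(1), of x] B Q by simp
          have "many_light_copies G0 n k \<tau> x"
          proof (rule many_light_disjoint_copies[OF _ _ G0(1) _ Q(1) x0 \<tau>])
            show "finite (verts H)" using H by (simp add: finite_simple_graph_def)
            show "1 \<le> card (verts H)" using v2 by simp
            show "verts G0 \<noteq> {}" using G0(2) by auto
            have "2 * factor_weight x Q * real (card (verts H)) \<le> 2 * (a * real n powr (1 - \<beta>)) * real v"
              unfolding fw using x by (simp add: v_def mult_right_mono)
            also have "\<dots> = A * (1 - \<alpha>) * real n powr (1 - \<beta>)" using v1 by (simp add: a_def)
            also have "real n powr (1 - \<beta>) = real n powr (- \<beta>) * real n"
              using n powr_add[of "real n" "- \<beta>" 1] by simp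
            finally show "2 * factor_weight x Q * real (card (verts H)) \<le> \<tau> * ((1 - \<alpha>) * real n)"
              by (simp add: \<tau>_def mult_ac)
            have "2 * real k * real v \<le> 2 * (2 * (\<kappa> * real n)) * real v"
              using k2 by (intro mult_right_mono) auto
            also have "\<dots> = (1 - \<alpha>) * real n" using v1 by (simp add: \<kappa>_def)
            finally show "2 * real k * real (card (verts H)) \<le> (1 - \<alpha>) * real n" by (simp add: v_def)
          qed
          then show ?thesis using x by (simp add: E1_def)
        qed simp
      qed
      then have "measure (exp_weights ?I) {x \<in> space (exp_weights ?I). \<not> a * real n powr (1 - \<beta>) \<le> ?F x} \<le> measure (exp_weights ?I) (E1 \<union> E2)"
        using E1_sets E2_sets by (intro finite_measure_mono) auto
      also have "\<dots> \<le> measure (exp_weights ?I) E1 + measure (exp_weights ?I) E2"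
        using E1_sets E2_sets by (intro measure_Un_le) auto
      finally show "measure (exp_weights ?I) {x \<in> space (exp_weights ?I). \<not> a * real n powr (1 - \<beta>) \<le> ?F x}
          \<le> exp (- (\<kappa> * real n)) + real n ^ 2 * exp (- real n)" using E1 E2 by linarith
    qed
  qed
  then show ?thesis using that[OF a \<kappa>] by (simp add: \<beta>_def)
qed

section \<open>Order of magnitude and concentration of the minimum factor weight\<close>

text \<open>Independence and the marginal laws together say that the joint law of the edge weights is the product
measure.\<close>

lemma iid_exp1_weights_transfer:
  fixes X :: "nat set \<Rightarrow> 'w \<Rightarrow> real"
  assumes iid: "iid_exp1_weights n P X" and n: "2 \<le> n"
    and meas: "{x \<in> space (edge_weights n). \<Phi> x} \<in> sets (edge_weights n)"
    and local: "\<And>x. \<Phi> (restrict x (edges (complete_graph n))) \<longleftrightarrow> \<Phi> x"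
  shows "measure P {\<omega> \<in> space P. \<Phi> (\<lambda>e. X e \<omega>)}
    = measure (edge_weights n) {x \<in> space (edge_weights n). \<Phi> x}"
proof -
  let ?I = "edges (complete_graph n)"
  interpret prob_space P using iid by (simp add: iid_exp1_weights_def)
  have dist: "distributed P lborel (X e) (exponential_density 1)" if "e \<in> ?I" for e
    using iid that by (simp add: iid_exp1_weights_def)
  have rv: "X e \<in> borel_measurable P" if "e \<in> ?I" for e
    using distributed_measurable[OF dist[OF that]] by simp
  have D: "distr P borel (X e) = exp1" if "e \<in> ?I" for e
  proof -
    have "distr P borel (X e) = distr P lborel (X e)" by (rule distr_cong) simp_all
    also have "\<dots> = exp1" using distributed_distr_eq_density[OF dist[OF that]] by (simp add: exp1_def)
    finally show ?thesis .
  qed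
  have "{0, 1} \<in> ?I" using n by (simp add: complete_graph_def)
  then have ne: "?I \<noteq> {}" by blast
  have "indep_vars (\<lambda>_. borel) X ?I" using iid by (simp add: iid_exp1_weights_def)
  then have "distr P (PiM ?I (\<lambda>_. borel)) (\<lambda>\<omega>. \<lambda>e\<in>?I. X e \<omega>) = PiM ?I (\<lambda>e. distr P borel (X e))"
    using indep_vars_iff_distr_eq_PiM'[where X = X and M' = "\<lambda>_. borel", OF ne rv] by simp
  also have "\<dots> = exp_weights ?I" using D by (intro PiM_cong) auto
  finally have distr: "distr P (PiM ?I (\<lambda>_. borel)) (\<lambda>\<omega>. \<lambda>e\<in>?I. X e \<omega>) = exp_weights ?I" .
  have sets_eq: "sets (exp_weights ?I) = sets (PiM ?I (\<lambda>_. borel))" by (rule sets_PiM_cong) simp_all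
  have "measure (exp_weights ?I) {x \<in> space (exp_weights ?I). \<Phi> x}
      = measure P ((\<lambda>\<omega>. \<lambda>e\<in>?I. X e \<omega>) -` {x \<in> space (exp_weights ?I). \<Phi> x} \<inter> space P)"
  proof -
    have "measure (distr P (PiM ?I (\<lambda>_. borel)) (\<lambda>\<omega>. \<lambda>e\<in>?I. X e \<omega>)) {x \<in> space (exp_weights ?I). \<Phi> x}
      = measure P ((\<lambda>\<omega>. \<lambda>e\<in>?I. X e \<omega>) -` {x \<in> space (exp_weights ?I). \<Phi> x} \<inter> space P)"
      using meas rv unfolding sets_eq by (intro measure_distr measurable_restrict) auto
    then show ?thesis unfolding distr .
  qed
  also have "(\<lambda>\<omega>. \<lambda>e\<in>?I. X e \<omega>) -` {x \<in> space (exp_weights ?I). \<Phi> x} \<inter> space P = {\<omega> \<in> space P. \<Phi> (\<lambda>e. X e \<omega>)}"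
    using local[of "\<lambda>e. X e _"] by (auto simp: space_PiM)
  finally show ?thesis by simp
qed

lemma min_factor_weight_transfer:
  assumes iid: "iid_exp1_weights n P X" and n: "2 \<le> n" and dvd: "card (verts H) dvd n"
    and H: "finite_simple_graph H" and v: "1 \<le> card (verts H)" and \<alpha>: "0 \<le> \<alpha>"
    and \<Psi>: "{y. \<Psi> y} \<in> sets borel"
  shows "measure P {\<omega> \<in> space P. \<Psi> (min_factor_weight H (\<lambda>e. X e \<omega>) (\<alpha> * real n) n)}
    = measure (edge_weights n)
        {x \<in> space (edge_weights n). \<Psi> (min_weight (factor_family \<alpha> H n) x)}"
proof -
  let ?I = "edges (complete_graph n)" and ?F = "min_weight (factor_family \<alpha> H n)"
  have F [measurable]: "?F \<in> borel_measurable (exp_weights ?I)"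
    by (rule min_weight_measurable[OF finite_factor_family factor_family_nonempty[OF H v \<alpha> dvd]
          Union_factor_family]) measurable
  have "?F -` {y. \<Psi> y} \<inter> space (exp_weights ?I) \<in> sets (exp_weights ?I)" by (rule measurable_sets[OF F \<Psi>])
  also have "?F -` {y. \<Psi> y} \<inter> space (exp_weights ?I) = {x \<in> space (exp_weights ?I). \<Psi> (?F x)}" by auto
  finally have meas: "{x \<in> space (exp_weights ?I). \<Psi> (?F x)} \<in> sets (exp_weights ?I)" .
  have local: "?F (restrict x ?I) = ?F x" for x
  proof (rule min_weight_cong)
    fix e assume "e \<in> \<Union>(factor_family \<alpha> H n)"
    then have "e \<in> ?I" using Union_factor_family by (rule subsetD[rotated])
    then show "restrict x ?I e = x e" by simp
  qed
  have "measure P {\<omega> \<in> space P. \<Psi> (?F (\<lambda>e. X e \<omega>))} = measure (exp_weights ?I) {x \<in> space (exp_weights ?I). \<Psi> (?F x)}"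
    by (rule iid_exp1_weights_transfer[OF iid n meas]) (simp only: local)
  then show ?thesis using n by (simp add: min_factor_weight_eq)
qed

text \<open>Substitute \<open>y = n powr c\<close> in \<open>y powr (- L / c) * exp (- q y) \<longlongrightarrow> 0\<close>.\<close>

lemma stretched_exp_eventually_le:
  fixes q c L \<epsilon> :: real
  assumes q: "0 < q" and c: "0 < c" and \<epsilon>: "0 < \<epsilon>"
  shows "\<forall>\<^sub>F n in sequentially. exp (- (q * real n powr c)) \<le> \<epsilon> * real n powr L"
proof -
  have "filterlim (\<lambda>n. real n powr c) at_top sequentially" using c by real_asymp
  moreover have "((\<lambda>y. y powr (- L / c) * exp (- (q * y))) \<longlongrightarrow> 0) at_top" using q by real_asymp
  ultimately have "(\<lambda>n. (real n powr c) powr (- L / c) * exp (- (q * real n powr c))) \<longlonglongrightarrow> 0"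
    by (rule filterlim_compose[rotated])
  then have "\<forall>\<^sub>F n in sequentially. (real n powr c) powr (- L / c) * exp (- (q * real n powr c)) < \<epsilon>"
    by (rule order_tendstoD) (rule \<epsilon>)
  then show ?thesis using eventually_gt_at_top[of 0]
  proof eventually_elim
    fix n :: nat
    assume lt: "(real n powr c) powr (- L / c) * exp (- (q * real n powr c)) < \<epsilon>" and n: "0 < n"
    have eq: "(real n powr c) powr (- L / c) = inverse (real n powr L)"
      using c by (simp add: powr_powr powr_minus)
    from lt have "inverse (real n powr L) * exp (- (q * real n powr c)) < \<epsilon>" unfolding eq .
    then show "exp (- (q * real n powr c)) \<le> \<epsilon> * real n powr L"
      using n by (simp add: field_simps)
  qed
qed

lemma eventually_multiples_at_top:
  "eventually A (multiples_at_top v) \<longleftrightarrow> (\<forall>\<^sub>F n in sequentially. v dvd n \<longrightarrow> A n)"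
  by (simp add: multiples_at_top_def eventually_inf_principal)

text \<open>The two tail bounds give the order of magnitude. In particular, a median \<open>M n\<close> is eventually at least
\<open>a n^(1 - 1/d) \<ge> 1\<close>, so the concentration theorem applies, and \<open>sqrt M \<le> M powr (3/4)\<close>.\<close>

theorem theorem3p1:
  fixes H :: "'a graph" and \<alpha> :: real
    and P :: "nat \<Rightarrow> 'w measure" and X :: "nat \<Rightarrow> nat set \<Rightarrow> 'w \<Rightarrow> real"
  defines "F \<equiv> (\<lambda>n \<omega>. min_factor_weight H (\<lambda>e. X n e \<omega>) (\<alpha> * real n) n)"
    and "Fl \<equiv> multiples_at_top (card (verts H))"
  assumes "finite_simple_graph H" and "2 \<le> card (verts H)" and "dstar H > 1"
    and "0 \<le> \<alpha>" and "\<alpha> < 1"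
    and "\<And>n. card (verts H) dvd n \<Longrightarrow> iid_exp1_weights n (P n) (X n)"
  shows "(\<exists>a b. 0 < a \<and> a < b \<and>
            with_overwhelming_prob Fl P
              (\<lambda>n \<omega>. a * real n powr (1 - 1 / dstar H) \<le> F n \<omega> \<and>
                     F n \<omega> \<le> b * real n powr (1 - 1 / dstar H))) \<and>
         (\<forall>M. (\<forall>n. card (verts H) dvd n \<longrightarrow> is_median (P n) (F n) (M n)) \<longrightarrow>
            bigO_in_prob Fl P (\<lambda>n \<omega>. F n \<omega> - M n) (\<lambda>n \<omega>. M n powr (3/4)))"
proof -
  note H = assms(3) and v2 = assms(4) and d = assms(5) and \<alpha> = assms(6,7) and iid = assms(8)
  have v1: "1 \<le> card (verts H)" using v2 by simp
  define \<gamma> where "\<gamma> = 1 - 1 / dstar H"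
  have \<gamma>: "0 < \<gamma>" using d by (simp add: \<gamma>_def)
  define I where "I = (\<lambda>n. edges (complete_graph n))"
  define f where "f = (\<lambda>n. min_weight (factor_family \<alpha> H n))"
  define prW where "prW = (\<lambda>n \<Psi>. measure (exp_weights (I n)) {x \<in> space (exp_weights (I n)). \<Psi> (f n x)})"
  have transfer: "measure (P n) {\<omega> \<in> space (P n). \<Psi> (F n \<omega>)} = prW n \<Psi>"
    if "card (verts H) dvd n" "2 \<le> n" "{y. \<Psi> y} \<in> sets borel" for n \<Psi>
    unfolding F_def prW_def f_def I_def
    by (rule min_factor_weight_transfer[OF iid[OF that(1)] that(2,1) H v1 \<alpha>(1) that(3)])
  have f_meas: "f n \<in> borel_measurable (exp_weights (I n))" if "card (verts H) dvd n" for n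
    unfolding f_def I_def
    by (rule min_weight_measurable[OF finite_factor_family factor_family_nonempty[OF H v1 \<alpha>(1) that]
          Union_factor_family]) measurable
  obtain b c where b: "0 < b" and c: "0 < c" and up:
    "\<forall>\<^sub>F n in sequentially. card (verts H) dvd n \<longrightarrow>
       prW n (\<lambda>y. \<not> y \<le> b * real n powr \<gamma>) \<le> 2 * real n ^ 2 * exp (- (real n powr c))"
    unfolding prW_def f_def I_def \<gamma>_def by (rule min_weight_upper_tail[OF H v2 d \<alpha>(1)])
  obtain a \<kappa> where a: "0 < a" and \<kappa>: "0 < \<kappa>" and lo:
    "\<forall>\<^sub>F n in sequentially. card (verts H) dvd n \<longrightarrow>
       prW n (\<lambda>y. \<not> a * real n powr \<gamma> \<le> y) \<le> exp (- (\<kappa> * real n)) + real n ^ 2 * exp (- real n)"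
    unfolding prW_def f_def I_def \<gamma>_def by (rule min_weight_lower_tail[OF H v2 d \<alpha>])
  have order: "with_overwhelming_prob Fl P
      (\<lambda>n \<omega>. a * real n powr \<gamma> \<le> F n \<omega> \<and> F n \<omega> \<le> (a + b) * real n powr \<gamma>)"
    unfolding with_overwhelming_prob_def Fl_def eventually_multiples_at_top
  proof (intro allI impI)
    fix K :: real assume K: "0 < K"
    have "\<forall>\<^sub>F n in sequentially. 2 * real n ^ 2 * exp (- (real n powr c))
        + (exp (- (\<kappa> * real n)) + real n ^ 2 * exp (- real n)) \<le> real n powr (- K)"
    proof -
      have "\<forall>\<^sub>F n in sequentially. exp (- (1 * real n powr c)) \<le> 1/8 * real n powr (- K - 2)"
        and "\<forall>\<^sub>F n in sequentially. exp (- (\<kappa> * real n powr 1)) \<le> 1/4 * real n powr (- K)"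
        and "\<forall>\<^sub>F n in sequentially. exp (- (1 * real n powr 1)) \<le> 1/4 * real n powr (- K - 2)"
        using c \<kappa> by (intro stretched_exp_eventually_le; simp)+
      then show ?thesis using eventually_gt_at_top[of 0]
      proof eventually_elim
        fix n :: nat
        assume 1: "exp (- (1 * real n powr c)) \<le> 1/8 * real n powr (- K - 2)"
          and 2: "exp (- (\<kappa> * real n powr 1)) \<le> 1/4 * real n powr (- K)"
          and 3: "exp (- (1 * real n powr 1)) \<le> 1/4 * real n powr (- K - 2)" and n: "0 < n"
        have sq: "real n ^ 2 * real n powr (- K - 2) = real n powr (- K)"
          using n powr_add[of "real n" 2 "- K - 2"] by (simp add: powr_numeral)
        have "2 * real n ^ 2 * exp (- (real n powr c)) \<le> 2 * real n ^ 2 * (1/8 * real n powr (- K - 2))"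
          using 1 by (intro mult_left_mono) auto
        moreover have "real n ^ 2 * exp (- real n) \<le> real n ^ 2 * (1/4 * real n powr (- K - 2))"
          using 3 n by (intro mult_left_mono) auto
        moreover have "exp (- (\<kappa> * real n)) \<le> 1/4 * real n powr (- K)" using 2 n by simp
        moreover have "0 \<le> real n powr (- K)" by simp
        ultimately show "2 * real n ^ 2 * exp (- (real n powr c))
            + (exp (- (\<kappa> * real n)) + real n ^ 2 * exp (- real n)) \<le> real n powr (- K)"
          using sq by linarith
      qed
    qed
    then show "\<forall>\<^sub>F n in sequentially. card (verts H) dvd n \<longrightarrow>
        measure (P n) {\<omega> \<in> space (P n). \<not> (a * real n powr \<gamma> \<le> F n \<omega> \<and> F n \<omega> \<le> (a + b) * real n powr \<gamma>)}
          \<le> real n powr (- K)"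
      using up lo eventually_ge_at_top[of 2]
    proof eventually_elim
      fix n :: nat
      assume small: "2 * real n ^ 2 * exp (- (real n powr c))
          + (exp (- (\<kappa> * real n)) + real n ^ 2 * exp (- real n)) \<le> real n powr (- K)"
        and u: "card (verts H) dvd n \<longrightarrow> prW n (\<lambda>y. \<not> y \<le> b * real n powr \<gamma>) \<le> 2 * real n ^ 2 * exp (- (real n powr c))"
        and l: "card (verts H) dvd n \<longrightarrow> prW n (\<lambda>y. \<not> a * real n powr \<gamma> \<le> y) \<le> exp (- (\<kappa> * real n)) + real n ^ 2 * exp (- real n)"
        and n: "2 \<le> n"
      show "card (verts H) dvd n \<longrightarrow>
        measure (P n) {\<omega> \<in> space (P n). \<not> (a * real n powr \<gamma> \<le> F n \<omega> \<and> F n \<omega> \<le> (a + b) * real n powr \<gamma>)}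
          \<le> real n powr (- K)"
      proof
        assume dvd: "card (verts H) dvd n"
        note [measurable] = f_meas[OF dvd]
        interpret prob_space "exp_weights (I n)" by (rule prob_space_exp_weights)
        let ?N = "real n powr \<gamma>"
        let ?A = "{x \<in> space (exp_weights (I n)). \<not> a * ?N \<le> f n x}" and ?B = "{x \<in> space (exp_weights (I n)). \<not> f n x \<le> b * ?N}"
        have "measure (P n) {\<omega> \<in> space (P n). \<not> (a * ?N \<le> F n \<omega> \<and> F n \<omega> \<le> (a + b) * ?N)}
            = prW n (\<lambda>y. \<not> (a * ?N \<le> y \<and> y \<le> (a + b) * ?N))"
          by (rule transfer[OF dvd n]) measurable
        also have "\<dots> \<le> measure (exp_weights (I n)) (?A \<union> ?B)"
          unfolding prW_def
        proof (rule finite_measure_mono)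
          have "b * ?N \<le> (a + b) * ?N" using a by (intro mult_right_mono) auto
          then show "{x \<in> space (exp_weights (I n)). \<not> (a * ?N \<le> f n x \<and> f n x \<le> (a + b) * ?N)} \<subseteq> ?A \<union> ?B" by auto
          show "?A \<union> ?B \<in> sets (exp_weights (I n))" by measurable
        qed
        also have "\<dots> \<le> measure (exp_weights (I n)) ?A + measure (exp_weights (I n)) ?B"
          by (intro measure_Un_le) measurable
        also have "\<dots> \<le> real n powr (- K)"
          using u l dvd small unfolding prW_def by simp
        finally show "measure (P n) {\<omega> \<in> space (P n). \<not> (a * ?N \<le> F n \<omega> \<and> F n \<omega> \<le> (a + b) * ?N)}
          \<le> real n powr (- K)" .
      qed
    qed
  qed
  have conc: "bigO_in_prob Fl P (\<lambda>n \<omega>. F n \<omega> - M n) (\<lambda>n \<omega>. M n powr (3/4))"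
    if med: "\<forall>n. card (verts H) dvd n \<longrightarrow> is_median (P n) (F n) (M n)" for M
    unfolding bigO_in_prob_def Fl_def eventually_multiples_at_top
  proof (intro allI impI)
    fix \<epsilon> :: real assume \<epsilon>: "0 < \<epsilon>"
    obtain C where C: "\<And>(I :: nat set set) \<F> m.
      \<lbrakk>finite I; finite \<F>; \<F> \<noteq> {}; \<Union>\<F> \<subseteq> I; 1 \<le> m;
       1/2 \<le> measure (exp_weights I) {x \<in> space (exp_weights I). min_weight \<F> x \<le> m};
       1/2 \<le> measure (exp_weights I) {x \<in> space (exp_weights I). m \<le> min_weight \<F> x}\<rbrakk>
      \<Longrightarrow> measure (exp_weights I) {x \<in> space (exp_weights I). \<bar>min_weight \<F> x - m\<bar> > C * sqrt m} < \<epsilon>"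
      using min_weight_concentration[OF \<epsilon>] by blast
    have ev1: "\<forall>\<^sub>F n in sequentially. exp (- (\<kappa> * real n)) + real n ^ 2 * exp (- real n) < 1/2"
    proof -
      have "(\<lambda>n. exp (- (\<kappa> * real n))) \<longlonglongrightarrow> 0" using \<kappa> by real_asymp
      moreover have "(\<lambda>n. real n ^ 2 * exp (- real n)) \<longlonglongrightarrow> 0" by real_asymp
      ultimately have "(\<lambda>n. exp (- (\<kappa> * real n)) + real n ^ 2 * exp (- real n)) \<longlonglongrightarrow> 0 + 0"
        by (rule tendsto_add)
      then show ?thesis by (rule order_tendstoD) simp
    qed
    have ev2: "\<forall>\<^sub>F n in sequentially. 1 \<le> a * real n powr \<gamma>"
      using a \<gamma> by real_asymp
    from ev1 ev2 lo eventually_ge_at_top[of 2]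
    have "\<forall>\<^sub>F n in sequentially. card (verts H) dvd n \<longrightarrow>
        measure (P n) {\<omega> \<in> space (P n). \<bar>F n \<omega> - M n\<bar> > \<bar>C\<bar> * \<bar>M n powr (3/4)\<bar>} < \<epsilon>"
    proof eventually_elim
      fix n :: nat
      assume small: "exp (- (\<kappa> * real n)) + real n ^ 2 * exp (- real n) < 1/2"
        and big: "1 \<le> a * real n powr \<gamma>"
        and l: "card (verts H) dvd n \<longrightarrow> prW n (\<lambda>y. \<not> a * real n powr \<gamma> \<le> y) \<le> exp (- (\<kappa> * real n)) + real n ^ 2 * exp (- real n)"
        and n: "2 \<le> n"
      show "card (verts H) dvd n \<longrightarrow>
        measure (P n) {\<omega> \<in> space (P n). \<bar>F n \<omega> - M n\<bar> > \<bar>C\<bar> * \<bar>M n powr (3/4)\<bar>} < \<epsilon>"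
      proof
        assume dvd: "card (verts H) dvd n"
        note [measurable] = f_meas[OF dvd]
        interpret prob_space "exp_weights (I n)" by (rule prob_space_exp_weights)
        have med_n: "is_median (P n) (F n) (M n)" using med dvd by simp
        have m1: "1/2 \<le> prW n (\<lambda>y. y \<le> M n)"
          using med_n transfer[OF dvd n, of "\<lambda>y. y \<le> M n"] by (simp add: is_median_def)
        have m2: "1/2 \<le> prW n (\<lambda>y. M n \<le> y)"
          using med_n transfer[OF dvd n, of "\<lambda>y. M n \<le> y"] by (simp add: is_median_def)
        have "a * real n powr \<gamma> \<le> M n"
        proof (rule ccontr)
          assume "\<not> a * real n powr \<gamma> \<le> M n"
          then have "prW n (\<lambda>y. y \<le> M n) \<le> prW n (\<lambda>y. \<not> a * real n powr \<gamma> \<le> y)"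
            unfolding prW_def by (intro finite_measure_mono) auto
          then show False using m1 l dvd small by simp
        qed
        then have M1: "1 \<le> M n" using big by linarith
        have "prW n (\<lambda>y. \<bar>y - M n\<bar> > C * sqrt (M n)) < \<epsilon>"
          unfolding prW_def f_def
        proof (rule C[OF _ finite_factor_family factor_family_nonempty[OF H v1 \<alpha>(1) dvd] _ M1])
          show "finite (I n)" by (simp add: I_def)
          show "\<Union>(factor_family \<alpha> H n) \<subseteq> I n" unfolding I_def by (rule Union_factor_family)
        qed (use m1 m2 in \<open>simp_all add: prW_def f_def\<close>)
        moreover have "prW n (\<lambda>y. \<bar>y - M n\<bar> > \<bar>C\<bar> * \<bar>M n powr (3/4)\<bar>) \<le> prW n (\<lambda>y. \<bar>y - M n\<bar> > C * sqrt (M n))"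
        proof -
          have "sqrt (M n) \<le> M n powr (3/4)"
            using M1 by (simp add: powr_half_sqrt[symmetric] powr_mono)
          then have "C * sqrt (M n) \<le> \<bar>C\<bar> * \<bar>M n powr (3/4)\<bar>"
            using M1 by (intro mult_mono) auto
          then show ?thesis
            unfolding prW_def by (intro finite_measure_mono) auto
        qed
        moreover have "measure (P n) {\<omega> \<in> space (P n). \<bar>F n \<omega> - M n\<bar> > \<bar>C\<bar> * \<bar>M n powr (3/4)\<bar>}
            = prW n (\<lambda>y. \<bar>y - M n\<bar> > \<bar>C\<bar> * \<bar>M n powr (3/4)\<bar>)"
          by (rule transfer[OF dvd n]) measurable
        ultimately show "measure (P n) {\<omega> \<in> space (P n). \<bar>F n \<omega> - M n\<bar> > \<bar>C\<bar> * \<bar>M n powr (3/4)\<bar>} < \<epsilon>"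
          by linarith
      qed
    qed
    then show "\<exists>C. \<forall>\<^sub>F n in sequentially. card (verts H) dvd n \<longrightarrow>
        measure (P n) {\<omega> \<in> space (P n). \<bar>F n \<omega> - M n\<bar> > C * \<bar>M n powr (3/4)\<bar>} < \<epsilon>"
      by (intro exI[of _ "\<bar>C\<bar>"])
  qed
  show ?thesis
  proof (intro conjI allI impI)
    show "\<exists>a b. 0 < a \<and> a < b \<and> with_overwhelming_prob Fl P
        (\<lambda>n \<omega>. a * real n powr (1 - 1 / dstar H) \<le> F n \<omega> \<and> F n \<omega> \<le> b * real n powr (1 - 1 / dstar H))"
      using order a b unfolding \<gamma>_def by (intro exI[of _ a] exI[of _ "a + b"]) simp
  qed (rule conc)
qed

end
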